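(* Let all the assumptions on $\tau,\alpha,b,c,\mathcal A,g,H,y,\alpha_0,\bar\delta$ listed in the context hold. If $(u_0,u_1,u_2)\in\mathcal D(\mathcal A^{1/2})\times\mathcal D(\mathcal A^{1/2})\times X$, then the system $$\tau u_{ttt}+\alpha u_{tt}+c^2\mathcal A u+b\mathcal A u_t-\int_0^t g(t-s)\mathcal A u(s)\,ds=0,\qquad u(0)=u_0,\ u_t(0)=u_1,\ u_{tt}(0)=u_2,$$ has a unique weak solution $u$ satisfying $$u\in C^1(\mathbb R_+;\mathcal D(\mathcal A^{1/2}))\cap C^2(\mathbb R_+;X).$$
   Context: $X$ is a real Hilbert space with inner product $(\cdot,\cdot)$ and norm $\|\cdot\|$; $\mathcal A$ is a positive self-adjoint operator on $X$ with dense domain; $\tau,\alpha,b,c>0$ are constants; $\mathbb R_+=[0,\infty)$. Assumptions. Put $\gamma=\alpha-\frac{c^2\tau}{b}$ and $G(t)=\int_0^t g(s)\,ds$. (1) $g\in C^1(\mathbb R_+)$, $g(t)>0$, $g(0)<\frac{b\alpha\gamma}{\tau^2}$ and $G(+\infty)<c^2$. (2) There is a convex, strictly increasing function $H\in C^1(\mathbb R_+)$ with $H(0)=0$ such that $g'(t)+H(g(t))\le 0$ for all $t>0$. (3) $y$ is the solution of $y'(t)+H(y(t))=0$, $y(0)=g(0)$, and there is $\alpha_0\in(0,1)$ with $y^{1-\alpha_0}\in L_1(\mathbb R_+)$. (4) There is $\bar\delta>0$ such that $H\in C^2(0,\bar\delta)$ and $x^2H''(x)-xH'(x)+H(x)\ge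 0$ for all $x\in(0,\bar\delta)$. (5) There is $\lambda_0>0$ with $\|v\|\le\lambda_0\|\mathcal A^{1/2}v\|$ for all $v\in\mathcal D(\mathcal A^{1/2})$. (6) $\gamma>0$. Weak solution: a function $u$ in the regularity class $C^1(\mathbb R_+;\mathcal D(\mathcal A^{1/2}))\cap C^2(\mathbb R_+;X)$ attaining the initial data and such that for every $v\in\mathcal D(\mathcal A^{1/2})$, in the sense of distributions in $t>0$, $$\tau\tfrac{d}{dt}(u_{tt},v)+\alpha(u_{tt},v)+c^2(\mathcal A^{1/2}u,\mathcal A^{1/2}v)+b(\mathcal A^{1/2}u_t,\mathcal A^{1/2}v)-\int_0^tg(t-s)(\mathcal A^{1/2}u(s),\mathcal A^{1/2}v)\,ds=0 .$$ Here $\mathcal D(\mathcal A^{1/2})$ carries the graph norm. *)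

theory Defs
  imports "HOL-Analysis.Analysis"
begin

section \<open>Unbounded operators on a real Hilbert space\<close>

text \<open>
  An unbounded operator is given by its domain \<open>D\<close> together with a total function \<open>A\<close> of
  which only the values on \<open>D\<close> are meaningful.
\<close>

definition linear_operator_on :: "'a::real_vector set \<Rightarrow> ('a \<Rightarrow> 'b::real_vector) \<Rightarrow> bool" where
  "linear_operator_on D A \<longleftrightarrow>
     subspace D \<and>
     (\<forall>x\<in>D. \<forall>y\<in>D. A (x + y) = A x + A y) \<and>
     (\<forall>x\<in>D. \<forall>r. A (r *\<^sub>R x) = r *\<^sub>R A x)"

definition operator_graph :: "'a set \<Rightarrow> ('a \<Rightarrow> 'b) \<Rightarrow> ('a \<times> 'b) set" where
  "operator_graph D A = {(x, A x) | x. x \<in> D}"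

text \<open>
  The graph of the adjoint; it is the graph of a function as soon as \<open>D\<close> is dense.
\<close>

definition adjoint_graph :: "'a::real_inner set \<Rightarrow> ('a \<Rightarrow> 'a) \<Rightarrow> ('a \<times> 'a) set" where
  "adjoint_graph D A = {(v, w). \<forall>x\<in>D. inner (A x) v = inner x w}"

definition self_adjoint_operator :: "'a::real_inner set \<Rightarrow> ('a \<Rightarrow> 'a) \<Rightarrow> bool" where
  "self_adjoint_operator D A \<longleftrightarrow>
     linear_operator_on D A \<and> closure D = UNIV \<and> operator_graph D A = adjoint_graph D A"

definition positive_operator :: "'a::real_inner set \<Rightarrow> ('a \<Rightarrow> 'a) \<Rightarrow> bool" where
  "positive_operator D A \<longleftrightarrow> (\<forall>x\<in>D. 0 \<le> inner (A x) x)"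

text \<open>
  \<open>(E, S)\<close> is the square root of \<open>(D, A)\<close>: the positive self-adjoint operator whose square,
  taken with its natural domain, is \<open>(D, A)\<close>. For a positive self-adjoint \<open>(D, A)\<close> it exists and
  determines \<open>E\<close>, and \<open>S\<close> on \<open>E\<close>, uniquely.
\<close>

definition is_operator_sqrt ::
  "'a::real_inner set \<Rightarrow> ('a \<Rightarrow> 'a) \<Rightarrow> 'a set \<Rightarrow> ('a \<Rightarrow> 'a) \<Rightarrow> bool" where
  "is_operator_sqrt E S D A \<longleftrightarrow>
     self_adjoint_operator E S \<and> positive_operator E S \<and>
     D = {x \<in> E. S x \<in> E} \<and> (\<forall>x\<in>D. A x = S (S x))"


section \<open>Continuously differentiable functions on the half-line\<close>

text \<open>
  \<open>f\<close> is of class $C^1$ on \<open>[0, \<infinity>)\<close> with derivative \<open>f'\<close>; the derivative is one-sided at 0, and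
  values at negative arguments are irrelevant.
\<close>

definition C1_halfline :: "(real \<Rightarrow> 'a::real_normed_vector) \<Rightarrow> (real \<Rightarrow> 'a) \<Rightarrow> bool" where
  "C1_halfline f f' \<longleftrightarrow>
     (\<forall>t\<ge>0. (f has_vector_derivative f' t) (at t within {0..})) \<and> continuous_on {0..} f'"

definition C2_halfline ::
  "(real \<Rightarrow> 'a::real_normed_vector) \<Rightarrow> (real \<Rightarrow> 'a) \<Rightarrow> (real \<Rightarrow> 'a) \<Rightarrow> bool" where
  "C2_halfline f f' f'' \<longleftrightarrow> C1_halfline f f' \<and> C1_halfline f' f''"

text \<open>
  The class $C^1$ on \<open>[0, \<infinity>)\<close> with values in \<open>E\<close>, where \<open>E\<close> carries the graph norm of \<open>S\<close>:
  \<open>x \<mapsto> (x, S x)\<close> is an isometry of \<open>E\<close> with this norm onto the graph of \<open>S\<close> in the product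
  space, whose norm is \<open>sqrt (\<parallel>x\<parallel>\<^sup>2 + \<parallel>S x\<parallel>\<^sup>2)\<close>.
\<close>

definition C1_halfline_graph ::
  "'a::real_normed_vector set \<Rightarrow> ('a \<Rightarrow> 'a) \<Rightarrow> (real \<Rightarrow> 'a) \<Rightarrow> (real \<Rightarrow> 'a) \<Rightarrow> bool" where
  "C1_halfline_graph E S f f' \<longleftrightarrow>
     (\<forall>t\<ge>0. f t \<in> E \<and> f' t \<in> E) \<and>
     C1_halfline (\<lambda>t. (f t, S (f t))) (\<lambda>t. (f' t, S (f' t)))"


section \<open>Weak solutions\<close>

definition test_function :: "(real \<Rightarrow> real) \<Rightarrow> bool" where
  "test_function \<phi> \<longleftrightarrow>
     (\<forall>n t. ((deriv ^^ n) \<phi>) differentiable (at t)) \<and>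
     compact (closure {t. \<phi> t \<noteq> 0}) \<and> closure {t. \<phi> t \<noteq> 0} \<subseteq> {0<..}"

text \<open>
  \<open>u'\<close> and \<open>u''\<close> stand for $u_t$ and $u_{tt}$, and \<open>(E, S)\<close> for the square root of the
  operator in the equation. The distributional derivative of $(u_{tt}, v)$ has been moved onto
  the test function.
\<close>

definition weak_solution ::
  "'a::real_inner set \<Rightarrow> ('a \<Rightarrow> 'a) \<Rightarrow> real \<Rightarrow> real \<Rightarrow> real \<Rightarrow> real \<Rightarrow> (real \<Rightarrow> real) \<Rightarrow>
   'a \<Rightarrow> 'a \<Rightarrow> 'a \<Rightarrow> (real \<Rightarrow> 'a) \<Rightarrow> bool" where
  "weak_solution E S \<tau> \<alpha> b c g u0 u1 u2 u \<longleftrightarrow>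
     (\<exists>u' u''.
        C1_halfline_graph E S u u' \<and>
        C2_halfline u u' u'' \<and>
        u 0 = u0 \<and> u' 0 = u1 \<and> u'' 0 = u2 \<and>
        (\<forall>v\<in>E. \<forall>\<phi>. test_function \<phi> \<longrightarrow>
           integral {0..} (\<lambda>t.
             - \<tau> * inner (u'' t) v * deriv \<phi> t
             + (\<alpha> * inner (u'' t) v
                + c\<^sup>2 * inner (S (u t)) (S v)
                + b * inner (S (u' t)) (S v)
                - integral {0..t} (\<lambda>s. g (t - s) * inner (S (u s)) (S v))) * \<phi> t) = 0))"

end

theory Submission
  imports Defs
begin

text \<open>
  Let \<open>S\<close> be the square root of the operator and \<open>K = S\<^sup>-\<^sup>1\<close>, a bounded positive self-adjoint operator.
  Writing \<open>u = K U\<close>, \<open>u_t = K V\<close>, \<open>u_tt = P\<close>, the weak equation becomes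
  \<open>U' = V\<close>, \<open>(K V)' = P\<close>, \<open>\<tau> (K P)' = - \<alpha> K P - c\<^sup>2 U - b V + g * U\<close>, where the third equation
  comes from the distributional one by the du Bois-Reymond lemma. Replacing \<open>K\<close> by \<open>K + \<epsilon>\<close> gives a linear
  Volterra equation with bounded coefficients. The variable \<open>Z = V + (c\<^sup>2/b) U - (1/b) g * U\<close> turns it
  into a wave equation with bounded perturbations, whose energy satisfies an estimate uniform in \<open>\<epsilon>\<close>.
  For data in the range of \<open>K\<^sup>2\<close> the estimate and the resolvent identity make the
  approximations Cauchy as \<open>\<epsilon> \<rightarrow> 0\<close>, and by density this extends to all data. Applied to
  \<open>K\<^sup>2 (U, V, P)\<close> with vanishing data, the same estimate gives uniqueness.
\<close>

section \<open>Convolution\<close>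

text \<open>For \<open>Q = S\<close> itself the energy could not be differentiated: a weak solution
  has \<open>P\<close> merely continuous in X, and \<open>Q (P t)\<close> need not make sense. The
  inverse of \<open>K + e\<close> is bounded, symmetric and commutes with \<open>K\<close>, so every
  computation is legitimate, and symmetry removes it from the energy balance. What is lost as e -> 0
  is a bound on the operator, whose norm may grow like 1/e. Two facts replace it:
  \<open>Q e (K x)\<close> never exceeds \<open>x\<close> in norm, and \<open>Q e - Q d\<close>
  equals \<open>d - e\<close> times \<open>Q e\<close> composed with \<open>Q d\<close>. Comparing
  two approximations thus costs two powers of the resolvent, and data \<open>K (K x)\<close> pay for
  both: the resolvents commute with the equation, so their product maps a solution to a solution
  whose data are bounded by \<open>x\<close>. Uniqueness needs two factors \<open>K\<close> for a
  similar reason: one makes \<open>P\<close> differentiable in X, the other bounds the error of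
  writing \<open>Q e\<close> in place of the inverse of \<open>K\<close>. The derivative of
  \<open>g\<close> enters because \<open>Z\<close> contains the convolution.\<close>

definition conv :: "(real \<Rightarrow> real) \<Rightarrow> (real \<Rightarrow> 'a::real_normed_vector) \<Rightarrow> real \<Rightarrow> 'a" where
  "conv g U t = integral {0..t} (\<lambda>s. g (t - s) *\<^sub>R U s)"

lemma C1_halfline_continuous:
  assumes "C1_halfline f f'"
  shows "continuous_on {0..} f"
  using assms unfolding C1_halfline_def continuous_on_eq_continuous_within
  by (auto intro: has_vector_derivative_continuous)

lemma continuous_on_conv_integrand:
  fixes U :: "real \<Rightarrow> 'a::real_normed_vector"
  assumes "continuous_on {0..} g" "continuous_on {0..} U" "0 \<le> x" "y \<le> t"
  shows "continuous_on {x..y} (\<lambda>s. g (t - s) *\<^sub>R U s)"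
  using assms
  by (auto intro!: continuous_intros continuous_on_compose2[OF assms(1)]
      continuous_on_subset[OF assms(2)])

lemma conv_integrable:
  fixes U :: "real \<Rightarrow> 'a::banach"
  assumes "continuous_on {0..} g" "continuous_on {0..} U" "0 \<le> x" "y \<le> t"
  shows "(\<lambda>s. g (t - s) *\<^sub>R U s) integrable_on {x..y}"
  by (intro integrable_continuous_real continuous_on_conv_integrand assms)

lemma bounded_on_initial_interval:
  fixes f :: "real \<Rightarrow> 'a::real_normed_vector"
  assumes "continuous_on {0..} f"
  obtains M where "M \<ge> 0" "\<And>t. 0 \<le> t \<Longrightarrow> t \<le> T \<Longrightarrow> norm (f t) \<le> M"
proof -
  have "compact (f ` {0..T})"
    by (intro compact_continuous_image continuous_on_subset[OF assms]) auto
  then obtain M where M: "\<And>x. x \<in> f ` {0..T} \<Longrightarrow> norm x \<le> M"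
    using compact_imp_bounded bounded_iff by metis
  then have "norm (f t) \<le> max M 0" if "0 \<le> t" "t \<le> T" for t
    using that M[of "f t"] by (simp add: le_max_iff_disj)
  then show ?thesis by (intro that[of "max M 0"]) auto
qed

lemma norm_conv_le:
  fixes U :: "real \<Rightarrow> 'a::banach"
  assumes "continuous_on {0..} g" "continuous_on {0..} U" "0 \<le> t"
    and "\<And>s. 0 \<le> s \<Longrightarrow> s \<le> t \<Longrightarrow> norm (g s) \<le> M"
  shows "norm (conv g U t) \<le> M * integral {0..t} (\<lambda>s. norm (U s))"
proof -
  have "norm (conv g U t) \<le> integral {0..t} (\<lambda>s. M * norm (U s))"
    unfolding conv_def
  proof (rule integral_norm_bound_integral)
    show "(\<lambda>s. g (t - s) *\<^sub>R U s) integrable_on {0..t}"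
      by (intro conv_integrable assms) auto
    show "(\<lambda>s. M * norm (U s)) integrable_on {0..t}"
      by (intro integrable_continuous_real continuous_intros continuous_on_subset[OF assms(2)]) auto
    show "norm (g (t - s) *\<^sub>R U s) \<le> M * norm (U s)" if "s \<in> {0..t}" for s
      using that assms(4)[of "t - s"] by (auto intro!: mult_right_mono)
  qed
  then show ?thesis by simp
qed

lemma conv_diff:
  fixes U V :: "real \<Rightarrow> 'a::banach"
  assumes "continuous_on {0..} g" "continuous_on {0..} U" "continuous_on {0..} V" "0 \<le> t"
  shows "conv g (\<lambda>s. U s - V s) t = conv g U t - conv g V t"
  unfolding conv_def scaleR_diff_right
  by (intro integral_diff conv_integrable assms) auto

lemma conv_linear:
  fixes U :: "real \<Rightarrow> 'a::banach" and L :: "'a \<Rightarrow> 'b::banach"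
  assumes "bounded_linear L" "continuous_on {0..} g" "continuous_on {0..} U" "0 \<le> t"
  shows "L (conv g U t) = conv g (\<lambda>s. L (U s)) t"
proof -
  have "integral {0..t} (L \<circ> (\<lambda>s. g (t - s) *\<^sub>R U s)) = L (conv g U t)"
    unfolding conv_def
    by (intro integral_linear conv_integrable assms) auto
  then show ?thesis
    by (simp add: conv_def o_def linear_cmul[OF bounded_linear.linear[OF assms(1)]])
qed

text \<open>The kernel is extended to an affine function on the negative axis, which makes the integrand
  differentiable in \<open>t\<close> on both sides of the upper limit.\<close>

lemma conv_has_vector_derivative:
  fixes U :: "real \<Rightarrow> 'a::banach"
  assumes g: "C1_halfline g g'" and U: "continuous_on {0..} U" and a: "0 \<le> a"
  shows "(conv g U has_vector_derivative (g 0 *\<^sub>R U a + conv g' U a)) (at a within {0..})"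
proof -
  define h where "h x = (if x \<in> {0..} then g x else g 0 + x * g' 0)" for x
  define h' where "h' x = (if x \<in> {0..} then g' x else g' 0)" for x
  have g': "continuous_on {0..} g'" using g by (simp add: C1_halfline_def)
  have gd: "(g has_vector_derivative g' x) (at x within {0..})" if "x \<ge> 0" for x
    using g that by (simp add: C1_halfline_def)
  have hd: "(h has_vector_derivative h' x) (at x)" for x
  proof -
    have "((\<lambda>x. if x \<in> {0..} then g x else g 0 + x * g' 0) has_vector_derivative
        (if x \<in> {0..} then g' x else g' 0)) (at x within UNIV)"
    proof (rule has_vector_derivative_If_within_closures[where S = "{0..}" and T = "{..0}"])
      have sets: "{0..} \<union> (closure {0..} \<inter> closure {..0}) = {0::real..}" by auto
      show "(g has_vector_derivative g' x) (at x within {0..} \<union> (closure {0..} \<inter> closure {..0}))"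
        if "x \<in> {0..} \<union> (closure {0..} \<inter> closure {..0})"
        unfolding sets using gd that by auto
    qed (auto intro!: derivative_eq_intros)
    then show ?thesis by (simp add: h_def[abs_def] h'_def)
  qed
  have hcont: "continuous_on UNIV h"
    using hd by (meson continuous_at_imp_continuous_on has_vector_derivative_continuous)
  have h'cont: "continuous_on UNIV h'"
  proof -
    have "continuous_on ({0..} \<union> {..0}) h'"
      unfolding h'_def[abs_def]
      by (rule continuous_on_If) (use g' in \<open>auto intro: continuous_on_subset\<close>)
    moreover have "{0..} \<union> {..0::real} = UNIV" by auto
    ultimately show ?thesis by simp
  qed
  have ch: "conv g U t = integral {0..t} (\<lambda>s. h (t - s) *\<^sub>R U s)" for t
    unfolding conv_def by (rule integral_cong) (auto simp: h_def)
  have cont: "continuous_on {0..x} (\<lambda>s. h (t - s) *\<^sub>R U s)" for t x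
    by (intro continuous_intros continuous_on_compose2[OF hcont] continuous_on_subset[OF U]) auto
  have 1: "((\<lambda>t. integral {0..a} (\<lambda>s. h (t - s) *\<^sub>R U s)) has_vector_derivative conv g' U a) (at a)"
  proof -
    have "((\<lambda>t. integral (cbox 0 a) (\<lambda>s. h (t - s) *\<^sub>R U s)) has_vector_derivative
        integral (cbox 0 a) (\<lambda>s. h' (a - s) *\<^sub>R U s)) (at a within UNIV)"
    proof (rule leibniz_rule_vector_derivative)
      fix x t
      show "((\<lambda>x. h (x - t) *\<^sub>R U t) has_vector_derivative h' (x - t) *\<^sub>R U t) (at x within UNIV)"
      proof -
        have "((\<lambda>x. x - t) has_vector_derivative 1) (at x)"
          by (auto intro!: derivative_eq_intros)
        from vector_diff_chain_at[OF this hd]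
        have "((\<lambda>x. h (x - t)) has_vector_derivative h' (x - t)) (at x)"
          by (simp add: o_def)
        then show ?thesis
          by (auto simp: has_real_derivative_iff_has_vector_derivative[symmetric]
              intro!: derivative_eq_intros)
      qed
    next
      fix x show "(\<lambda>s. h (x - s) *\<^sub>R U s) integrable_on cbox 0 a"
        using cont by (simp add: integrable_continuous_real)
    next
      show "continuous_on (UNIV \<times> cbox 0 a) (\<lambda>(x, t). h' (x - t) *\<^sub>R U t)"
        unfolding split_beta
        by (intro continuous_intros continuous_on_compose2[OF h'cont] continuous_on_compose2[OF U]) auto
    qed auto
    moreover have "integral (cbox 0 a) (\<lambda>s. h' (a - s) *\<^sub>R U s) = conv g' U a"
      unfolding conv_def by (simp, rule integral_cong) (auto simp: h'_def)
    ultimately show ?thesis by simp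
  qed
  \<comment> \<open>Differentiating with the upper limit frozen at \<open>a\<close> gives
    \<open>conv g' U a\<close>. What remains, \<open>k\<close>, is the integral over the short
    interval between \<open>a\<close> and \<open>t\<close>, where joint continuity at
    \<open>(a, a)\<close> keeps the integrand close to \<open>g 0 *\<^sub>R U a\<close>. Points
    \<open>t < a\<close> must be treated too, which is where the extension of the kernel is
    used.\<close>
  define k where "k t = conv g U t - integral {0..a} (\<lambda>s. h (t - s) *\<^sub>R U s)" for t
  have h0: "h 0 = g 0" by (simp add: h_def)
  have 2: "(k has_vector_derivative g 0 *\<^sub>R U a) (at a within {0..})"
    unfolding has_vector_derivative_def has_derivative_within_alt
  proof (intro conjI allI impI)
    show "bounded_linear (\<lambda>x. x *\<^sub>R g 0 *\<^sub>R U a)" by (rule bounded_linear_scaleR_left)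
    fix e :: real assume e: "e > 0"
    have c2: "continuous_on ({0..} \<times> {0..}) (\<lambda>p. h (fst p - snd p) *\<^sub>R U (snd p))"
      by (intro continuous_intros continuous_on_compose2[OF hcont] continuous_on_compose2[OF U]) auto
    obtain d where d: "d > 0"
      "\<And>p. p \<in> {0..} \<times> {0..} \<Longrightarrow> dist p (a, a) < d \<Longrightarrow>
        dist (h (fst p - snd p) *\<^sub>R U (snd p)) (h (a - a) *\<^sub>R U a) < e"
      using c2[unfolded continuous_on_iff, rule_format, of "(a, a)" e] a e by auto
    have near: "norm (h (t - s) *\<^sub>R U s - g 0 *\<^sub>R U a) \<le> e"
      if "t \<ge> 0" "s \<ge> 0" "\<bar>t - a\<bar> < d / 2" "\<bar>s - a\<bar> \<le> \<bar>t - a\<bar>" for t s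
    proof -
      have "dist (t, s) (a, a) \<le> \<bar>t - a\<bar> + \<bar>s - a\<bar>"
        unfolding dist_Pair_Pair dist_real_def
        using sqrt_sum_squares_le_sum_abs[of "\<bar>t - a\<bar>" "\<bar>s - a\<bar>"] by simp
      then have "dist (t, s) (a, a) < d" using that by linarith
      then have "dist (h (t - s) *\<^sub>R U s) (h (a - a) *\<^sub>R U a) < e"
        using d(2)[of "(t, s)"] that(1,2) by simp
      then show ?thesis by (simp add: dist_norm h0)
    qed
    show "\<exists>d>0. \<forall>t\<in>{0..}. norm (t - a) < d \<longrightarrow>
        norm (k t - k a - (t - a) *\<^sub>R g 0 *\<^sub>R U a) \<le> e * norm (t - a)"
    proof (intro exI conjI ballI impI)
      show "d / 2 > 0" using d by simp
      fix t :: real assume t: "t \<in> {0..}" "norm (t - a) < d / 2"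
      have ka: "k a = 0" by (simp add: k_def ch)
      show "norm (k t - k a - (t - a) *\<^sub>R g 0 *\<^sub>R U a) \<le> e * norm (t - a)"
      proof (cases "a \<le> t")
        case True
        have int: "(\<lambda>s. h (t - s) *\<^sub>R U s) integrable_on {a..t}"
          by (rule integrable_on_subinterval[OF integrable_continuous_real[OF cont[of t t]]])
             (use a in auto)
        have "integral {0..a} (\<lambda>s. h (t - s) *\<^sub>R U s) + integral {a..t} (\<lambda>s. h (t - s) *\<^sub>R U s)
            = conv g U t"
          unfolding ch using a True by (intro Henstock_Kurzweil_Integration.integral_combine integrable_continuous_real cont) auto
        then have "k t = integral {a..t} (\<lambda>s. h (t - s) *\<^sub>R U s)" by (simp add: k_def algebra_simps)
        then have "k t - (t - a) *\<^sub>R g 0 *\<^sub>R U a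
            = integral {a..t} (\<lambda>s. h (t - s) *\<^sub>R U s - g 0 *\<^sub>R U a)"
          using True int by (subst Henstock_Kurzweil_Integration.integral_diff) auto
        also have "norm \<dots> \<le> integral {a..t} (\<lambda>s. e)"
          by (rule integral_norm_bound_integral) (use int near t True a in \<open>auto intro: integrable_diff\<close>)
        finally show ?thesis using True unfolding ka diff_zero by (simp add: mult.commute)
      next
        case False
        then have ta: "t \<le> a" by simp
        have int: "(\<lambda>s. h (t - s) *\<^sub>R U s) integrable_on {t..a}"
          by (rule integrable_on_subinterval[OF integrable_continuous_real[OF cont[of a t]]])
             (use t in auto)
        have "conv g U t + integral {t..a} (\<lambda>s. h (t - s) *\<^sub>R U s)
            = integral {0..a} (\<lambda>s. h (t - s) *\<^sub>R U s)"
          unfolding ch using t ta by (intro Henstock_Kurzweil_Integration.integral_combine integrable_continuous_real cont) auto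
        then have "k t = - integral {t..a} (\<lambda>s. h (t - s) *\<^sub>R U s)" by (simp add: k_def algebra_simps)
        then have "k t - (t - a) *\<^sub>R g 0 *\<^sub>R U a
            = - integral {t..a} (\<lambda>s. h (t - s) *\<^sub>R U s - g 0 *\<^sub>R U a)"
          using ta int by (subst Henstock_Kurzweil_Integration.integral_diff) (auto simp: algebra_simps)
        also have "norm \<dots> \<le> integral {t..a} (\<lambda>s. e)"
          unfolding norm_minus_cancel
          by (rule integral_norm_bound_integral) (use int near t ta a in \<open>auto intro: integrable_diff\<close>)
        finally show ?thesis using ta unfolding ka diff_zero by (simp add: mult.commute)
      qed
    qed
  qed
  have "((\<lambda>t. k t + integral {0..a} (\<lambda>s. h (t - s) *\<^sub>R U s)) has_vector_derivative
      g 0 *\<^sub>R U a + conv g' U a) (at a within {0..})"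
    by (intro has_vector_derivative_add 2 has_vector_derivative_at_within[OF 1])
  then show ?thesis by (simp add: k_def)
qed

lemma continuous_on_conv:
  fixes U :: "real \<Rightarrow> 'a::banach"
  assumes g: "C1_halfline g g'" and U: "continuous_on {0..} U"
  shows "continuous_on {0..} (conv g U)"
  using conv_has_vector_derivative[OF assms]
  by (auto simp: continuous_on_eq_continuous_within intro: has_vector_derivative_continuous)

section \<open>Linear Volterra equations\<close>

lemma at_within_halfline:
  fixes t T :: real
  assumes "0 \<le> t" "t < T"
  shows "at t within {0..} = at t within {0..T}"
  by (rule at_within_nhd[of t "{..<T}"]) (use assms in auto)

lemma continuous_on_halflineI:
  fixes f :: "real \<Rightarrow> 'a::topological_space"
  assumes "\<And>T. 0 \<le> T \<Longrightarrow> continuous_on {0..T} f"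
  shows "continuous_on {0..} f"
proof -
  have "continuous (at t within {0..}) f" if "0 \<le> t" for t
    using assms[of "t + 1"] that at_within_halfline[of t "t + 1"]
    by (simp add: continuous_on_eq_continuous_within)
  then show ?thesis by (simp add: continuous_on_eq_continuous_within)
qed

lemma integral_has_vector_derivative_halfline:
  fixes f :: "real \<Rightarrow> 'a::banach"
  assumes "continuous_on {0..} f" "0 \<le> t"
  shows "((\<lambda>u. integral {0..u} f) has_vector_derivative f t) (at t within {0..})"
  using assms at_within_halfline[of t "t + 1"]
    integral_has_vector_derivative[OF continuous_on_subset[OF assms(1)], of 0 "t + 1" t]
  by auto

lemma continuous_on_integral_halfline:
  fixes f :: "real \<Rightarrow> 'a::banach"
  assumes "continuous_on {0..} f"
  shows "continuous_on {0..} (\<lambda>u. integral {0..u} f)"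
  using integral_has_vector_derivative_halfline[OF assms]
  by (auto simp: continuous_on_eq_continuous_within intro: has_vector_derivative_continuous)

lemma integral_mono_upper:
  fixes f :: "real \<Rightarrow> real"
  assumes "continuous_on {0..} f" "\<And>s. 0 \<le> s \<Longrightarrow> 0 \<le> f s" "0 \<le> s" "s \<le> t"
  shows "integral {0..s} f \<le> integral {0..t} f"
  by (rule integral_subset_le)
    (use assms in \<open>auto intro!: integrable_continuous_real intro: continuous_on_subset\<close>)

text \<open>Picard iteration for the integrated equation. The memory term is dominated by the same
  time integral as the local term, so successive iterates differ by at most
  \<open>B * (C * t) ^ n / fact n\<close> on every bounded interval, and no continuation argument is
  required for global existence.\<close>

lemma volterra_ode_exists:
  fixes L N :: "'y::banach \<Rightarrow> 'y"
  assumes L: "bounded_linear L" and N: "bounded_linear N" and g: "C1_halfline g g'"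
  shows "\<exists>x. continuous_on {0..} x \<and> x 0 = x0 \<and>
    (\<forall>t\<ge>0. (x has_vector_derivative L (x t) + N (conv g x t)) (at t within {0..}))"
proof -
  define f where "f x t = L (x t) + N (conv g x t)" for x t
  define F where "F x t = x0 + integral {0..t} (f x)" for x t
  define X where "X n = (F ^^ n) (\<lambda>_. x0)" for n
  have X_Suc: "X (Suc n) = F (X n)" for n by (simp add: X_def)
  note gc = C1_halfline_continuous[OF g]
  have fc: "continuous_on {0..} (f x)" if "continuous_on {0..} x" for x
    unfolding f_def[abs_def]
    by (intro continuous_intros bounded_linear.continuous_on[OF L] bounded_linear.continuous_on[OF N]
        continuous_on_conv[OF g] that)
  have Fc: "continuous_on {0..} (F x)" if "continuous_on {0..} x" for x
    unfolding F_def[abs_def] by (intro continuous_intros continuous_on_integral_halfline fc that)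
  have Xc: "continuous_on {0..} (X n)" for n
    by (induction n) (auto simp: X_Suc intro: Fc, simp add: X_def)
  obtain BL where BL: "BL \<ge> 0" "\<And>x. norm (L x) \<le> norm x * BL"
    using bounded_linear.nonneg_bounded[OF L] by auto
  obtain BN where BN: "BN \<ge> 0" "\<And>x. norm (N x) \<le> norm x * BN"
    using bounded_linear.nonneg_bounded[OF N] by auto
  \<comment> \<open>The convolution at time \<open>s\<close> is bounded by \<open>M\<close> times
    the integral up to \<open>t\<close>; integrating this constant once more over an interval of
    length at most \<open>T\<close> produces the summand \<open>BN * M * T\<close>.\<close>
  have lip: "\<exists>C\<ge>0. \<forall>x y t. continuous_on {0..} x \<longrightarrow> continuous_on {0..} y \<longrightarrow> 0 \<le> t \<longrightarrow> t \<le> T \<longrightarrow>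
      norm (F x t - F y t) \<le> C * integral {0..t} (\<lambda>s. norm (x s - y s))" if T: "T \<ge> 0" for T
  proof -
    obtain M where M: "M \<ge> 0" "\<And>t. 0 \<le> t \<Longrightarrow> t \<le> T \<Longrightarrow> norm (g t) \<le> M"
      using bounded_on_initial_interval[OF gc, of T] by blast
    show ?thesis
    proof (intro exI conjI allI impI)
      show "BL + BN * M * T \<ge> 0" using BL BN M T by simp
      fix x y :: "real \<Rightarrow> 'y" and t
      assume x: "continuous_on {0..} x" and y: "continuous_on {0..} y" and t: "0 \<le> t" "t \<le> T"
      define I where "I = integral {0..t} (\<lambda>s. norm (x s - y s))"
      have dc: "continuous_on {0..} (\<lambda>s. norm (x s - y s))" by (intro continuous_intros x y)
      have I0: "I \<ge> 0" unfolding I_def by (rule integral_nonneg)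
          (auto intro!: integrable_continuous_real continuous_on_subset[OF dc])
      have fi: "f x integrable_on {0..t}" if "continuous_on {0..} x" for x
        by (rule integrable_continuous_real, rule continuous_on_subset[OF fc[OF that]]) auto
      have "norm (F x t - F y t) = norm (integral {0..t} (\<lambda>s. f x s - f y s))"
        by (simp add: F_def Henstock_Kurzweil_Integration.integral_diff fi x y)
      also have "\<dots> \<le> integral {0..t} (\<lambda>s. BL * norm (x s - y s) + BN * M * I)"
      proof (rule integral_norm_bound_integral)
        show "(\<lambda>s. f x s - f y s) integrable_on {0..t}" by (intro integrable_diff fi x y)
        show "(\<lambda>s. BL * norm (x s - y s) + BN * M * I) integrable_on {0..t}"
          by (intro integrable_continuous_real continuous_intros continuous_on_subset[OF x]
              continuous_on_subset[OF y]) auto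
        fix s assume s: "s \<in> {0..t}"
        have "norm (conv g (\<lambda>r. x r - y r) s) \<le> M * integral {0..s} (\<lambda>r. norm (x r - y r))"
          using s t by (intro norm_conv_le gc continuous_intros x y M) auto
        also have "\<dots> \<le> M * I" unfolding I_def
          using s t M by (intro mult_left_mono integral_mono_upper dc) auto
        finally have c: "norm (conv g (\<lambda>r. x r - y r) s) \<le> M * I" .
        have "f x s - f y s = L (x s - y s) + N (conv g (\<lambda>r. x r - y r) s)"
          using s conv_diff[OF gc x y, of s]
          by (simp add: f_def linear_diff[OF bounded_linear.linear[OF L]] linear_diff[OF bounded_linear.linear[OF N]])
        also have "norm \<dots> \<le> norm (x s - y s) * BL + norm (conv g (\<lambda>r. x r - y r) s) * BN"
          by (intro norm_triangle_le add_mono BL BN)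
        also have "\<dots> \<le> BL * norm (x s - y s) + BN * M * I"
          using mult_right_mono[OF c BN(1)] by (simp add: algebra_simps)
        finally show "norm (f x s - f y s) \<le> BL * norm (x s - y s) + BN * M * I" .
      qed
      also have "\<dots> = BL * I + BN * M * I * t"
        unfolding I_def using t
        by (subst Henstock_Kurzweil_Integration.integral_add)
          (auto intro!: integrable_continuous_real continuous_intros continuous_on_subset[OF x]
              continuous_on_subset[OF y])
      also have "\<dots> \<le> BL * I + BN * M * I * T"
        using t I0 M BN by (intro add_left_mono mult_left_mono) auto
      finally show "norm (F x t - F y t) \<le> (BL + BN * M * T) * integral {0..t} (\<lambda>s. norm (x s - y s))"
        by (simp add: I_def algebra_simps)
    qed
  qed
  \<comment> \<open>The limit is written as a telescoping series that does not mention
    \<open>T\<close>, so the same \<open>x\<close> serves all intervals.\<close>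
  define x where "x t = x0 + (\<Sum>i. X (Suc i) t - X i t)" for t
  have lim: "uniform_limit {0..T} X x sequentially" if T: "T \<ge> 0" for T
  proof -
    obtain C where C: "C \<ge> 0" "\<And>x y t. continuous_on {0..} x \<Longrightarrow> continuous_on {0..} y \<Longrightarrow> 0 \<le> t \<Longrightarrow>
        t \<le> T \<Longrightarrow> norm (F x t - F y t) \<le> C * integral {0..t} (\<lambda>s. norm (x s - y s))"
      using lip[OF T] by blast
    have "continuous_on {0..} (\<lambda>t. X 1 t - X 0 t)" by (intro continuous_intros Xc)
    from bounded_on_initial_interval[OF this, of T]
    obtain B where B: "B \<ge> 0" "\<And>t. 0 \<le> t \<Longrightarrow> t \<le> T \<Longrightarrow> norm (X 1 t - X 0 t) \<le> B" by blast
    \<comment> \<open>Each application of \<open>F\<close> integrates the previous bound once, which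
      is the source of the factorial.\<close>
    have est: "norm (X (Suc n) t - X n t) \<le> B * (C * t) ^ n / fact n" if "0 \<le> t" "t \<le> T" for n t
      using that
    proof (induction n arbitrary: t)
      case 0 then show ?case using B by simp
    next
      case (Suc n)
      have "norm (X (Suc (Suc n)) t - X (Suc n) t) = norm (F (X (Suc n)) t - F (X n) t)"
        by (simp only: X_Suc)
      also have "\<dots> \<le> C * integral {0..t} (\<lambda>s. norm (X (Suc n) s - X n s))"
        using Suc.prems by (intro C Xc)
      also have "\<dots> \<le> C * integral {0..t} (\<lambda>s. B * (C * s) ^ n / fact n)"
        by (intro mult_left_mono C integral_le integrable_continuous_real continuous_intros
            continuous_on_subset[OF Xc]) (use Suc in auto)
      also have "integral {0..t} (\<lambda>s. B * (C * s) ^ n / fact n) = B * C ^ n * t ^ Suc n / fact (Suc n)"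
      proof -
        have "((\<lambda>s. B * (C * s) ^ n / fact n) has_integral
            B * C ^ n * t ^ Suc n / fact (Suc n) - B * C ^ n * 0 ^ Suc n / fact (Suc n)) {0..t}"
        proof (rule fundamental_theorem_of_calculus)
          show "0 \<le> t" by fact
          fix s
          have "((\<lambda>s. B * C ^ n * s ^ Suc n / fact (Suc n)) has_real_derivative
              B * C ^ n * (of_nat (Suc n) * s ^ n) / fact (Suc n)) (at s within {0..t})"
            using DERIV_cdivide[OF DERIV_cmult[OF DERIV_pow[of "Suc n" s "{0..t}"], of "B * C ^ n"], of "fact (Suc n)"]
            by simp
          also have "B * C ^ n * (of_nat (Suc n) * s ^ n) / fact (Suc n) = B * (C * s) ^ n / fact n"
            by (simp add: power_mult_distrib fact_Suc del: of_nat_Suc)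
          finally show "((\<lambda>s. B * C ^ n * s ^ Suc n / fact (Suc n)) has_vector_derivative
              B * (C * s) ^ n / fact n) (at s within {0..t})"
            by (simp add: has_real_derivative_iff_has_vector_derivative)
        qed
        from integral_unique[OF this] show ?thesis
          by (simp only: power_0_Suc mult_zero_right div_0 diff_zero)
      qed
      finally show ?case by (simp add: power_mult_distrib mult_ac)
    qed
    have "summable (\<lambda>n. B * (inverse (fact n) * (C * T) ^ n))"
      by (intro summable_mult summable_exp)
    then have sm: "summable (\<lambda>n. B * (C * T) ^ n / fact n)" by (simp add: field_simps)
    have "uniform_limit {0..T} (\<lambda>n t. \<Sum>i<n. X (Suc i) t - X i t) (\<lambda>t. \<Sum>i. X (Suc i) t - X i t) sequentially"
    proof (rule Weierstrass_m_test[OF _ sm])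
      fix n t assume t: "t \<in> {0..T}"
      then have "norm (X (Suc n) t - X n t) \<le> B * (C * t) ^ n / fact n" using est by auto
      also have "\<dots> \<le> B * (C * T) ^ n / fact n"
        using t B C by (intro divide_right_mono mult_left_mono power_mono) auto
      finally show "norm (X (Suc n) t - X n t) \<le> B * (C * T) ^ n / fact n" .
    qed
    then have "uniform_limit {0..T} (\<lambda>n t. x0 + (\<Sum>i<n. X (Suc i) t - X i t)) x sequentially"
      unfolding x_def by (intro uniform_limit_intros)
    moreover have "x0 + (\<Sum>i<n. X (Suc i) t - X i t) = X n t" for n t
      by (simp add: sum_lessThan_telescope[of "\<lambda>i. X i t"]) (simp add: X_def)
    ultimately show ?thesis by simp
  qed
  have xc: "continuous_on {0..} x"
  proof (rule continuous_on_halflineI)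
    fix T :: real assume "0 \<le> T"
    then show "continuous_on {0..T} x"
      by (intro uniform_limit_theorem[OF _ lim]) (auto intro!: always_eventually continuous_on_subset[OF Xc])
  qed
  have fix_x: "x t = F x t" if t: "t \<ge> 0" for t
  proof -
    obtain C where C: "C \<ge> 0" "\<And>x y s. continuous_on {0..} x \<Longrightarrow> continuous_on {0..} y \<Longrightarrow> 0 \<le> s \<Longrightarrow>
        s \<le> t \<Longrightarrow> norm (F x s - F y s) \<le> C * integral {0..s} (\<lambda>s. norm (x s - y s))"
      using lip[OF t] by blast
    have 1: "(\<lambda>n. X (Suc n) t) \<longlonglongrightarrow> x t"
      by (rule LIMSEQ_Suc, rule tendsto_uniform_limitI[OF lim[OF t]]) (use t in simp)
    \<comment> \<open>Uniform convergence sends the integrals \<open>I n\<close> to 0, and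
      \<open>lip\<close> then carries the iteration formula over to the limit.\<close>
    have "uniform_limit {0..t} (\<lambda>n s. norm (X n s - x s)) (\<lambda>s. norm (x s - x s)) sequentially"
      by (intro uniform_limit_intros lim[OF t])
    then obtain I J where IJ: "\<And>n. ((\<lambda>s. norm (X n s - x s)) has_integral I n) {0..t}"
      "((\<lambda>s. norm (x s - x s)) has_integral J) {0..t}" "I \<longlonglongrightarrow> J"
      by (rule uniform_limit_integral)
        (auto intro!: continuous_intros continuous_on_subset[OF Xc] continuous_on_subset[OF xc])
    have "J = 0" using IJ(2) by (simp add: has_integral_iff)
    have "(\<lambda>n. X (Suc n) t - F x t) \<longlonglongrightarrow> 0"
    proof (rule Lim_null_comparison)
      show "(\<lambda>n. C * I n) \<longlonglongrightarrow> 0" using IJ(3) \<open>J = 0\<close> by (auto intro: tendsto_eq_intros)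
      show "\<forall>\<^sub>F n in sequentially. norm (X (Suc n) t - F x t) \<le> C * I n"
        using C(2)[OF Xc xc t] IJ(1) by (auto simp: X_Suc has_integral_iff)
    qed
    then have "(\<lambda>n. X (Suc n) t) \<longlonglongrightarrow> F x t" by (simp add: LIM_zero_iff)
    then show ?thesis using 1 LIMSEQ_unique by blast
  qed
  have "(x has_vector_derivative f x t) (at t within {0..})" if t: "t \<ge> 0" for t
  proof (rule has_vector_derivative_transform[where f = "F x"])
    show "t \<in> {0..}" using t by simp
    show "(F x has_vector_derivative f x t) (at t within {0..})"
      unfolding F_def[abs_def]
      using has_vector_derivative_add[OF has_vector_derivative_const integral_has_vector_derivative_halfline[OF fc[OF xc] t]]
      by simp
  qed (use fix_x in auto)
  moreover have "x 0 = x0" using fix_x[of 0] by (simp add: F_def)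
  ultimately show ?thesis using xc unfolding f_def by blast
qed

section \<open>The energy estimate\<close>

text \<open>\<open>U\<close>, \<open>V\<close>, \<open>P\<close> stand for $\mathcal A^{1/2}u$, $\mathcal A^{1/2}u_t$, $u_{tt}$, the operator \<open>Q\<close>
  for an approximation of $\mathcal A^{1/2}$, and \<open>f1\<close>, \<open>f2\<close> for errors.\<close>

definition mgt_system ::
  "real \<Rightarrow> real \<Rightarrow> real \<Rightarrow> real \<Rightarrow> (real \<Rightarrow> real) \<Rightarrow> ('a::real_normed_vector \<Rightarrow> 'a) \<Rightarrow>
    (real \<Rightarrow> 'a) \<Rightarrow> (real \<Rightarrow> 'a) \<Rightarrow> (real \<Rightarrow> 'a) \<Rightarrow> (real \<Rightarrow> 'a) \<Rightarrow> (real \<Rightarrow> 'a) \<Rightarrow> bool" where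
  "mgt_system \<tau> \<alpha> b c g Q f1 f2 U V P \<longleftrightarrow> (\<forall>t\<ge>0.
     (U has_vector_derivative V t) (at t within {0..}) \<and>
     (V has_vector_derivative Q (P t) + f1 t) (at t within {0..}) \<and>
     (P has_vector_derivative
        (1 / \<tau>) *\<^sub>R (f2 t - \<alpha> *\<^sub>R P t - Q (c\<^sup>2 *\<^sub>R U t + b *\<^sub>R V t - conv g U t))) (at t within {0..}))"

lemma mgt_system_continuous:
  assumes "mgt_system \<tau> \<alpha> b c g Q f1 f2 U V P"
  shows "continuous_on {0..} U" "continuous_on {0..} V" "continuous_on {0..} P"
  using assms unfolding mgt_system_def continuous_on_eq_continuous_within
  by (auto intro: has_vector_derivative_continuous)

lemma gronwall_halfline:
  fixes f f' :: "real \<Rightarrow> real"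
  assumes d: "\<And>t. 0 \<le> t \<Longrightarrow> (f has_real_derivative f' t) (at t within {0..})"
    and le: "\<And>t. 0 \<le> t \<Longrightarrow> t \<le> T \<Longrightarrow> f' t \<le> a * f t" and t: "0 \<le> t" "t \<le> T"
  shows "f t \<le> f 0 * exp (a * t)"
proof -
  define h where "h t = f t * exp (- (a * t))" for t
  have hd: "(h has_real_derivative (f' t - a * f t) * exp (- (a * t))) (at t within {0..})"
    if "0 \<le> t" for t
    unfolding h_def[abs_def] by (auto intro!: derivative_eq_intros d that simp: algebra_simps)
  have "h t \<le> h 0"
  proof (rule DERIV_nonpos_imp_decreasing_open[where f = h and a = 0 and b = t])
    show "0 \<le> t" by fact
    show "continuous_on {0..t} h"
      by (rule DERIV_continuous_on) (auto intro: DERIV_subset[OF hd])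
    fix x assume x: "0 < x" "x < t"
    have "at x within {0..} = at x" by (rule at_within_interior) (use x in simp)
    then show "\<exists>y. (h has_real_derivative y) (at x) \<and> y \<le> 0"
      using hd[of x] x le[of x] t by (intro exI[of _ "(f' x - a * f x) * exp (- (a * x))"])
        (auto simp: mult_le_0_iff)
  qed
  then have "f t * exp (- (a * t)) * exp (a * t) \<le> f 0 * exp (a * t)"
    unfolding h_def by (intro mult_right_mono) auto
  then show ?thesis by (simp add: mult.assoc exp_minus_inverse mult.commute[of "exp (- (a * t))"])
qed

lemma square_sum5_le:
  fixes x1 :: real
  shows "(x1 + x2 + x3 + x4 + x5)\<^sup>2 \<le> 5 * (x1\<^sup>2 + x2\<^sup>2 + x3\<^sup>2 + x4\<^sup>2 + x5\<^sup>2)"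
proof -
  have "5 * (x1\<^sup>2 + x2\<^sup>2 + x3\<^sup>2 + x4\<^sup>2 + x5\<^sup>2) - (x1 + x2 + x3 + x4 + x5)\<^sup>2
    = (x1-x2)\<^sup>2+(x1-x3)\<^sup>2+(x1-x4)\<^sup>2+(x1-x5)\<^sup>2+(x2-x3)\<^sup>2+(x2-x4)\<^sup>2+(x2-x5)\<^sup>2+(x3-x4)\<^sup>2+(x3-x5)\<^sup>2+(x4-x5)\<^sup>2"
    by (simp add: power2_eq_square algebra_simps)
  also have "\<dots> \<ge> 0" by simp
  finally show ?thesis by simp
qed

text \<open>With \<open>Z = V + (c\<^sup>2/b) U - (1/b) g * U\<close> the unbounded terms of \<open>Z' = Q P + \<dots>\<close> and
  \<open>\<tau> P' = - b Q Z + \<dots>\<close> cancel in the derivative of \<open>\<tau> \<parallel>P\<parallel>\<^sup>2 + b \<parallel>Z\<parallel>\<^sup>2\<close>, so the constant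
  does not depend on \<open>Q\<close>. The square of \<open>\<integral> \<parallel>U\<parallel>\<close> is added to absorb the memory terms.\<close>

lemma mgt_energy_estimate:
  fixes g g' :: "real \<Rightarrow> real" and T :: real
  assumes g: "C1_halfline g g'" and pos: "\<tau> > 0" "b > 0" "\<alpha> \<ge> 0"
  shows "\<exists>C\<ge>0. \<forall>(Q :: 'a::{real_inner, banach} \<Rightarrow> 'a) f1 f2 U V P D.
    linear Q \<longrightarrow> (\<forall>x y. inner (Q x) y = inner x (Q y)) \<longrightarrow>
    mgt_system \<tau> \<alpha> b c g Q f1 f2 U V P \<longrightarrow>
    (\<forall>t\<in>{0..T}. norm (f1 t) \<le> D \<and> norm (f2 t) \<le> D) \<longrightarrow>
    norm (U 0) \<le> D \<longrightarrow> norm (V 0) \<le> D \<longrightarrow> norm (P 0) \<le> D \<longrightarrow>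
    (\<forall>t\<in>{0..T}. norm (U t) \<le> C * D \<and> norm (V t) \<le> C * D \<and> norm (P t) \<le> C * D)"
proof -
  note gc = C1_halfline_continuous[OF g]
  have g'c: "continuous_on {0..} g'" using g by (simp add: C1_halfline_def)
  obtain M where M: "M \<ge> 0" "\<And>t. 0 \<le> t \<Longrightarrow> t \<le> T \<Longrightarrow> norm (g t) \<le> M"
    using bounded_on_initial_interval[OF gc] by blast
  obtain M' where M': "M' \<ge> 0" "\<And>t. 0 \<le> t \<Longrightarrow> t \<le> T \<Longrightarrow> norm (g' t) \<le> M'"
    using bounded_on_initial_interval[OF g'c] by blast
  \<comment> \<open>\<open>a1\<close> and \<open>a2\<close> bound \<open>V\<close> and
    \<open>W\<close> by multiples of \<open>S\<close>; \<open>a3\<close> adds up the contributions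
    to \<open>e'\<close>; \<open>m\<close> bounds each squared norm by its share of the energy, the
    5 being the constant of \<open>square_sum5_le\<close>. \<open>a4\<close> is the resulting growth
    rate, and \<open>a5 * D\<^sup>2\<close> dominates the initial value of
    \<open>e + D\<^sup>2\<close> together with its growth up to \<open>T\<close>.\<close>
  define k where "k = c\<^sup>2 / b"
  define a1 where "a1 = 1 + k + M / b"
  define a2 where "a2 = k * a1 + (\<bar>g 0\<bar> + M') / b"
  define a3 where "a3 = 2 + 2 * b * (1 + a2) + 2 * a1 + 2"
  define m where "m = 1 / \<tau> + 1 / b + 1"
  define a4 where "a4 = 5 * a3 * m"
  define a5 where "a5 = (\<tau> + b * (1 + k)\<^sup>2 + 1 + 1) * exp (a4 * T)"
  have k0: "k \<ge> 0" using pos by (simp add: k_def)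
  have a1: "a1 \<ge> 1" using k0 M pos by (simp add: a1_def)
  have a2: "a2 \<ge> 0" using k0 a1 M' pos by (simp add: a2_def)
  have a3: "a3 \<ge> 0" using a1 a2 pos by (simp add: a3_def)
  have m: "m \<ge> 0" using pos by (simp add: m_def)
  have a4: "a4 \<ge> 0" using a3 m by (simp add: a4_def)
  show ?thesis
  proof (intro exI[of _ "a1 * sqrt (5 * m * a5)"] conjI allI impI)
    show "0 \<le> a1 * sqrt (5 * m * a5)" using a1 m pos by (simp add: a5_def)
    fix Q :: "'a \<Rightarrow> 'a" and f1 f2 U V P D
    assume Q: "linear Q" and sym: "\<forall>x y. inner (Q x) y = inner x (Q y)"
      and sys: "mgt_system \<tau> \<alpha> b c g Q f1 f2 U V P"
      and f: "\<forall>t\<in>{0..T}. norm (f1 t) \<le> D \<and> norm (f2 t) \<le> D"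
      and U0: "norm (U 0) \<le> D" and V0: "norm (V 0) \<le> D" and P0: "norm (P 0) \<le> D"
    note Uc = mgt_system_continuous(1)[OF sys]
    have D0: "D \<ge> 0" using U0 norm_ge_zero order_trans by blast
    define I where "I t = integral {0..t} (\<lambda>s. norm (U s))" for t
    define Z where "Z t = V t + k *\<^sub>R U t - (1 / b) *\<^sub>R conv g U t" for t
    \<comment> \<open>\<open>W\<close> collects the part of the derivative of \<open>Z\<close> that
      contains neither \<open>Q\<close> nor the forcing; it is of lower order once \<open>V\<close>
      is expressed through \<open>Z\<close>, \<open>U\<close> and the convolution.\<close>
    define W where "W t = k *\<^sub>R V t - (1 / b) *\<^sub>R (g 0 *\<^sub>R U t + conv g' U t)" for t
    \<comment> \<open>The summand \<open>I t\<close> controls the two convolutions, and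
      \<open>D\<close> the forcing, so that every term below is a multiple of
      \<open>S t\<close>.\<close>
    define S where "S t = norm (P t) + norm (Z t) + norm (U t) + I t + D" for t
    have nc: "continuous_on {0..} (\<lambda>s. norm (U s))" by (intro continuous_intros Uc)
    have Id: "(I has_real_derivative norm (U t)) (at t within {0..})" if "0 \<le> t" for t
      unfolding I_def[abs_def] has_real_derivative_iff_has_vector_derivative
      by (intro integral_has_vector_derivative_halfline nc that)
    have I0: "I t \<ge> 0" if "0 \<le> t" for t
      unfolding I_def by (rule integral_nonneg)
        (auto intro!: integrable_continuous_real continuous_on_subset[OF nc])
    have Ud: "(U has_vector_derivative V t) (at t within {0..})" if "0 \<le> t" for t
      using sys that by (simp add: mgt_system_def)
    have Zeq: "c\<^sup>2 *\<^sub>R U t + b *\<^sub>R V t - conv g U t = b *\<^sub>R Z t" for t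
      using pos by (simp add: Z_def k_def algebra_simps)
    have Pd: "(P has_vector_derivative (1 / \<tau>) *\<^sub>R (f2 t - \<alpha> *\<^sub>R P t - b *\<^sub>R Q (Z t))) (at t within {0..})"
      if "0 \<le> t" for t
      using sys that by (simp add: mgt_system_def Zeq linear_cmul[OF Q])
    have Zd: "(Z has_vector_derivative Q (P t) + f1 t + W t) (at t within {0..})" if "0 \<le> t" for t
    proof -
      have "(Z has_vector_derivative (Q (P t) + f1 t) + k *\<^sub>R V t - (1 / b) *\<^sub>R (g 0 *\<^sub>R U t + conv g' U t))
          (at t within {0..})"
        unfolding Z_def[abs_def]
        by (intro has_vector_derivative_diff has_vector_derivative_add
            bounded_linear.has_vector_derivative[OF bounded_linear_scaleR_right]
            conv_has_vector_derivative[OF g Uc that] Ud that)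
          (use sys that in \<open>simp add: mgt_system_def\<close>)
      then show ?thesis by (simp add: W_def algebra_simps)
    qed
    define e where "e t = \<tau> * inner (P t) (P t) + b * inner (Z t) (Z t) + inner (U t) (U t) + (I t)\<^sup>2" for t
    define e' where "e' t = \<tau> * (2 * inner (P t) ((1 / \<tau>) *\<^sub>R (f2 t - \<alpha> *\<^sub>R P t - b *\<^sub>R Q (Z t))))
        + b * (2 * inner (Z t) (Q (P t) + f1 t + W t)) + 2 * inner (U t) (V t) + 2 * I t * norm (U t)" for t
    have inner_d: "((\<lambda>t. inner (F t) (F t)) has_real_derivative 2 * inner (F t) F') (at t within {0..})"
      if "(F has_vector_derivative F') (at t within {0..})" for F :: "real \<Rightarrow> 'a" and F' t
      using bounded_bilinear.has_vector_derivative[OF bounded_bilinear_inner that that]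
      by (simp add: has_real_derivative_iff_has_vector_derivative inner_commute)
    have ed: "(e has_real_derivative e' t) (at t within {0..})" if "0 \<le> t" for t
    proof -
      have "((\<lambda>t. (I t)\<^sup>2) has_real_derivative 2 * I t * norm (U t)) (at t within {0..})"
        using Id[OF that] by (auto intro!: derivative_eq_intros)
      then show ?thesis
        unfolding e_def[abs_def] e'_def
        by (intro DERIV_add DERIV_cmult inner_d Pd Zd Ud that)
    qed
    have cb: "norm (conv g U t) \<le> M * I t" "norm (conv g' U t) \<le> M' * I t" if "0 \<le> t" "t \<le> T" for t
      unfolding I_def using that by (auto intro!: norm_conv_le gc g'c Uc M M')
    have S0: "S t \<ge> 0" and parts: "norm (P t) \<le> S t" "norm (Z t) \<le> S t" "norm (U t) \<le> S t" "I t \<le> S t" "D \<le> S t"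
      if "0 \<le> t" for t
      using I0[OF that] D0 by (auto simp: S_def)
    have Vb: "norm (V t) \<le> a1 * S t" if t: "0 \<le> t" "t \<le> T" for t
    proof -
      have "V t = Z t - k *\<^sub>R U t + (1 / b) *\<^sub>R conv g U t" by (simp add: Z_def)
      then have "norm (V t) \<le> norm (Z t) + k * norm (U t) + (1 / b) * norm (conv g U t)"
        using k0 pos norm_triangle_ineq4[of "Z t" "k *\<^sub>R U t"]
          norm_triangle_ineq[of "Z t - k *\<^sub>R U t" "(1 / b) *\<^sub>R conv g U t"] by simp
      also have "\<dots> \<le> S t + k * S t + (1 / b) * (M * S t)"
        using parts[OF t(1)] cb(1)[OF t] k0 pos M
        by (intro add_mono mult_left_mono order_trans[OF cb(1)[OF t]]) auto
      finally show ?thesis by (simp add: a1_def algebra_simps)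
    qed
    have Wb: "norm (W t) \<le> a2 * S t" if t: "0 \<le> t" "t \<le> T" for t
    proof -
      have "norm (W t) \<le> k * norm (V t) + (1 / b) * norm (g 0 *\<^sub>R U t + conv g' U t)"
        using k0 pos norm_triangle_ineq4[of "k *\<^sub>R V t" "(1 / b) *\<^sub>R (g 0 *\<^sub>R U t + conv g' U t)"]
        by (simp add: W_def)
      also have "\<dots> \<le> k * (a1 * S t) + (1 / b) * (\<bar>g 0\<bar> * S t + M' * S t)"
      proof (intro add_mono mult_left_mono Vb t k0)
        have "norm (g 0 *\<^sub>R U t + conv g' U t) \<le> \<bar>g 0\<bar> * norm (U t) + M' * I t"
          by (rule norm_triangle_le) (use cb(2)[OF t] in simp)
        also have "\<dots> \<le> \<bar>g 0\<bar> * S t + M' * S t"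
          using parts[OF t(1)] M' by (intro add_mono mult_left_mono) auto
        finally show "norm (g 0 *\<^sub>R U t + conv g' U t) \<le> \<bar>g 0\<bar> * S t + M' * S t" .
      qed (use pos in simp)
      finally show ?thesis using pos by (simp add: a2_def algebra_simps add_divide_distrib)
    qed
    have Ssq: "(S t)\<^sup>2 \<le> 5 * m * (e t + D\<^sup>2)" if t: "0 \<le> t" for t
    proof -
      have "(norm (P t))\<^sup>2 \<le> m * (\<tau> * inner (P t) (P t))"
      proof -
        have "1 \<le> m * \<tau>" using pos by (simp add: m_def field_simps)
        from mult_right_mono[OF this, of "inner (P t) (P t)"] show ?thesis
          by (simp add: power2_norm_eq_inner)
      qed
      moreover have "(norm (Z t))\<^sup>2 \<le> m * (b * inner (Z t) (Z t))"
      proof -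
        have "1 \<le> m * b" using pos by (simp add: m_def field_simps)
        from mult_right_mono[OF this, of "inner (Z t) (Z t)"] show ?thesis
          by (simp add: power2_norm_eq_inner)
      qed
      moreover have "x \<le> m * x" if "x \<ge> 0" for x
      proof -
        have "1 \<le> m" using pos by (simp add: m_def field_simps)
        from mult_right_mono[OF this that] show ?thesis by simp
      qed
      from this[of "(norm (U t))\<^sup>2"] this[of "(I t)\<^sup>2"] this[of "D\<^sup>2"]
      have "(norm (U t))\<^sup>2 \<le> m * inner (U t) (U t)" "(I t)\<^sup>2 \<le> m * (I t)\<^sup>2" "D\<^sup>2 \<le> m * D\<^sup>2"
        by (simp_all add: power2_norm_eq_inner)
      ultimately have "(norm (P t))\<^sup>2 + (norm (Z t))\<^sup>2 + (norm (U t))\<^sup>2 + (I t)\<^sup>2 + D\<^sup>2 \<le> m * (e t + D\<^sup>2)"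
        by (simp add: e_def distrib_left)
      then show ?thesis
        using square_sum5_le[of "norm (P t)" "norm (Z t)" "norm (U t)" "I t" D] by (simp add: S_def)
    qed
    have e'b: "e' t \<le> a4 * (e t + D\<^sup>2)" if t: "0 \<le> t" "t \<le> T" for t
    proof -
      have prod: "inner x y \<le> r * (S t)\<^sup>2" if "norm x \<le> S t" "norm y \<le> r * S t" for x y :: 'a and r
      proof -
        have "inner x y \<le> norm x * norm y" by (rule norm_cauchy_schwarz)
        also have "\<dots> \<le> S t * (r * S t)" using that S0[OF t(1)] by (intro mult_mono) auto
        finally show ?thesis by (simp add: power2_eq_square mult_ac)
      qed
      \<comment> \<open>By symmetry of \<open>Q\<close> the terms \<open>- 2 b (P, Q Z)\<close> and
        \<open>2 b (Z, Q P)\<close> add up to zero; the weights \<tau> and \<open>b\<close> in the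
        energy are chosen for this.\<close>
      have 1: "e' t = - (2 * \<alpha> * inner (P t) (P t)) + 2 * inner (P t) (f2 t) + 2 * b * inner (Z t) (f1 t + W t)
          + 2 * inner (U t) (V t) + 2 * (I t * norm (U t))"
        using pos sym by (simp add: e'_def inner_simps inner_commute algebra_simps)
      have "inner (P t) (f2 t) \<le> 1 * (S t)\<^sup>2"
      proof (rule prod)
        have "norm (f2 t) \<le> D" using f t by auto
        then show "norm (f2 t) \<le> 1 * S t" using parts(5)[OF t(1)] by simp
      qed (rule parts[OF t(1)])
      moreover have "inner (Z t) (f1 t + W t) \<le> (1 + a2) * (S t)\<^sup>2"
      proof (rule prod)
        have "norm (f1 t) \<le> D" using f t by auto
        then have "norm (f1 t) \<le> S t" using parts(5)[OF t(1)] by simp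
        then show "norm (f1 t + W t) \<le> (1 + a2) * S t"
          using Wb[OF t] by (intro norm_triangle_le) (simp add: algebra_simps)
      qed (rule parts[OF t(1)])
      moreover have "inner (U t) (V t) \<le> a1 * (S t)\<^sup>2"
        by (intro prod parts Vb t)
      moreover have "I t * norm (U t) \<le> (S t)\<^sup>2"
        unfolding power2_eq_square using t by (intro mult_mono parts S0) auto
      moreover have "\<alpha> * inner (P t) (P t) \<ge> 0" using pos by simp
      ultimately have "e' t \<le> 2 * (S t)\<^sup>2 + 2 * b * ((1 + a2) * (S t)\<^sup>2) + 2 * (a1 * (S t)\<^sup>2) + 2 * (S t)\<^sup>2"
        using mult_left_mono[of "inner (Z t) (f1 t + W t)" "(1 + a2) * (S t)\<^sup>2" "2 * b"] pos
        unfolding 1 by linarith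
      also have "\<dots> = a3 * (S t)\<^sup>2" by (simp add: a3_def algebra_simps)
      also have "\<dots> \<le> a3 * (5 * m * (e t + D\<^sup>2))" by (intro mult_left_mono Ssq t a3)
      finally show ?thesis by (simp add: a4_def mult_ac)
    qed
    have e0: "e 0 \<le> (\<tau> + b * (1 + k)\<^sup>2 + 1) * D\<^sup>2"
    proof -
      have "norm (Z 0) \<le> norm (V 0) + k * norm (U 0)"
        using norm_triangle_ineq[of "V 0" "k *\<^sub>R U 0"] k0 by (simp add: Z_def conv_def)
      also have "\<dots> \<le> (1 + k) * D"
        using mult_left_mono[OF U0 k0] V0 by (simp add: algebra_simps)
      finally have "inner (Z 0) (Z 0) \<le> (1 + k)\<^sup>2 * D\<^sup>2"
        using power_mono[of "norm (Z 0)" "(1 + k) * D" 2]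
        by (simp add: power2_norm_eq_inner[symmetric] power_mult_distrib)
      moreover have "inner (P 0) (P 0) \<le> D\<^sup>2" "inner (U 0) (U 0) \<le> D\<^sup>2"
        unfolding power2_norm_eq_inner[symmetric] using P0 U0 by (auto intro: power_mono)
      moreover have "I 0 = 0" by (simp add: I_def)
      ultimately have "\<tau> * inner (P 0) (P 0) \<le> \<tau> * D\<^sup>2" "b * inner (Z 0) (Z 0) \<le> b * ((1 + k)\<^sup>2 * D\<^sup>2)"
        "inner (U 0) (U 0) \<le> D\<^sup>2" "(I 0)\<^sup>2 = 0"
        using pos by (simp_all add: mult_left_mono)
      moreover have "(\<tau> + b * (1 + k)\<^sup>2 + 1) * D\<^sup>2 = \<tau> * D\<^sup>2 + b * ((1 + k)\<^sup>2 * D\<^sup>2) + D\<^sup>2"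
        by (simp add: algebra_simps)
      ultimately show ?thesis unfolding e_def by linarith
    qed
    show "\<forall>t\<in>{0..T}. norm (U t) \<le> a1 * sqrt (5 * m * a5) * D \<and>
        norm (V t) \<le> a1 * sqrt (5 * m * a5) * D \<and> norm (P t) \<le> a1 * sqrt (5 * m * a5) * D"
    proof
      fix t assume "t \<in> {0..T}"
      then have t: "0 \<le> t" "t \<le> T" by auto
      \<comment> \<open>Gronwall is applied to \<open>e + D\<^sup>2\<close> because the forcing
        makes \<open>e'\<close> controllable only by this sum.\<close>
      have "e t + D\<^sup>2 \<le> (e 0 + D\<^sup>2) * exp (a4 * t)"
      proof (rule gronwall_halfline[where f = "\<lambda>t. e t + D\<^sup>2" and f' = e'])
        show "((\<lambda>t. e t + D\<^sup>2) has_real_derivative e' t) (at t within {0..})" if "0 \<le> t" for t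
          using DERIV_add[OF ed[OF that] DERIV_const] by simp
      qed (use t e'b in auto)
      also have "\<dots> \<le> ((\<tau> + b * (1 + k)\<^sup>2 + 1) * D\<^sup>2 + D\<^sup>2) * exp (a4 * T)"
        using e0 t a4 pos by (intro mult_mono) (auto intro: mult_left_mono)
      also have "\<dots> = a5 * D\<^sup>2" by (simp add: a5_def algebra_simps)
      finally have "(S t)\<^sup>2 \<le> 5 * m * (a5 * D\<^sup>2)"
        using Ssq[OF t(1)] m by (meson mult_left_mono order_trans mult_nonneg_nonneg zero_le_numeral)
      then have "S t \<le> sqrt (5 * m * a5) * D"
        using real_le_rsqrt[of "S t" "5 * m * (a5 * D\<^sup>2)"] D0 by (simp add: real_sqrt_mult mult_ac)
      then have aS: "a1 * S t \<le> a1 * sqrt (5 * m * a5) * D"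
        using mult_left_mono[of "S t" _ a1] a1 by (simp add: mult_ac)
      \<comment> \<open>\<open>a1 \<ge> 1\<close> lets the constant found for \<open>V\<close> serve
        \<open>U\<close> and \<open>P\<close> as well.\<close>
      moreover have "S t \<le> a1 * S t" using a1 S0[OF t(1)] by (simp add: mult_le_cancel_right1)
      ultimately show "norm (U t) \<le> a1 * sqrt (5 * m * a5) * D \<and>
        norm (V t) \<le> a1 * sqrt (5 * m * a5) * D \<and> norm (P t) \<le> a1 * sqrt (5 * m * a5) * D"
        using parts[OF t(1)] Vb[OF t] by (auto intro: order_trans)
    qed
  qed
qed

section \<open>The resolvent of a positive bounded operator\<close>

text \<open>Lax-Milgram by contraction: solutions of \<open>M x = y\<close> are the fixed points of
  the map sending \<open>x\<close> to \<open>x - l *\<^sub>R (M x - y)\<close>, which contracts for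
  a suitable step \<open>l\<close>.\<close>

lemma coercive_bounded_surj:
  fixes M :: "'a::{real_inner, complete_space} \<Rightarrow> 'a"
  assumes M: "bounded_linear M" and e: "e > 0" and coercive: "\<And>x. e * inner x x \<le> inner (M x) x"
  shows "surj M"
proof -
  obtain B where B: "B > 0" "\<And>x. norm (M x) \<le> norm x * B"
    using bounded_linear.pos_bounded[OF M] by blast
  note lin = bounded_linear.linear[OF M]
  \<comment> \<open>Adding \<open>e\<close> to the operator bound forces \<open>e / N < 1\<close>,
    so that the square root defining \<open>q\<close> is that of a positive number.\<close>
  define N where "N = B + e"
  have N: "N > 0" "e < N" "\<And>x. norm (M x) \<le> N * norm x"
  proof -
    fix x :: 'a
    have "0 \<le> e * norm x" using e by simp
    with B(2)[of x] show "norm (M x) \<le> N * norm x" by (simp add: N_def algebra_simps)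
  qed (use B e in \<open>auto simp: N_def\<close>)
  \<comment> \<open>This step minimises \<open>1 - 2 * l * e + l\<^sup>2 * N\<^sup>2\<close>, with
    minimum \<open>1 - (e / N)\<^sup>2\<close>.\<close>
  define l where "l = e / N\<^sup>2"
  define q where "q = sqrt (1 - (e / N)\<^sup>2)"
  have eN: "0 < e / N" "e / N < 1" using e N by auto
  have q2: "(e / N)\<^sup>2 < 1" using eN by (simp add: power_less_one_iff abs_square_less_1)
  have q: "0 \<le> q" "q < 1" using q2 eN unfolding q_def by auto
  have contr: "norm (x - l *\<^sub>R M x) \<le> q * norm x" for x
  proof -
    have "(norm (x - l *\<^sub>R M x))\<^sup>2 = inner x x - 2 * l * inner (M x) x + l\<^sup>2 * (norm (M x))\<^sup>2"
      unfolding power2_norm_eq_inner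
      by (simp add: inner_simps inner_commute power2_eq_square algebra_simps)
    also have "\<dots> \<le> inner x x - 2 * l * (e * inner x x) + l\<^sup>2 * (N * norm x)\<^sup>2"
      using coercive[of x] e N by (intro add_mono diff_mono mult_left_mono power_mono) (auto simp: l_def)
    also have "\<dots> = (1 - 2 * l * e + l\<^sup>2 * N\<^sup>2) * (norm x)\<^sup>2"
      by (simp add: power2_norm_eq_inner algebra_simps power_mult_distrib)
    also have "1 - 2 * l * e + l\<^sup>2 * N\<^sup>2 = 1 - (e / N)\<^sup>2"
      using N by (simp add: l_def field_simps power2_eq_square)
    also have "\<dots> = q\<^sup>2" using q2 by (simp add: q_def)
    finally have "(norm (x - l *\<^sub>R M x))\<^sup>2 \<le> (q * norm x)\<^sup>2" by (simp add: power_mult_distrib)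
    then show ?thesis using q by (simp add: power2_le_iff_abs_le)
  qed
  have "\<exists>x. M x = y" for y
  proof -
    have "\<exists>!x. x - l *\<^sub>R (M x - y) = x"
    proof (rule banach_fix_type[OF q])
      show "\<forall>x z. dist (x - l *\<^sub>R (M x - y)) (z - l *\<^sub>R (M z - y)) \<le> q * dist x z"
      proof (intro allI)
        fix x z
        have "(x - l *\<^sub>R (M x - y)) - (z - l *\<^sub>R (M z - y)) = (x - z) - l *\<^sub>R M (x - z)"
          by (simp add: linear_diff[OF lin] algebra_simps)
        then show "dist (x - l *\<^sub>R (M x - y)) (z - l *\<^sub>R (M z - y)) \<le> q * dist x z"
          unfolding dist_norm using contr[of "x - z"] by (simp only:)
      qed
    qed
    moreover have "l \<noteq> 0" using e N by (simp add: l_def)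
    ultimately show ?thesis by auto
  qed
  then show ?thesis by (metis surjI)
qed

definition resolvent :: "('a::real_vector \<Rightarrow> 'a) \<Rightarrow> real \<Rightarrow> 'a \<Rightarrow> 'a" where
  "resolvent K e = inv (\<lambda>x. K x + e *\<^sub>R x)"

locale positive_bounded =
  fixes K :: "'a::{real_inner, complete_space} \<Rightarrow> 'a"
  assumes bounded_linear: "bounded_linear K"
    and symmetric: "inner (K x) y = inner x (K y)"
    and positive: "0 \<le> inner (K x) x"
begin

lemmas linear = bounded_linear.linear[OF bounded_linear]

abbreviation Q where "Q e \<equiv> resolvent K e"

lemma surj_add: "e > 0 \<Longrightarrow> surj (\<lambda>x. K x + e *\<^sub>R x)"
  by (rule coercive_bounded_surj[of _ e])
    (auto simp: inner_simps positive intro!: bounded_linear_add bounded_linear bounded_linear_scaleR_right)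

text \<open>The cross term \<open>2 * e * inner (K x) x\<close> in the square of the sum is
  nonnegative, so each summand alone is dominated. The first bound gives a resolvent of norm at most
  \<open>1 / e\<close>; the second gives a bound on the resolvent after \<open>K\<close> that is
  free of \<open>e\<close>.\<close>

lemma norm_add_ge:
  assumes "e > 0"
  shows "e * norm x \<le> norm (K x + e *\<^sub>R x)" "norm (K x) \<le> norm (K x + e *\<^sub>R x)"
proof -
  have "(norm (K x + e *\<^sub>R x))\<^sup>2 = (norm (K x))\<^sup>2 + 2 * e * inner (K x) x + (e * norm x)\<^sup>2"
    by (simp add: power2_norm_eq_inner inner_simps inner_commute power_mult_distrib)
      (simp add: power2_eq_square algebra_simps)
  moreover have "0 \<le> 2 * e * inner (K x) x" using positive assms by simp
  ultimately have "(e * norm x)\<^sup>2 \<le> (norm (K x + e *\<^sub>R x))\<^sup>2" "(norm (K x))\<^sup>2 \<le> (norm (K x + e *\<^sub>R x))\<^sup>2"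
    by (simp_all add: add_increasing add_increasing2)
  then show "e * norm x \<le> norm (K x + e *\<^sub>R x)" "norm (K x) \<le> norm (K x + e *\<^sub>R x)"
    using power2_le_imp_le norm_ge_zero by blast+
qed

lemma inj_add: "e > 0 \<Longrightarrow> inj (\<lambda>x. K x + e *\<^sub>R x)"
proof (rule injI)
  fix x y assume e: "e > 0" and "K x + e *\<^sub>R x = K y + e *\<^sub>R y"
  then have "K (x - y) + e *\<^sub>R (x - y) = 0" by (simp add: linear_diff[OF linear] algebra_simps)
  then show "x = y" using norm_add_ge(1)[OF e, of "x - y"] e by (simp add: mult_le_0_iff)
qed

lemma add_resolvent: "e > 0 \<Longrightarrow> K (Q e x) + e *\<^sub>R Q e x = x"
  unfolding resolvent_def using surj_f_inv_f[OF surj_add] by fast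

lemma resolvent_eqI: "e > 0 \<Longrightarrow> K y + e *\<^sub>R y = x \<Longrightarrow> Q e x = y"
  using inj_add add_resolvent[of e x] by (auto dest!: injD)

lemma norm_resolvent_le: "e > 0 \<Longrightarrow> e * norm (Q e x) \<le> norm x"
  using norm_add_ge(1)[of e "Q e x"] by (simp add: add_resolvent)

lemma resolvent_bounded_linear: assumes "e > 0" shows "bounded_linear (Q e)"
proof (rule bounded_linear_intro[where K = "1 / e"])
  show "Q e (x + y) = Q e x + Q e y" for x y
  proof (rule resolvent_eqI[OF assms])
    have "K (Q e x + Q e y) + e *\<^sub>R (Q e x + Q e y)
        = (K (Q e x) + e *\<^sub>R Q e x) + (K (Q e y) + e *\<^sub>R Q e y)"
      by (simp add: linear_add[OF linear] algebra_simps)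
    then show "K (Q e x + Q e y) + e *\<^sub>R (Q e x + Q e y) = x + y" by (simp add: add_resolvent assms)
  qed
  show "Q e (r *\<^sub>R x) = r *\<^sub>R Q e x" for r x
  proof (rule resolvent_eqI[OF assms])
    have "K (r *\<^sub>R Q e x) + e *\<^sub>R (r *\<^sub>R Q e x) = r *\<^sub>R (K (Q e x) + e *\<^sub>R Q e x)"
      by (simp add: linear_cmul[OF linear] algebra_simps)
    then show "K (r *\<^sub>R Q e x) + e *\<^sub>R (r *\<^sub>R Q e x) = r *\<^sub>R x" by (simp add: add_resolvent assms)
  qed
  show "norm (Q e x) \<le> norm x * (1 / e)" for x
    using norm_resolvent_le[OF assms, of x] assms by (simp add: field_simps)
qed

lemmas resolvent_linear = bounded_linear.linear[OF resolvent_bounded_linear]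

lemma resolvent_K: "e > 0 \<Longrightarrow> Q e (K x) = K (Q e x)"
proof (rule resolvent_eqI)
  assume "e > 0"
  have "K (K (Q e x)) + e *\<^sub>R K (Q e x) = K (K (Q e x) + e *\<^sub>R Q e x)"
    by (simp add: linear_add[OF linear] linear_cmul[OF linear])
  then show "K (K (Q e x)) + e *\<^sub>R K (Q e x) = K x" by (simp add: add_resolvent \<open>e > 0\<close>)
qed

lemma resolvent_add: "e > 0 \<Longrightarrow> Q e (K x + e *\<^sub>R x) = x"
  by (rule resolvent_eqI) auto

text \<open>The bound that is uniform in \<open>e\<close>: one factor \<open>K\<close> compensates
  one resolvent.\<close>

lemma norm_resolvent_K_le: "e > 0 \<Longrightarrow> norm (Q e (K x)) \<le> norm x"
  using norm_add_ge(2)[of e "Q e x"] by (simp add: add_resolvent resolvent_K)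

lemma resolvent_symmetric: assumes "e > 0" shows "inner (Q e x) y = inner x (Q e y)"
proof -
  have "inner (Q e x) (K (Q e y) + e *\<^sub>R Q e y) = inner (K (Q e x) + e *\<^sub>R Q e x) (Q e y)"
    by (simp add: inner_simps symmetric)
  then show ?thesis by (simp add: add_resolvent assms)
qed

lemma resolvent_commute: assumes "e > 0" "d > 0" shows "Q e (Q d x) = Q d (Q e x)"
proof (rule resolvent_eqI[OF assms(1)])
  have "K (Q d (Q e x)) + e *\<^sub>R Q d (Q e x) = Q d (K (Q e x) + e *\<^sub>R Q e x)"
    using assms by (simp add: resolvent_K linear_add[OF resolvent_linear] linear_cmul[OF resolvent_linear])
  then show "K (Q d (Q e x)) + e *\<^sub>R Q d (Q e x) = Q d x" by (simp add: add_resolvent assms)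
qed

text \<open>The factor \<open>d - e\<close> is what makes approximations with different parameters
  approach each other, at the price of a second resolvent.\<close>

lemma resolvent_identity: assumes "e > 0" "d > 0" shows "Q e x - Q d x = (d - e) *\<^sub>R Q e (Q d x)"
proof -
  have "Q e x = Q e (K (Q d x) + d *\<^sub>R Q d x)" by (simp add: add_resolvent assms)
  also have "\<dots> = Q e (K (Q d x) + e *\<^sub>R Q d x + (d - e) *\<^sub>R Q d x)" by (simp add: algebra_simps)
  also have "\<dots> = Q d x + (d - e) *\<^sub>R Q e (Q d x)"
    using assms by (simp only: linear_add[OF resolvent_linear[OF assms(1)], of "K (Q d x) + e *\<^sub>R Q d x"]
        linear_cmul[OF resolvent_linear] resolvent_add)
  finally show ?thesis by simp
qed

end

section \<open>The inverse of a coercive self-adjoint operator\<close>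

text \<open>The projection theorem: a minimising sequence for the distance from \<open>y\<close> to
  \<open>M\<close> converges to a nearest point \<open>x0\<close>, and \<open>y - x0\<close> is
  orthogonal to \<open>M\<close> and nonzero because \<open>y\<close> lies outside.\<close>

lemma closed_subspace_orthogonal_ex:
  fixes M :: "'a::{real_inner, complete_space} set"
  assumes M: "subspace M" "closed M" and y: "y \<notin> M"
  shows "\<exists>z. z \<noteq> 0 \<and> (\<forall>x\<in>M. inner z x = 0)"
proof -
  define d where "d = infdist y M"
  have ne: "M \<noteq> {}" using M subspace_0 by auto
  have d0: "d \<ge> 0" by (simp add: d_def infdist_nonneg)
  have dle: "d \<le> norm (y - x)" if "x \<in> M" for x
    using infdist_le[OF that, of y] by (simp add: d_def dist_norm)
  have "\<exists>x\<in>M. norm (y - x) < d + 1 / Suc n" for n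
  proof (rule ccontr)
    assume "\<not> ?thesis"
    then have "d + 1 / Suc n \<le> dist y x" if "x \<in> M" for x using that by (force simp: dist_norm)
    then have "d + 1 / Suc n \<le> d" unfolding d_def infdist_notempty[OF ne]
      by (intro cINF_greatest ne) (auto simp: d_def infdist_notempty[OF ne])
    moreover have "0 < 1 / real (Suc n)" by simp
    ultimately show False by linarith
  qed
  then obtain X where X: "\<And>n. X n \<in> M" "\<And>n. norm (y - X n) < d + 1 / Suc n" by metis
  define r where "r n = (d + 1 / Suc n)\<^sup>2 - d\<^sup>2" for n
  have r0: "r \<longlonglongrightarrow> 0"
  proof -
    have "(\<lambda>n. (d + inverse (real (Suc n)))\<^sup>2 - d\<^sup>2) \<longlonglongrightarrow> (d + 0)\<^sup>2 - d\<^sup>2"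
      by (intro tendsto_intros LIMSEQ_inverse_real_of_nat)
    then show ?thesis by (simp add: r_def[abs_def] inverse_eq_divide)
  qed
  \<comment> \<open>Parallelogram identity; the midpoint lies in \<open>M\<close> and is therefore
    at distance at least \<open>d\<close> from \<open>y\<close>.\<close>
  have par: "(norm (X m - X n))\<^sup>2 \<le> 2 * r m + 2 * r n" for m n
  proof -
    have "(1/2) *\<^sub>R (X m + X n) \<in> M" using M X by (intro subspace_scale subspace_add)
    from dle[OF this] have "d\<^sup>2 \<le> (norm (y - (1/2) *\<^sub>R (X m + X n)))\<^sup>2" using d0 by (intro power_mono)
    moreover have "(norm (X m - X n))\<^sup>2 + 4 * (norm (y - (1/2) *\<^sub>R (X m + X n)))\<^sup>2
        = 2 * (norm (y - X m))\<^sup>2 + 2 * (norm (y - X n))\<^sup>2"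
      by (simp add: power2_norm_eq_inner inner_simps inner_commute algebra_simps)
    moreover have "(norm (y - X i))\<^sup>2 \<le> (d + 1 / Suc i)\<^sup>2" for i
      using X(2)[of i] by (intro power_mono) auto
    from this[of m] this[of n] calculation show ?thesis unfolding r_def by argo
  qed
  have "Cauchy X"
  proof (rule CauchyI)
    fix e :: real assume e: "e > 0"
    have "\<forall>\<^sub>F n in sequentially. r n < e\<^sup>2 / 4"
      by (rule order_tendstoD(2)[OF r0]) (use e in simp)
    then obtain N where N: "\<And>n. n \<ge> N \<Longrightarrow> r n < e\<^sup>2 / 4" by (auto simp: eventually_sequentially)
    have "norm (X m - X n) < e" if "m \<ge> N" "n \<ge> N" for m n
    proof -
      have "(norm (X m - X n))\<^sup>2 < e\<^sup>2" using par[of m n] N[OF that(1)] N[OF that(2)] by argo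
      then show ?thesis using e by (simp add: power_less_imp_less_base)
    qed
    then show "\<exists>N. \<forall>m\<ge>N. \<forall>n\<ge>N. norm (X m - X n) < e" by blast
  qed
  then obtain x0 where x0: "X \<longlonglongrightarrow> x0" using Cauchy_convergent convergent_def by blast
  have x0M: "x0 \<in> M" using closed_sequentially[OF M(2) X(1) x0] .
  have "norm (y - x0) \<le> d"
  proof (rule LIMSEQ_le)
    show "(\<lambda>n. norm (y - X n)) \<longlonglongrightarrow> norm (y - x0)" by (intro tendsto_intros x0)
    have "(\<lambda>n. d + inverse (real (Suc n))) \<longlonglongrightarrow> d + 0"
      by (intro tendsto_intros LIMSEQ_inverse_real_of_nat)
    then show "(\<lambda>n. d + 1 / Suc n) \<longlonglongrightarrow> d" by (simp add: inverse_eq_divide)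
    show "\<exists>N. \<forall>n\<ge>N. norm (y - X n) \<le> d + 1 / Suc n" using X(2) less_imp_le by blast
  qed
  have orth: "inner (y - x0) x = 0" if x: "x \<in> M" for x
  proof (rule ccontr)
    define p where "p = inner (y - x0) x"
    assume "inner (y - x0) x \<noteq> 0"
    then have p: "p \<noteq> 0" "inner x x > 0" by (auto simp: p_def)
    \<comment> \<open>The coefficient of the projection of \<open>y - x0\<close> onto
      \<open>x\<close>: moving by it would lower the squared distance by
      \<open>s * p > 0\<close>.\<close>
    define s where "s = p / inner x x"
    have "x0 + s *\<^sub>R x \<in> M" using M x x0M by (intro subspace_add subspace_scale)
    from dle[OF this] \<open>norm (y - x0) \<le> d\<close> have "norm (y - x0) \<le> norm (y - x0 - s *\<^sub>R x)"
      by (simp add: algebra_simps)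
    then have "(norm (y - x0))\<^sup>2 \<le> (norm (y - x0 - s *\<^sub>R x))\<^sup>2" by (intro power_mono) auto
    also have "\<dots> = (norm (y - x0))\<^sup>2 - 2 * s * p + s\<^sup>2 * inner x x"
      unfolding power2_norm_eq_inner p_def
      by (simp add: inner_diff_left inner_diff_right inner_commute power2_eq_square algebra_simps)
    also have "s\<^sup>2 * inner x x = s * p" using p by (simp add: s_def power2_eq_square)
    finally have "s * p \<le> 0" by (simp add: mult.commute)
    moreover have "s * p > 0" using p by (simp add: s_def flip: power2_eq_square)
    ultimately show False by simp
  qed
  show ?thesis
    using orth x0M y by (intro exI[of _ "y - x0"]) auto
qed

lemma self_adjoint_symmetric:
  assumes "self_adjoint_operator E S" "x \<in> E" "y \<in> E"
  shows "inner (S x) y = inner x (S y)"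
proof -
  have "(y, S y) \<in> adjoint_graph E S"
    using assms by (auto simp: self_adjoint_operator_def operator_graph_def)
  then show ?thesis using assms by (auto simp: adjoint_graph_def)
qed

text \<open>This is the inclusion of the adjoint graph in the graph, the maximality half of
  self-adjointness: membership in the domain is obtained from testing against \<open>E\<close>
  alone. The symmetric half is the preceding lemma.\<close>

lemma self_adjoint_adjoint_mem:
  assumes "self_adjoint_operator E S" "\<And>x. x \<in> E \<Longrightarrow> inner (S x) v = inner x w"
  shows "v \<in> E" "S v = w"
proof -
  have "(v, w) \<in> operator_graph E S"
    using assms by (auto simp: self_adjoint_operator_def adjoint_graph_def)
  then show "v \<in> E" "S v = w" by (auto simp: operator_graph_def)
qed

text \<open>The range is closed, and its orthogonal complement is the kernel of \<open>S\<close>, hence trivial.\<close>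

lemma self_adjoint_coercive_inverse:
  fixes S :: "'a::{real_inner, complete_space} \<Rightarrow> 'a"
  assumes sa: "self_adjoint_operator E S" and pos: "positive_operator E S"
    and l: "l > 0" and below: "\<And>v. v \<in> E \<Longrightarrow> norm v \<le> l * norm (S v)"
  obtains K where "positive_bounded K" "\<And>x. K x \<in> E" "\<And>x. S (K x) = x" "\<And>v. v \<in> E \<Longrightarrow> K (S v) = v"
proof -
  have subE: "subspace E" and add: "\<And>x y. x \<in> E \<Longrightarrow> y \<in> E \<Longrightarrow> S (x + y) = S x + S y"
    and scale: "\<And>x r. x \<in> E \<Longrightarrow> S (r *\<^sub>R x) = r *\<^sub>R S x"
    using sa by (auto simp: self_adjoint_operator_def linear_operator_on_def)
  have diff: "S (x - y) = S x - S y" if "x \<in> E" "y \<in> E" for x y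
    using add[of x "(-1) *\<^sub>R y"] scale[of y "-1"] that subE subspace_neg[of E y] by simp
  have inj: "x = y" if "x \<in> E" "y \<in> E" "S x = S y" for x y
    using below[of "x - y"] diff[OF that(1,2)] that subE by (simp add: subspace_diff)
  have "S ` E = UNIV"
  proof (rule ccontr)
    assume "S ` E \<noteq> UNIV"
    then obtain y where "y \<notin> S ` E" by auto
    moreover have "subspace (S ` E)"
    proof (rule subspaceI)
      show "0 \<in> S ` E" using scale[of 0 0] subspace_0[OF subE] by force
      show "x + y \<in> S ` E" if "x \<in> S ` E" "y \<in> S ` E" for x y
        using that add subspace_add[OF subE] by (metis (no_types) imageE imageI)
      show "r *\<^sub>R x \<in> S ` E" if "x \<in> S ` E" for r x
        using that scale subspace_scale[OF subE] by (metis (no_types) imageE imageI)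
    qed
    moreover have "closed (S ` E)"
    unfolding closed_sequential_limits
    proof (intro allI impI, elim conjE)
      fix Y w assume "\<forall>n. Y n \<in> S ` E" and w: "Y \<longlonglongrightarrow> w"
      then have "\<forall>n. \<exists>x. x \<in> E \<and> Y n = S x" by blast
      then obtain X where X: "\<And>n. X n \<in> E" "\<And>n. Y n = S (X n)" by metis
      have "Cauchy X"
      proof (rule CauchyI)
        fix e :: real assume "e > 0"
        then obtain N where N: "\<And>m n. m \<ge> N \<Longrightarrow> n \<ge> N \<Longrightarrow> norm (Y m - Y n) < e / l"
          using LIMSEQ_imp_Cauchy[OF w] l CauchyD[of Y "e / l"] by (metis divide_pos_pos)
        have "norm (X m - X n) < e" if "m \<ge> N" "n \<ge> N" for m n
        proof -
          have "norm (X m - X n) \<le> l * norm (Y m - Y n)"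
            using below[of "X m - X n"] X diff subE by (simp add: subspace_diff)
          also have "\<dots> < e" using N[OF that] l by (simp add: field_simps)
          finally show ?thesis .
        qed
        then show "\<exists>N. \<forall>m\<ge>N. \<forall>n\<ge>N. norm (X m - X n) < e" by blast
      qed
      then obtain x where x: "X \<longlonglongrightarrow> x" using Cauchy_convergent convergent_def by blast
      \<comment> \<open>Self-adjointness makes \<open>S\<close> a closed operator: the relation
        between \<open>X n\<close> and \<open>Y n\<close> is tested against \<open>z\<close> in the
        domain, where both sides pass to the limit.\<close>
      have "inner (S z) x = inner z w" if z: "z \<in> E" for z
      proof (rule LIMSEQ_unique)
        show "(\<lambda>n. inner (S z) (X n)) \<longlonglongrightarrow> inner (S z) x" by (intro tendsto_intros x)
        have "inner (S z) (X n) = inner z (Y n)" for n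
          using self_adjoint_symmetric[OF sa z X(1)] X(2) by simp
        then show "(\<lambda>n. inner (S z) (X n)) \<longlonglongrightarrow> inner z w" by (simp add: tendsto_inner w)
      qed
      from self_adjoint_adjoint_mem[OF sa this] show "w \<in> S ` E" by auto
    qed
    ultimately obtain z where z: "z \<noteq> 0" "\<And>x. x \<in> E \<Longrightarrow> inner z (S x) = 0"
      using closed_subspace_orthogonal_ex[of "S ` E" y] by auto
    \<comment> \<open>Orthogonality to the range says that \<open>(z, 0)\<close> belongs to the
      adjoint graph.\<close>
    have "z \<in> E \<and> S z = 0"
      using self_adjoint_adjoint_mem[OF sa, of z 0] z(2) by (simp add: inner_commute)
    then show False using below[of z] z(1) by simp
  qed
  then have "\<exists>v. v \<in> E \<and> S v = x" for x by (metis UNIV_I imageE)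
  then obtain K where K: "\<And>x. K x \<in> E" "\<And>x. S (K x) = x" by metis
  have KS: "K (S v) = v" if "v \<in> E" for v using inj K that by blast
  have "positive_bounded K"
  proof (rule positive_bounded.intro)
    show "bounded_linear K"
    proof (rule bounded_linear_intro[where K = l])
      show "K (x + y) = K x + K y" for x y
        by (rule inj) (auto simp: K add intro: subspace_add[OF subE])
      show "K (r *\<^sub>R x) = r *\<^sub>R K x" for r x
        by (rule inj) (auto simp: K scale intro: subspace_scale[OF subE])
      show "norm (K x) \<le> norm x * l" for x
        using below[OF K(1), of x] by (simp add: K mult.commute)
    qed
    show "inner (K x) y = inner x (K y)" for x y
      using self_adjoint_symmetric[OF sa K(1) K(1), of x y] by (simp add: K)
    show "0 \<le> inner (K x) x" for x
      using pos K unfolding positive_operator_def by (metis inner_commute)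
  qed
  then show ?thesis using that K KS by blast
qed

section \<open>Test functions\<close>

text \<open>With \<open>q = x (1 - x)\<close>, the functions \<open>p q\<^sup>-\<^sup>k exp (-1/q)\<close> on \<open>(0, 1)\<close>, extended by 0, are closed
  under differentiation; \<open>bump_step\<close> computes the polynomial and the exponent of the derivative.\<close>

definition bump :: "real poly \<Rightarrow> nat \<Rightarrow> real \<Rightarrow> real" where
  "bump p k x = (if 0 < x \<and> x < 1
     then poly p x * (1 / (x * (1 - x))) ^ k * exp (- (1 / (x * (1 - x)))) else 0)"

definition bump_step :: "real poly \<times> nat \<Rightarrow> real poly \<times> nat" where
  "bump_step = (\<lambda>(p, k). (pderiv p * [:0, 1, -1:]\<^sup>2
     - smult (real k) (p * [:1, -2:] * [:0, 1, -1:]) + p * [:1, -2:], k + 2))"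

text \<open>From \<open>(1 + r / n) ^ n \<le> exp r\<close> with \<open>n = k + 2\<close>. The two
  spare powers leave \<open>(1 / r)\<^sup>2\<close>, which for \<open>r = 1 / q\<close> is the
  factor \<open>q\<^sup>2\<close> needed at the endpoints of the bump.\<close>

lemma power_mult_exp_minus_le:
  fixes r :: real
  assumes "r > 0"
  shows "r ^ k * exp (- r) \<le> real (k + 2) ^ (k + 2) * (1 / r)\<^sup>2"
proof -
  have "(r / real (k + 2)) ^ (k + 2) \<le> (1 + r / real (k + 2)) ^ (k + 2)"
    using assms by (intro power_mono) auto
  also have "\<dots> \<le> exp r"
    using assms by (intro exp_ge_one_plus_x_over_n_power_n) auto
  finally have "r ^ (k + 2) \<le> real (k + 2) ^ (k + 2) * exp r"
    by (simp add: power_divide divide_le_eq mult.commute del: power_Suc)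
  then have "r ^ (k + 2) * (exp (- r) * (1 / r)\<^sup>2) \<le> real (k + 2) ^ (k + 2) * exp r * (exp (- r) * (1 / r)\<^sup>2)"
    by (intro mult_right_mono) auto
  moreover have "r ^ (k + 2) * (exp (- r) * (1 / r)\<^sup>2) = r ^ k * exp (- r)"
    using assms by (simp add: power_add power_divide power2_eq_square)
  moreover have "real (k + 2) ^ (k + 2) * exp r * (exp (- r) * (1 / r)\<^sup>2) = real (k + 2) ^ (k + 2) * (1 / r)\<^sup>2"
    by (simp add: exp_minus)
  ultimately show ?thesis by metis
qed

lemma DERIV_zero_of_quadratic_bound:
  fixes f :: "real \<Rightarrow> real"
  assumes "\<And>x. \<bar>f x\<bar> \<le> C * (x - a)\<^sup>2"
  shows "(f has_real_derivative 0) (at a)"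
proof -
  have fa: "f a = 0" using assms[of a] by simp
  have "((\<lambda>h. (f (a + h) - f a) / h) \<longlongrightarrow> 0) (at 0)"
  proof (rule Lim_null_comparison)
    have "\<bar>(f (a + h) - f a) / h\<bar> \<le> C * \<bar>h\<bar>" if "h \<noteq> 0" for h
      using assms[of "a + h"] that fa by (simp add: power2_eq_square abs_mult divide_le_eq)
    then show "\<forall>\<^sub>F h in at 0. norm ((f (a + h) - f a) / h) \<le> C * \<bar>h\<bar>"
      by (auto simp: eventually_at_filter)
    show "((\<lambda>h. C * \<bar>h\<bar>) \<longlongrightarrow> 0) (at 0)" by (auto intro!: tendsto_eq_intros)
  qed
  then show ?thesis by (simp add: DERIV_def)
qed

text \<open>Inside the unit interval this is the product rule, with all terms brought to the common
  power \<open>k + 2\<close> of \<open>1 / q\<close>; outside, the function vanishes. At 0 and 1 the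
  quadratic bound shows that the derivative is 0, the value assigned by the next bump.\<close>

lemma bump_has_derivative:
  "(bump p k has_real_derivative (case bump_step (p, k) of (p', k') \<Rightarrow> bump p' k' x)) (at x)"
proof -
  let ?q = "\<lambda>x. x * (1 - x) :: real"
  have "compact (poly p ` {0..1})" by (intro compact_continuous_image continuous_intros) auto
  then obtain B where B: "\<And>x. 0 \<le> x \<Longrightarrow> x \<le> 1 \<Longrightarrow> \<bar>poly p x\<bar> \<le> B"
    using compact_imp_bounded bounded_iff by (metis atLeastAtMost_iff imageI real_norm_def)
  define C where "C = B * real (k + 2) ^ (k + 2)"
  have B0: "B \<ge> 0" using B[of 0] by simp
  have C0: "C \<ge> 0" using B0 by (simp add: C_def)
  have bound: "\<bar>bump p k y\<bar> \<le> C * y\<^sup>2 \<and> \<bar>bump p k y\<bar> \<le> C * (y - 1)\<^sup>2" for y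
  proof (cases "0 < y \<and> y < 1")
    case True
    then have q: "?q y > 0" by simp
    have "\<bar>bump p k y\<bar> = \<bar>poly p y\<bar> * ((1 / ?q y) ^ k * exp (- (1 / ?q y)))"
      using True by (simp add: bump_def abs_mult)
    also have "\<dots> \<le> B * (real (k + 2) ^ (k + 2) * (1 / (1 / ?q y))\<^sup>2)"
      using True q B[of y] B0 by (intro mult_mono power_mult_exp_minus_le) auto
    finally have b: "\<bar>bump p k y\<bar> \<le> C * (?q y)\<^sup>2" by (simp add: C_def)
    have "(?q y)\<^sup>2 \<le> y\<^sup>2" using True by (intro power_mono) (auto simp: mult_le_cancel_left1)
    moreover have "(?q y)\<^sup>2 \<le> (1 - y)\<^sup>2" using True by (intro power_mono) (auto simp: mult_le_cancel_right1)
    moreover have "(1 - y)\<^sup>2 = (y - 1)\<^sup>2" by (rule power2_commute)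
    ultimately show ?thesis using b C0 by (metis mult_left_mono order_trans)
  qed (use C0 in \<open>auto simp: bump_def\<close>)
  consider "0 < x \<and> x < 1" | "x < 0" | "x > 1" | "x = 0" | "x = 1" by linarith
  then show ?thesis
  proof cases
    case 1
    define r where "r = 1 / ?q x"
    have q: "?q x \<noteq> 0" using 1 by simp
    have rq: "r * ?q x = 1" using q by (simp add: r_def)
    have dr: "((\<lambda>x. 1 / ?q x) has_real_derivative - ((1 - 2 * x) * r\<^sup>2)) (at x)"
      using q by (auto intro!: derivative_eq_intros simp: r_def power2_eq_square minus_divide_left)
    have "((\<lambda>x. poly p x * (1 / ?q x) ^ k * exp (- (1 / ?q x))) has_real_derivative
        ((poly (pderiv p) x * r ^ k + poly p x * (real k * r ^ (k - 1) * - ((1 - 2 * x) * r\<^sup>2))) * exp (- r)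
        + poly p x * r ^ k * (exp (- r) * ((1 - 2 * x) * r\<^sup>2)))) (at x)"
      by (rule DERIV_cong[OF DERIV_mult[OF DERIV_mult[OF poly_DERIV DERIV_power[OF dr]]
            DERIV_fun_exp[OF DERIV_minus[OF dr]]]], unfold r_def[symmetric])
        (simp add: algebra_simps)
    also have "(poly (pderiv p) x * r ^ k + poly p x * (real k * r ^ (k - 1) * - ((1 - 2 * x) * r\<^sup>2))) * exp (- r)
        + poly p x * r ^ k * (exp (- r) * ((1 - 2 * x) * r\<^sup>2))
        = (case bump_step (p, k) of (p', k') \<Rightarrow> bump p' k' x)"
    proof -
      \<comment> \<open>For \<open>k = 0\<close> the exponent \<open>k - 1\<close> is truncated to
        0, which is harmless because of the factor \<open>real k\<close>.\<close>
      have k1: "real k * r ^ (k - 1) * r\<^sup>2 = real k * r ^ (k + 2) * ?q x"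
      proof (cases k)
        case (Suc j)
        have "r ^ (k + 2) * ?q x = r ^ (k + 1) * (r * ?q x)" by simp
        also have "\<dots> = r ^ (k - 1) * r\<^sup>2" by (simp add: rq Suc power2_eq_square)
        finally show ?thesis by (simp add: mult.assoc)
      qed simp
      have k2: "r ^ k = r ^ (k + 2) * (?q x)\<^sup>2"
      proof -
        have "r ^ (k + 2) * (?q x)\<^sup>2 = r ^ k * (r * ?q x)\<^sup>2" by (simp add: power_add power_mult_distrib power2_eq_square)
        then show ?thesis by (simp add: rq)
      qed
      have k3: "r ^ k * r\<^sup>2 = r ^ (k + 2)" by (simp add: power_add power2_eq_square)
      have k4: "(case bump_step (p, k) of (p', k') \<Rightarrow> bump p' k' x)
          = (poly (pderiv p) x * (?q x)\<^sup>2 - real k * (poly p x * (1 - 2 * x) * ?q x) + poly p x * (1 - 2 * x))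
            * r ^ (k + 2) * exp (- r)"
      proof -
        have "poly (fst (bump_step (p, k))) x
            = poly (pderiv p) x * (?q x)\<^sup>2 - real k * (poly p x * (1 - 2 * x) * ?q x) + poly p x * (1 - 2 * x)"
          by (simp add: bump_step_def power2_eq_square algebra_simps)
        moreover have "snd (bump_step (p, k)) = k + 2" by (simp add: bump_step_def)
        moreover have "(case bump_step (p, k) of (p', k') \<Rightarrow> bump p' k' x)
            = poly (fst (bump_step (p, k))) x * r ^ snd (bump_step (p, k)) * exp (- r)"
          unfolding split_beta bump_def r_def using 1 by (simp only: if_True simp_thms)
        ultimately show ?thesis by (simp only:)
      qed
      have "(poly (pderiv p) x * r ^ k + poly p x * (real k * r ^ (k - 1) * - ((1 - 2 * x) * r\<^sup>2))) * exp (- r)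
          + poly p x * r ^ k * (exp (- r) * ((1 - 2 * x) * r\<^sup>2))
          = poly (pderiv p) x * (r ^ k) * exp (- r)
            - poly p x * (1 - 2 * x) * (real k * r ^ (k - 1) * r\<^sup>2) * exp (- r)
            + poly p x * (1 - 2 * x) * (r ^ k * r\<^sup>2) * exp (- r)"
        by (simp add: algebra_simps del: power_Suc)
      also have "\<dots> = poly (pderiv p) x * (r ^ (k + 2) * (?q x)\<^sup>2) * exp (- r)
            - poly p x * (1 - 2 * x) * (real k * r ^ (k + 2) * ?q x) * exp (- r)
            + poly p x * (1 - 2 * x) * r ^ (k + 2) * exp (- r)"
        by (simp only: k1 k3) (simp only: k2[symmetric])
      also have "\<dots> = (case bump_step (p, k) of (p', k') \<Rightarrow> bump p' k' x)"
        unfolding k4 by (simp add: algebra_simps power2_eq_square del: power_Suc)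
      finally show ?thesis .
    qed
    finally show ?thesis
      by (rule has_field_derivative_transform_within_open[where S = "{0<..<1}"]) (use 1 in \<open>auto simp: bump_def\<close>)
  next
    case 2
    have "((\<lambda>_. 0 :: real) has_real_derivative 0) (at x)" by simp
    then have "(bump p k has_real_derivative 0) (at x)"
      by (rule has_field_derivative_transform_within_open[where S = "{..<0}"]) (use 2 in \<open>auto simp: bump_def\<close>)
    then show ?thesis using 2 by (simp add: bump_step_def bump_def)
  next
    case 3
    have "((\<lambda>_. 0 :: real) has_real_derivative 0) (at x)" by simp
    then have "(bump p k has_real_derivative 0) (at x)"
      by (rule has_field_derivative_transform_within_open[where S = "{1<..}"]) (use 3 in \<open>auto simp: bump_def\<close>)
    then show ?thesis using 3 by (simp add: bump_step_def bump_def)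
  next
    case 4
    have "(bump p k has_real_derivative 0) (at 0)"
      by (rule DERIV_zero_of_quadratic_bound[of _ C]) (use bound in auto)
    then show ?thesis using 4 by (simp add: bump_step_def bump_def)
  next
    case 5
    have "(bump p k has_real_derivative 0) (at 1)"
      by (rule DERIV_zero_of_quadratic_bound[of _ C]) (use bound in auto)
    then show ?thesis using 5 by (simp add: bump_step_def bump_def)
  qed
qed

text \<open>A function together with a candidate for each of its iterated derivatives. Smoothness in
  the sense of \<open>test_function\<close> is read off from such a chain, with no computation of
  \<open>deriv ^^ n\<close>.\<close>

definition derivative_chain :: "(nat \<Rightarrow> real \<Rightarrow> real) \<Rightarrow> bool" where
  "derivative_chain F \<longleftrightarrow> (\<forall>n x. (F n has_real_derivative F (Suc n) x) (at x))"

lemma derivative_chain_deriv: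
  assumes "derivative_chain F"
  shows "(deriv ^^ n) (F 0) = F n" and "(deriv ^^ n) (F 0) differentiable (at t)"
proof -
  show *: "(deriv ^^ n) (F 0) = F n"
    by (induction n) (use assms in \<open>auto simp: derivative_chain_def intro: DERIV_imp_deriv\<close>)
  show "(deriv ^^ n) (F 0) differentiable (at t)"
    unfolding * using assms by (auto simp: derivative_chain_def real_differentiable_def)
qed

lemma derivative_chain_bump:
  "\<exists>F. derivative_chain F \<and> F 0 = bump p k"
proof -
  define s where "s n = (bump_step ^^ n) (p, k)" for n
  define F where "F n = bump (fst (s n)) (snd (s n))" for n
  have "(F n has_real_derivative F (Suc n) x) (at x)" for n x
    using bump_has_derivative[of "fst (s n)" "snd (s n)" x] by (simp add: F_def s_def split_beta)
  then show ?thesis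
    by (intro exI[of _ F]) (simp add: derivative_chain_def F_def s_def)
qed

lemma antiderivative_of_bump:
  obtains \<Theta> :: "real \<Rightarrow> real" where
    "\<And>x. (\<Theta> has_real_derivative bump 1 0 x) (at x)"
    "\<And>x. x \<le> 0 \<Longrightarrow> \<Theta> x = 0" "\<And>x. x \<ge> 1 \<Longrightarrow> \<Theta> x = \<Theta> 1"
proof -
  \<comment> \<open>Integration starts at -1, not at 0, so that 0 is an interior point of the
    interval and the derivative there is two-sided.\<close>
  define \<Theta> where "\<Theta> x = integral {-1..x} (bump 1 0)" for x
  have cont: "continuous_on UNIV (bump 1 0)"
    using bump_has_derivative[of 1 0] by (meson DERIV_isCont continuous_at_imp_continuous_on)
  have zero: "\<Theta> x = 0" if "x \<le> 0" for x
  proof -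
    have "\<Theta> x = integral {-1..x} (\<lambda>_. 0 :: real)" unfolding \<Theta>_def
      by (rule integral_cong) (use that in \<open>auto simp: bump_def\<close>)
    then show ?thesis by simp
  qed
  have d: "(\<Theta> has_real_derivative bump 1 0 x) (at x)" for x
  proof (cases "x < 0")
    case True
    have "((\<lambda>_. 0 :: real) has_real_derivative 0) (at x)" by simp
    then have "(\<Theta> has_real_derivative 0) (at x)"
      by (rule has_field_derivative_transform_within_open[where S = "{..<0}"]) (use True zero in auto)
    then show ?thesis using True by (simp add: bump_def)
  next
    case False
    have "(\<Theta> has_vector_derivative bump 1 0 x) (at x within {-1..x + 1})"
      unfolding \<Theta>_def[abs_def] using False
      by (intro integral_has_vector_derivative continuous_on_subset[OF cont]) auto
    moreover have "at x within {-1..x + 1} = at x" by (rule at_within_interior) (use False in simp)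
    ultimately show ?thesis by (simp add: has_real_derivative_iff_has_vector_derivative)
  qed
  have "\<Theta> x = \<Theta> 1" if "x \<ge> 1" for x
  proof (cases "x = 1")
    case False
    show ?thesis
    proof (rule DERIV_isconst_end[where f = \<Theta> and a = 1 and b = x])
      show "1 < x" using False that by simp
      show "continuous_on {1..x} \<Theta>"
        by (meson d DERIV_isCont continuous_at_imp_continuous_on)
      show "(\<Theta> has_real_derivative 0) (at y)" if "1 < y" "y < x" for y
        using d[of y] that by (simp add: bump_def)
    qed
  qed simp
  with d zero show ?thesis using that by blast
qed

text \<open>The test function below rises from 0 to a plateau on \<open>[s1, s1 + d]\<close> and descends on
  \<open>[s2, s2 + d]\<close>.\<close>

lemma plateau_test_function:
  assumes s: "0 < s1" "s1 < s2" and d: "0 < d"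
  obtains \<phi> where "test_function \<phi>"
    "\<And>t. deriv \<phi> t = bump 1 0 ((t - s1) / d) - bump 1 0 ((t - s2) / d)"
proof -
  obtain F where F: "derivative_chain F" "F 0 = bump 1 0" using derivative_chain_bump by blast
  obtain \<Theta> where \<Theta>: "\<And>x. (\<Theta> has_real_derivative bump 1 0 x) (at x)"
    "\<And>x. x \<le> 0 \<Longrightarrow> \<Theta> x = 0" "\<And>x. x \<ge> 1 \<Longrightarrow> \<Theta> x = \<Theta> 1"
    using antiderivative_of_bump by blast
  define A where "A n = (case n of 0 \<Rightarrow> \<Theta> | Suc m \<Rightarrow> F m)" for n
  have A: "(A n has_real_derivative A (Suc n) x) (at x)" for n x
    using F \<Theta>(1) by (cases n) (auto simp: A_def derivative_chain_def)
  \<comment> \<open>The outer factor \<open>d\<close> cancels the \<open>1 / d\<close> of the first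
    differentiation, so the derivative of \<open>G 0\<close> is a difference of two bumps of height
    independent of \<open>d\<close>.\<close>
  define G where "G n t = d * ((1 / d) ^ n * (A n ((t - s1) / d) - A n ((t - s2) / d)))" for n t
  have G: "derivative_chain G"
    unfolding derivative_chain_def
  proof (intro allI)
    fix n t
    have sub: "((\<lambda>t. A n ((t - s) / d)) has_real_derivative A (Suc n) ((t - s) / d) * (1 / d)) (at t)" for s
      by (rule DERIV_chain2[OF A]) (use d in \<open>auto intro!: derivative_eq_intros\<close>)
    have "((\<lambda>t. d * ((1 / d) ^ n * (A n ((t - s1) / d) - A n ((t - s2) / d)))) has_real_derivative
        d * ((1 / d) ^ n * (A (Suc n) ((t - s1) / d) * (1 / d) - A (Suc n) ((t - s2) / d) * (1 / d)))) (at t)"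
      by (intro DERIV_cmult DERIV_diff sub)
    then show "(G n has_real_derivative G (Suc n) t) (at t)"
      by (simp add: G_def[abs_def] algebra_simps)
  qed
  have G0: "G 0 t = 0" if "t \<notin> {s1..s2 + d}" for t
  proof -
    consider "t < s1" | "t > s2 + d" using \<open>t \<notin> _\<close> by force
    then show ?thesis
    proof cases
      case 1
      then have "(t - s1) / d \<le> 0" "(t - s2) / d \<le> 0" using s d by (auto simp: divide_le_0_iff)
      then show ?thesis by (simp add: G_def A_def \<Theta>)
    next
      case 2
      then have "(t - s1) / d \<ge> 1" "(t - s2) / d \<ge> 1" using s d by (auto simp: le_divide_eq)
      from \<Theta>(3)[OF this(1)] \<Theta>(3)[OF this(2)] show ?thesis by (simp add: G_def A_def)
    qed
  qed
  have "closure {t. G 0 t \<noteq> 0} \<subseteq> {s1..s2 + d}"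
    by (rule closure_minimal) (use G0 in blast, simp)
  then have "test_function (G 0)"
    unfolding test_function_def using derivative_chain_deriv(2)[OF G] s
    by (auto simp: compact_eq_bounded_closed intro: bounded_subset[OF bounded_closed_interval[of s1 "s2 + d"]])
  moreover have "deriv (G 0) t = bump 1 0 ((t - s1) / d) - bump 1 0 ((t - s2) / d)" for t
  proof -
    have "deriv (G 0) = G 1" using derivative_chain_deriv(1)[OF G, of 1] by simp
    then show ?thesis using d by (simp add: G_def A_def F)
  qed
  ultimately show ?thesis using that by blast
qed

section \<open>Integration against test functions and distributional derivatives\<close>

lemma test_function_support:
  assumes "test_function \<phi>"
  obtains T where "T > 0" "\<phi> 0 = 0" "\<And>t. t \<ge> T \<Longrightarrow> \<phi> t = 0" "\<And>t. t \<ge> T \<Longrightarrow> deriv \<phi> t = 0"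
    "\<And>t. (\<phi> has_real_derivative deriv \<phi> t) (at t)" "continuous_on UNIV (deriv \<phi>)"
proof -
  have diff: "((deriv ^^ n) \<phi>) differentiable (at t)" for n t
    using assms by (simp add: test_function_def)
  have d: "(\<phi> has_real_derivative deriv \<phi> t) (at t)" for t
    using diff[of 0 t] by (simp add: DERIV_deriv_iff_real_differentiable)
  have c: "continuous_on UNIV (deriv \<phi>)"
    using diff[of 1] by (auto intro!: differentiable_imp_continuous_on simp: differentiable_on_def)
  have cl: "compact (closure {t. \<phi> t \<noteq> 0})" "closure {t. \<phi> t \<noteq> 0} \<subseteq> {0<..}"
    using assms by (auto simp: test_function_def)
  then obtain M where M: "\<And>t. t \<in> closure {t. \<phi> t \<noteq> 0} \<Longrightarrow> \<bar>t\<bar> \<le> M"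
    using compact_imp_bounded[OF cl(1)] by (auto simp: bounded_iff)
  have z: "\<phi> t = 0" if "t > M" for t
    using M[of t] closure_subset[of "{t. \<phi> t \<noteq> 0}"] that by force
  have z': "deriv \<phi> t = 0" if "t > M" for t
  proof -
    have "((\<lambda>_. 0 :: real) has_real_derivative 0) (at t)" by simp
    then have "(\<phi> has_real_derivative 0) (at t)"
      by (rule has_field_derivative_transform_within_open[where S = "{M<..}"]) (use z that in auto)
    then show ?thesis by (rule DERIV_imp_deriv)
  qed
  have "\<phi> 0 = 0" using cl(2) closure_subset[of "{t. \<phi> t \<noteq> 0}"] by force
  \<comment> \<open>Going past the bound on the support makes both the function and its derivative
    vanish at \<open>T\<close> itself.\<close>
  then show ?thesis using d c z z' by (intro that[of "\<bar>M\<bar> + 1"]) auto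
qed

lemma integral_halfline_truncate:
  fixes f :: "real \<Rightarrow> real"
  assumes "\<And>t. t > T \<Longrightarrow> f t = 0"
  shows "integral {0..} f = integral {0..T} f"
proof -
  have "integral {0..} f = integral {0..} (\<lambda>t. if t \<in> {0..T} then f t else 0)"
    by (rule integral_cong) (use assms in auto)
  also have "\<dots> = integral {0..T} f" 
  proof -
    have "{0..T} \<inter> {0..} = {0..T}" "{0..} \<inter> {0..T} = {0..T}" by auto
    then show ?thesis by (simp only: integral_restrict_Int)
  qed
  finally show ?thesis .
qed

lemma integral_deriv_test_function:
  assumes "test_function \<phi>"
  shows "integral {0..} (deriv \<phi>) = 0"
proof -
  obtain T where T: "T > 0" "\<phi> 0 = 0" "\<And>t. t \<ge> T \<Longrightarrow> \<phi> t = 0" "\<And>t. t \<ge> T \<Longrightarrow> deriv \<phi> t = 0"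
    "\<And>t. (\<phi> has_real_derivative deriv \<phi> t) (at t)" "continuous_on UNIV (deriv \<phi>)"
    using test_function_support[OF assms] by blast
  have "(deriv \<phi> has_integral \<phi> T - \<phi> 0) {0..T}"
    by (rule fundamental_theorem_of_calculus)
      (use T in \<open>auto simp: has_real_derivative_iff_has_vector_derivative[symmetric] intro: has_field_derivative_at_within\<close>)
  then show ?thesis
    using T integral_halfline_truncate[of T "deriv \<phi>"] by (simp add: integral_unique)
qed

text \<open>Two different values at positive times \<open>s1 < s2\<close> are excluded by a test
  function whose derivative is a positive bump just after \<open>s1\<close> and a negative one just
  after \<open>s2\<close>. The sign \<sigma> covers both orders of the values, and the value at 0
  follows by continuity.\<close>

lemma du_bois_reymond:
  assumes \<kappa>: "continuous_on {0..} \<kappa>"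
    and zero: "\<And>\<phi>. test_function \<phi> \<Longrightarrow> integral {0..} (\<lambda>t. \<kappa> t * deriv \<phi> t) = 0"
    and t: "t \<ge> 0"
  shows "\<kappa> t = \<kappa> 0"
proof -
  have less: False
    if s: "0 < s1" "s1 < s2" and ne: "\<sigma> * \<kappa> s1 < \<sigma> * \<kappa> s2" for s1 s2 \<sigma> :: real
  proof -
    \<comment> \<open>Subtracting the midpoint does not change the integral, because the derivative
      of a test function has integral zero, and it gives the integrand \<open>h\<close> one sign on
      both bumps.\<close>
    define m where "m = (\<sigma> * \<kappa> s1 + \<sigma> * \<kappa> s2) / 2"
    have m: "\<sigma> * \<kappa> s1 < m" "m < \<sigma> * \<kappa> s2" using ne by (simp_all add: m_def)
    have c: "continuous_on {0..} (\<lambda>t. \<sigma> * \<kappa> t - m)" by (intro continuous_intros \<kappa>)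
    have "\<exists>d>0. \<forall>t\<in>{0..}. dist t s1 < d \<longrightarrow> dist (\<sigma> * \<kappa> t - m) (\<sigma> * \<kappa> s1 - m) < m - \<sigma> * \<kappa> s1"
      using c[unfolded continuous_on_iff, rule_format, of s1 "m - \<sigma> * \<kappa> s1"] s m by auto
    then obtain d1 where d1: "d1 > 0" "\<And>t. t \<ge> 0 \<Longrightarrow> dist t s1 < d1 \<Longrightarrow> \<sigma> * \<kappa> t < m"
      by (force simp: dist_real_def)
    have "\<exists>d>0. \<forall>t\<in>{0..}. dist t s2 < d \<longrightarrow> dist (\<sigma> * \<kappa> t - m) (\<sigma> * \<kappa> s2 - m) < \<sigma> * \<kappa> s2 - m"
      using c[unfolded continuous_on_iff, rule_format, of s2 "\<sigma> * \<kappa> s2 - m"] s m by auto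
    then obtain d2 where d2: "d2 > 0" "\<And>t. t \<ge> 0 \<Longrightarrow> dist t s2 < d2 \<Longrightarrow> \<sigma> * \<kappa> t > m"
      by (force simp: dist_real_def)
    \<comment> \<open>With this width the first bump lies where \<open>\<sigma> * \<kappa>\<close>
      is below \<open>m\<close> and the second where it is above; in particular the two bumps cannot
      overlap.\<close>
    define d where "d = min d1 d2"
    have d: "d > 0" using d1 d2 by (simp add: d_def)
    obtain \<phi> where \<phi>: "test_function \<phi>"
      "\<And>t. deriv \<phi> t = bump 1 0 ((t - s1) / d) - bump 1 0 ((t - s2) / d)"
      using plateau_test_function[OF s d] by blast
    obtain T where T: "T > 0" "\<phi> 0 = 0" "\<And>t. t \<ge> T \<Longrightarrow> \<phi> t = 0" "\<And>t. t \<ge> T \<Longrightarrow> deriv \<phi> t = 0"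
      "\<And>t. (\<phi> has_real_derivative deriv \<phi> t) (at t)" "continuous_on UNIV (deriv \<phi>)"
      using test_function_support[OF \<phi>(1)] by blast
    have \<kappa>T: "continuous_on {0..T} \<kappa>" by (rule continuous_on_subset[OF \<kappa>]) auto
    have \<phi>T: "continuous_on {0..T} (deriv \<phi>)" by (rule continuous_on_subset[OF T(6)]) auto
    have i1: "integral {0..T} (\<lambda>t. \<kappa> t * deriv \<phi> t) = 0"
      using zero[OF \<phi>(1)] integral_halfline_truncate[of T "\<lambda>t. \<kappa> t * deriv \<phi> t"] T(4) by simp
    have i2: "integral {0..T} (deriv \<phi>) = 0"
      using integral_deriv_test_function[OF \<phi>(1)] integral_halfline_truncate[of T "deriv \<phi>"] T(4) by simp
    define h where "h t = (m - \<sigma> * \<kappa> t) * deriv \<phi> t" for t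
    have hc: "continuous_on {0..T} h" unfolding h_def[abs_def] by (intro continuous_intros \<kappa>T \<phi>T)
    have "h = (\<lambda>t. m * deriv \<phi> t - \<sigma> * (\<kappa> t * deriv \<phi> t))" by (auto simp: h_def algebra_simps)
    then have "integral {0..T} h = integral {0..T} (\<lambda>t. m * deriv \<phi> t) - integral {0..T} (\<lambda>t. \<sigma> * (\<kappa> t * deriv \<phi> t))"
      by (simp only:) (intro Henstock_Kurzweil_Integration.integral_diff integrable_continuous_real continuous_intros \<kappa>T \<phi>T)
    then have "integral {0..T} h = 0" by (simp add: i1 i2)
    moreover have h0: "0 \<le> h t" if "t \<in> {0..T}" for t
    proof -
      have b: "bump 1 0 x \<ge> 0" for x by (simp add: bump_def)
      consider "s1 < t \<and> t < s1 + d" | "s2 < t \<and> t < s2 + d" | "\<not> (s1 < t \<and> t < s1 + d)" "\<not> (s2 < t \<and> t < s2 + d)" by blast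
      then show ?thesis
      proof cases
        case 1
        then have "\<sigma> * \<kappa> t < m" using that by (intro d1) (auto simp: d_def dist_real_def)
        moreover have "\<not> (s2 < t \<and> t < s2 + d)"
        proof
          assume "s2 < t \<and> t < s2 + d"
          then have "\<sigma> * \<kappa> t > m" using that by (intro d2) (auto simp: d_def dist_real_def)
          then show False using \<open>\<sigma> * \<kappa> t < m\<close> by simp
        qed
        then have "bump 1 0 ((t - s2) / d) = 0" using d by (auto simp: bump_def divide_less_eq zero_less_divide_iff)
        ultimately show ?thesis using b by (simp add: h_def \<phi>(2))
      next
        case 2
        then have "\<sigma> * \<kappa> t > m" using that by (intro d2) (auto simp: d_def dist_real_def)
        moreover have "\<not> (s1 < t \<and> t < s1 + d)"
        proof
          assume "s1 < t \<and> t < s1 + d"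
          then have "\<sigma> * \<kappa> t < m" using that by (intro d1) (auto simp: d_def dist_real_def)
          then show False using \<open>\<sigma> * \<kappa> t > m\<close> by simp
        qed
        then have "bump 1 0 ((t - s1) / d) = 0" using d by (auto simp: bump_def divide_less_eq zero_less_divide_iff)
        ultimately show ?thesis using b[of "(t - s2) / d"] by (simp add: h_def \<phi>(2) mult_nonpos_nonneg)
      next
        case 3
        then show ?thesis using d by (auto simp: h_def \<phi>(2) bump_def divide_less_eq zero_less_divide_iff)
      qed
    qed
    ultimately have all0: "\<forall>t\<in>{0..T}. h t = 0"
      using integral_eq_0_iff[OF hc T(1) h0] by blast
    \<comment> \<open>The centre of the first bump, where \<open>h\<close> is strictly positive
      although a continuous nonnegative function with zero integral must vanish.\<close>
    define t0 where "t0 = s1 + d / 2"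
    have "\<sigma> * \<kappa> t0 < m" using s d by (intro d1) (auto simp: d_def dist_real_def t0_def)
    moreover have "\<not> (s2 < t0 \<and> t0 < s2 + d)"
    proof
      assume "s2 < t0 \<and> t0 < s2 + d"
      then have "\<sigma> * \<kappa> t0 > m" using s d by (intro d2) (auto simp: d_def dist_real_def t0_def)
      then show False using \<open>\<sigma> * \<kappa> t0 < m\<close> by simp
    qed
    then have "bump 1 0 ((t0 - s2) / d) = 0" using d by (auto simp: bump_def divide_less_eq zero_less_divide_iff)
    moreover have "bump 1 0 ((t0 - s1) / d) > 0" using d by (simp add: t0_def bump_def)
    ultimately have "h t0 > 0" by (simp add: h_def \<phi>(2))
    moreover have "t0 \<in> {0..T}"
    proof (rule ccontr)
      assume "t0 \<notin> {0..T}"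
      then have "t0 \<ge> T" using s d by (auto simp: t0_def)
      then show False using T(4) \<open>h t0 > 0\<close> by (simp add: h_def)
    qed
    ultimately show False using all0 by force
  qed
  have eq: "\<kappa> s1 = \<kappa> s2" if "0 < s1" "s1 < s2" for s1 s2
    using less[OF that, of 1] less[OF that, of "-1"] by force
  have pos: "\<kappa> s = \<kappa> 1" if "s > 0" for s
    using eq that by (metis linorder_cases zero_less_one)
  have "\<kappa> 0 = \<kappa> 1"
  proof (rule tendsto_unique)
    have "(\<kappa> \<longlongrightarrow> \<kappa> 0) (at 0 within {0..})" using \<kappa> by (simp add: continuous_on)
    then show "(\<kappa> \<longlongrightarrow> \<kappa> 0) (at_right 0)" by (rule tendsto_within_subset) auto
    show "(\<kappa> \<longlongrightarrow> \<kappa> 1) (at_right 0)"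
      by (intro tendsto_eventually always_eventually[THEN eventually_at_filter[THEN iffD2]] allI impI)
        (rule pos, simp)
  qed simp
  with pos[of t] t show ?thesis by (metis less_eq_real_def)
qed

lemma integral_by_parts_test_function:
  assumes r: "continuous_on {0..} r" and \<phi>: "test_function \<phi>"
  shows "integral {0..} (\<lambda>t. integral {0..t} r * deriv \<phi> t) = - integral {0..} (\<lambda>t. r t * \<phi> t)"
proof -
  obtain T where T: "T > 0" "\<phi> 0 = 0" "\<And>t. t \<ge> T \<Longrightarrow> \<phi> t = 0" "\<And>t. t \<ge> T \<Longrightarrow> deriv \<phi> t = 0"
    "\<And>t. (\<phi> has_real_derivative deriv \<phi> t) (at t)" "continuous_on UNIV (deriv \<phi>)"
    using test_function_support[OF \<phi>] by blast
  let ?R = "\<lambda>t. integral {0..t} r"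
  have rT: "continuous_on {0..T} r" and RT: "continuous_on {0..T} ?R"
    by (auto intro: continuous_on_subset[OF r] continuous_on_subset[OF continuous_on_integral_halfline[OF r]])
  have \<phi>T: "continuous_on {0..T} (deriv \<phi>)" by (rule continuous_on_subset[OF T(6)]) auto
  have \<phi>cT: "continuous_on {0..T} \<phi>" using T(5) by (meson DERIV_isCont continuous_at_imp_continuous_on)
  have "((\<lambda>t. ?R t * deriv \<phi> t + r t * \<phi> t) has_integral ?R T * \<phi> T - ?R 0 * \<phi> 0) {0..T}"
  proof (rule fundamental_theorem_of_calculus)
    show "0 \<le> T" using T by simp
    fix t assume t: "t \<in> {0..T}"
    have "(?R has_real_derivative r t) (at t within {0..T})"
      using integral_has_vector_derivative[OF rT t] by (simp add: has_real_derivative_iff_has_vector_derivative)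
    from DERIV_mult[OF this has_field_derivative_at_within[OF T(5)]]
    show "((\<lambda>t. ?R t * \<phi> t) has_vector_derivative ?R t * deriv \<phi> t + r t * \<phi> t) (at t within {0..T})"
      by (simp add: has_real_derivative_iff_has_vector_derivative algebra_simps)
  qed
  then have "integral {0..T} (\<lambda>t. ?R t * deriv \<phi> t + r t * \<phi> t) = 0"
    using T by (simp add: integral_unique)
  moreover have "integral {0..T} (\<lambda>t. ?R t * deriv \<phi> t + r t * \<phi> t)
      = integral {0..T} (\<lambda>t. ?R t * deriv \<phi> t) + integral {0..T} (\<lambda>t. r t * \<phi> t)"
    by (intro Henstock_Kurzweil_Integration.integral_add integrable_continuous_real continuous_intros rT RT \<phi>T \<phi>cT)
  moreover have "integral {0..} (\<lambda>t. ?R t * deriv \<phi> t) = integral {0..T} (\<lambda>t. ?R t * deriv \<phi> t)"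
    by (rule integral_halfline_truncate) (use T in auto)
  moreover have "integral {0..} (\<lambda>t. r t * \<phi> t) = integral {0..T} (\<lambda>t. r t * \<phi> t)"
    by (rule integral_halfline_truncate) (use T in auto)
  ultimately show ?thesis by simp
qed

text \<open>Integration by parts replaces \<open>r\<close> by its primitive, so the hypothesis says
  that \<psi> plus this primitive has vanishing distributional derivative. Continuity up to 0
  identifies the constant as \<open>\<psi> 0\<close>, although test functions live on positive
  times.\<close>

lemma distributional_derivative_iff:
  assumes \<psi>: "continuous_on {0..} \<psi>" and r: "continuous_on {0..} r"
  shows "(\<forall>\<phi>. test_function \<phi> \<longrightarrow> integral {0..} (\<lambda>t. - \<psi> t * deriv \<phi> t + r t * \<phi> t) = 0)
    \<longleftrightarrow> (\<forall>t\<ge>0. \<psi> t + integral {0..t} r = \<psi> 0)"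
proof -
  define \<kappa> where "\<kappa> t = \<psi> t + integral {0..t} r" for t
  have Rc: "continuous_on {0..} (\<lambda>t. integral {0..t} r)" by (rule continuous_on_integral_halfline[OF r])
  have \<kappa>: "continuous_on {0..} \<kappa>" unfolding \<kappa>_def[abs_def] by (intro continuous_intros \<psi> Rc)
  have eq: "integral {0..} (\<lambda>t. - \<psi> t * deriv \<phi> t + r t * \<phi> t) = - integral {0..} (\<lambda>t. \<kappa> t * deriv \<phi> t)"
    if \<phi>: "test_function \<phi>" for \<phi>
  proof -
    obtain T where T: "T > 0" "\<phi> 0 = 0" "\<And>t. t \<ge> T \<Longrightarrow> \<phi> t = 0" "\<And>t. t \<ge> T \<Longrightarrow> deriv \<phi> t = 0"
      "\<And>t. (\<phi> has_real_derivative deriv \<phi> t) (at t)" "continuous_on UNIV (deriv \<phi>)"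
      using test_function_support[OF \<phi>] by blast
    have c: "continuous_on {0..T} r" "continuous_on {0..T} \<psi>" "continuous_on {0..T} (\<lambda>t. integral {0..t} r)"
      by (auto intro: continuous_on_subset[OF r] continuous_on_subset[OF Rc] continuous_on_subset[OF \<psi>])
    have \<phi>T: "continuous_on {0..T} (deriv \<phi>)" by (rule continuous_on_subset[OF T(6)]) auto
    have \<phi>cT: "continuous_on {0..T} \<phi>" using T(5) by (meson DERIV_isCont continuous_at_imp_continuous_on)
    have "integral {0..T} (\<lambda>t. - \<psi> t * deriv \<phi> t + r t * \<phi> t)
        = - integral {0..T} (\<lambda>t. \<psi> t * deriv \<phi> t) + integral {0..T} (\<lambda>t. r t * \<phi> t)"
      by (subst Henstock_Kurzweil_Integration.integral_add)
        (auto intro!: integrable_continuous_real continuous_intros c \<phi>T \<phi>cT)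
    moreover have "integral {0..T} (\<lambda>t. \<kappa> t * deriv \<phi> t)
        = integral {0..T} (\<lambda>t. \<psi> t * deriv \<phi> t) + integral {0..T} (\<lambda>t. integral {0..t} r * deriv \<phi> t)"
      unfolding \<kappa>_def distrib_right
      by (intro Henstock_Kurzweil_Integration.integral_add integrable_continuous_real continuous_intros c \<phi>T)
    moreover have "integral {0..T} (\<lambda>t. integral {0..t} r * deriv \<phi> t) = - integral {0..T} (\<lambda>t. r t * \<phi> t)"
      using integral_by_parts_test_function[OF r \<phi>] T
        integral_halfline_truncate[of T "\<lambda>t. integral {0..t} r * deriv \<phi> t"]
        integral_halfline_truncate[of T "\<lambda>t. r t * \<phi> t"] by simp
    ultimately show ?thesis
      using T integral_halfline_truncate[of T "\<lambda>t. - \<psi> t * deriv \<phi> t + r t * \<phi> t"]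
        integral_halfline_truncate[of T "\<lambda>t. \<kappa> t * deriv \<phi> t"] by simp
  qed
  have k0: "\<kappa> 0 = \<psi> 0" by (simp add: \<kappa>_def)
  show ?thesis
  proof
    assume L: "\<forall>\<phi>. test_function \<phi> \<longrightarrow> integral {0..} (\<lambda>t. - \<psi> t * deriv \<phi> t + r t * \<phi> t) = 0"
    have "\<kappa> t = \<kappa> 0" if "t \<ge> 0" for t
      by (rule du_bois_reymond[OF \<kappa> _ that]) (use L eq in force)
    then show "\<forall>t\<ge>0. \<psi> t + integral {0..t} r = \<psi> 0" unfolding k0 by (simp add: \<kappa>_def)
  next
    assume R: "\<forall>t\<ge>0. \<psi> t + integral {0..t} r = \<psi> 0"
    show "\<forall>\<phi>. test_function \<phi> \<longrightarrow> integral {0..} (\<lambda>t. - \<psi> t * deriv \<phi> t + r t * \<phi> t) = 0"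
    proof (intro allI impI)
      fix \<phi> assume \<phi>: "test_function \<phi>"
      have "integral {0..} (\<lambda>t. \<kappa> t * deriv \<phi> t) = integral {0..} (\<lambda>t. \<psi> 0 * deriv \<phi> t)"
        by (rule integral_cong) (use R in \<open>auto simp: \<kappa>_def\<close>)
      then show "integral {0..} (\<lambda>t. - \<psi> t * deriv \<phi> t + r t * \<phi> t) = 0"
        unfolding eq[OF \<phi>] by (simp add: integral_deriv_test_function[OF \<phi>])
    qed
  qed
qed

section \<open>The system with a bounded operator\<close>

lemma bounded_linear_triple:
  assumes "bounded_linear f" "bounded_linear g" "bounded_linear h"
  shows "bounded_linear (\<lambda>x. (f x, g x, h x))"
  by (intro bounded_linear_Pair assms)

text \<open>A linear Volterra equation on the product of three copies of the space: \<open>L\<close>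
  is the local part, and the memory \<open>N\<close> reads the first component and acts on the
  third.\<close>

lemma mgt_system_exists:
  fixes Q :: "'a::banach \<Rightarrow> 'a"
  assumes Q: "bounded_linear Q" and g: "C1_halfline g g'"
  shows "\<exists>U V P. mgt_system \<tau> \<alpha> b c g Q (\<lambda>_. 0) (\<lambda>_. 0) U V P \<and> U 0 = a0 \<and> V 0 = a1 \<and> P 0 = a2"
proof -
  define L where "L x = (fst (snd x), Q (snd (snd x)),
      (1 / \<tau>) *\<^sub>R (- \<alpha> *\<^sub>R snd (snd x) - Q (c\<^sup>2 *\<^sub>R fst x + b *\<^sub>R fst (snd x))))" for x :: "'a \<times> 'a \<times> 'a"
  define N where "N x = (0 :: 'a, 0 :: 'a, (1 / \<tau>) *\<^sub>R Q (fst x))" for x :: "'a \<times> 'a \<times> 'a"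
  note bl = bounded_linear_compose[OF bounded_linear_fst bounded_linear_snd]
    bounded_linear_compose[OF bounded_linear_snd bounded_linear_snd] bounded_linear_fst
  have L: "bounded_linear L" unfolding L_def[abs_def]
    by (intro bounded_linear_triple bl bounded_linear_compose[OF Q] bounded_linear_sub bounded_linear_add
        bounded_linear_compose[OF bounded_linear_scaleR_right])
  have N: "bounded_linear N" unfolding N_def[abs_def]
    by (intro bounded_linear_triple bl bounded_linear_compose[OF Q] bounded_linear_zero
        bounded_linear_compose[OF bounded_linear_scaleR_right])
  obtain x where x: "continuous_on {0..} x" "x 0 = (a0, a1, a2)"
    "\<And>t. t \<ge> 0 \<Longrightarrow> (x has_vector_derivative L (x t) + N (conv g x t)) (at t within {0..})"
    using volterra_ode_exists[OF L N g, of "(a0, a1, a2)"] by blast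
  define U where "U t = fst (x t)" for t
  define V where "V t = fst (snd (x t))" for t
  define P where "P t = snd (snd (x t))" for t
  have "mgt_system \<tau> \<alpha> b c g Q (\<lambda>_. 0) (\<lambda>_. 0) U V P"
    unfolding mgt_system_def
  proof (intro allI impI)
    fix t :: real assume t: "t \<ge> 0"
    have cU: "fst (conv g x t) = conv g U t"
      using conv_linear[OF bounded_linear_fst C1_halfline_continuous[OF g] x(1) t] by (simp add: U_def[abs_def])
    have "(U has_vector_derivative fst (L (x t) + N (conv g x t))) (at t within {0..})"
      "(V has_vector_derivative fst (snd (L (x t) + N (conv g x t)))) (at t within {0..})"
      "(P has_vector_derivative snd (snd (L (x t) + N (conv g x t)))) (at t within {0..})"
      unfolding U_def[abs_def] V_def[abs_def] P_def[abs_def]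
      by (intro bounded_linear.has_vector_derivative[OF _ x(3)[OF t]] bl)+
    moreover have "fst (L (x t) + N (conv g x t)) = V t"
      "fst (snd (L (x t) + N (conv g x t))) = Q (P t) + 0"
      "snd (snd (L (x t) + N (conv g x t)))
        = (1 / \<tau>) *\<^sub>R (0 - \<alpha> *\<^sub>R P t - Q (c\<^sup>2 *\<^sub>R U t + b *\<^sub>R V t - conv g U t))"
      by (simp_all add: L_def N_def U_def V_def P_def cU
          linear_diff[OF bounded_linear.linear[OF Q]] algebra_simps)
    ultimately show "(U has_vector_derivative V t) (at t within {0..}) \<and>
        (V has_vector_derivative Q (P t) + 0) (at t within {0..}) \<and>
        (P has_vector_derivative
          (1 / \<tau>) *\<^sub>R (0 - \<alpha> *\<^sub>R P t - Q (c\<^sup>2 *\<^sub>R U t + b *\<^sub>R V t - conv g U t))) (at t within {0..})"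
      by simp
  qed
  then show ?thesis using x(2) by (intro exI[of _ U] exI[of _ V] exI[of _ P]) (simp add: U_def V_def P_def)
qed

text \<open>Used for products of resolvents: a bound on the transformed solution then needs only a
  bound on the transformed data.\<close>

lemma mgt_system_image:
  fixes U V P :: "real \<Rightarrow> 'a::banach"
  assumes sys: "mgt_system \<tau> \<alpha> b c g Q f1 f2 U V P" and L: "bounded_linear L"
    and comm: "\<And>x. L (Q x) = Q (L x)" and g: "continuous_on {0..} g"
  shows "mgt_system \<tau> \<alpha> b c g Q (\<lambda>t. L (f1 t)) (\<lambda>t. L (f2 t)) (\<lambda>t. L (U t)) (\<lambda>t. L (V t)) (\<lambda>t. L (P t))"
  unfolding mgt_system_def
proof (intro allI impI)
  fix t :: real assume t: "t \<ge> 0"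
  note lin = bounded_linear.linear[OF L]
  note c = mgt_system_continuous[OF sys]
  note D = bounded_linear.has_vector_derivative[OF L]
  have cv: "L (conv g U t) = conv g (\<lambda>t. L (U t)) t" by (rule conv_linear[OF L g c(1) t])
  have s: "(U has_vector_derivative V t) (at t within {0..})"
    "(V has_vector_derivative Q (P t) + f1 t) (at t within {0..})"
    "(P has_vector_derivative
        (1 / \<tau>) *\<^sub>R (f2 t - \<alpha> *\<^sub>R P t - Q (c\<^sup>2 *\<^sub>R U t + b *\<^sub>R V t - conv g U t))) (at t within {0..})"
    using sys t by (auto simp: mgt_system_def)
  show "((\<lambda>t. L (U t)) has_vector_derivative L (V t)) (at t within {0..}) \<and>
      ((\<lambda>t. L (V t)) has_vector_derivative Q (L (P t)) + L (f1 t)) (at t within {0..}) \<and>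
      ((\<lambda>t. L (P t)) has_vector_derivative
        (1 / \<tau>) *\<^sub>R (L (f2 t) - \<alpha> *\<^sub>R L (P t) - Q (c\<^sup>2 *\<^sub>R L (U t) + b *\<^sub>R L (V t) - conv g (\<lambda>t. L (U t)) t)))
      (at t within {0..})"
    using D[OF s(1)] D[OF s(2)] D[OF s(3)]
    by (simp add: linear_add[OF lin] linear_diff[OF lin] linear_cmul[OF lin] comm cv)
qed

lemma mgt_system_diff:
  fixes U V P :: "real \<Rightarrow> 'a::banach"
  assumes sys: "mgt_system \<tau> \<alpha> b c g Q f1 f2 U V P" and sys': "mgt_system \<tau> \<alpha> b c g Q h1 h2 U' V' P'"
    and Q: "linear Q" and g: "continuous_on {0..} g"
  shows "mgt_system \<tau> \<alpha> b c g Q (\<lambda>t. f1 t - h1 t) (\<lambda>t. f2 t - h2 t)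
    (\<lambda>t. U t - U' t) (\<lambda>t. V t - V' t) (\<lambda>t. P t - P' t)"
  unfolding mgt_system_def
proof (intro allI impI)
  fix t :: real assume t: "t \<ge> 0"
  have cv: "conv g (\<lambda>t. U t - U' t) t = conv g U t - conv g U' t"
    by (rule conv_diff[OF g mgt_system_continuous(1)[OF sys] mgt_system_continuous(1)[OF sys'] t])
  have s: "(U has_vector_derivative V t) (at t within {0..})"
    "(V has_vector_derivative Q (P t) + f1 t) (at t within {0..})"
    "(P has_vector_derivative
        (1 / \<tau>) *\<^sub>R (f2 t - \<alpha> *\<^sub>R P t - Q (c\<^sup>2 *\<^sub>R U t + b *\<^sub>R V t - conv g U t))) (at t within {0..})"
    "(U' has_vector_derivative V' t) (at t within {0..})"
    "(V' has_vector_derivative Q (P' t) + h1 t) (at t within {0..})"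
    "(P' has_vector_derivative
        (1 / \<tau>) *\<^sub>R (h2 t - \<alpha> *\<^sub>R P' t - Q (c\<^sup>2 *\<^sub>R U' t + b *\<^sub>R V' t - conv g U' t))) (at t within {0..})"
    using sys sys' t by (auto simp: mgt_system_def)
  have e1: "Q (P t) + f1 t - (Q (P' t) + h1 t) = Q (P t - P' t) + (f1 t - h1 t)"
    by (simp add: linear_diff[OF Q])
  have e2: "(1 / \<tau>) *\<^sub>R (f2 t - \<alpha> *\<^sub>R P t - Q (c\<^sup>2 *\<^sub>R U t + b *\<^sub>R V t - conv g U t))
      - (1 / \<tau>) *\<^sub>R (h2 t - \<alpha> *\<^sub>R P' t - Q (c\<^sup>2 *\<^sub>R U' t + b *\<^sub>R V' t - conv g U' t))
      = (1 / \<tau>) *\<^sub>R (f2 t - h2 t - \<alpha> *\<^sub>R (P t - P' t)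
        - Q (c\<^sup>2 *\<^sub>R (U t - U' t) + b *\<^sub>R (V t - V' t) - (conv g U t - conv g U' t)))"
  proof -
    have "c\<^sup>2 *\<^sub>R (U t - U' t) + b *\<^sub>R (V t - V' t) - (conv g U t - conv g U' t)
        = (c\<^sup>2 *\<^sub>R U t + b *\<^sub>R V t - conv g U t) - (c\<^sup>2 *\<^sub>R U' t + b *\<^sub>R V' t - conv g U' t)"
      by (simp add: algebra_simps)
    then show ?thesis by (simp only: linear_diff[OF Q]) (simp add: algebra_simps)
  qed
  show "((\<lambda>t. U t - U' t) has_vector_derivative V t - V' t) (at t within {0..}) \<and>
      ((\<lambda>t. V t - V' t) has_vector_derivative Q (P t - P' t) + (f1 t - h1 t)) (at t within {0..}) \<and>
      ((\<lambda>t. P t - P' t) has_vector_derivative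
        (1 / \<tau>) *\<^sub>R (f2 t - h2 t - \<alpha> *\<^sub>R (P t - P' t)
          - Q (c\<^sup>2 *\<^sub>R (U t - U' t) + b *\<^sub>R (V t - V' t) - conv g (\<lambda>t. U t - U' t) t))) (at t within {0..})"
    unfolding cv e1[symmetric] e2[symmetric]
    by (intro conjI has_vector_derivative_diff s)
qed

text \<open>A solution for \<open>Q'\<close> is regarded as a forced solution for \<open>Q\<close>,
  so that two approximations can be subtracted and compared by the energy estimate of a single
  operator.\<close>

lemma mgt_system_change_operator:
  assumes "mgt_system \<tau> \<alpha> b c g Q' (\<lambda>_. 0) (\<lambda>_. 0) U V P"
  shows "mgt_system \<tau> \<alpha> b c g Q (\<lambda>t. Q' (P t) - Q (P t))
    (\<lambda>t. Q (c\<^sup>2 *\<^sub>R U t + b *\<^sub>R V t - conv g U t) - Q' (c\<^sup>2 *\<^sub>R U t + b *\<^sub>R V t - conv g U t)) U V P"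
  using assms unfolding mgt_system_def by (simp add: algebra_simps)

text \<open>The limit \<open>\<epsilon> \<rightarrow> 0\<close> of the system with \<open>Q = (K + \<epsilon>)\<^sup>-\<^sup>1\<close>, after applying \<open>K + \<epsilon>\<close>.\<close>

definition mgt_limit_system ::
  "real \<Rightarrow> real \<Rightarrow> real \<Rightarrow> real \<Rightarrow> (real \<Rightarrow> real) \<Rightarrow> ('a::real_normed_vector \<Rightarrow> 'a) \<Rightarrow>
    (real \<Rightarrow> 'a) \<Rightarrow> (real \<Rightarrow> 'a) \<Rightarrow> (real \<Rightarrow> 'a) \<Rightarrow> bool" where
  "mgt_limit_system \<tau> \<alpha> b c g K U V P \<longleftrightarrow>
     continuous_on {0..} V \<and> continuous_on {0..} P \<and> (\<forall>t\<ge>0.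
     (U has_vector_derivative V t) (at t within {0..}) \<and>
     ((\<lambda>t. K (V t)) has_vector_derivative P t) (at t within {0..}) \<and>
     ((\<lambda>t. \<tau> *\<^sub>R K (P t)) has_vector_derivative
        - (\<alpha> *\<^sub>R K (P t)) - (c\<^sup>2 *\<^sub>R U t + b *\<^sub>R V t - conv g U t)) (at t within {0..}))"

lemma mgt_limit_system_continuous:
  assumes "mgt_limit_system \<tau> \<alpha> b c g K U V P"
  shows "continuous_on {0..} U" "continuous_on {0..} V" "continuous_on {0..} P"
  using assms unfolding mgt_limit_system_def
  by (auto simp: continuous_on_eq_continuous_within intro: has_vector_derivative_continuous)

section \<open>Locally uniform limits of convolutions and derivatives\<close>

lemma uniform_limit_conv:
  fixes U :: "nat \<Rightarrow> real \<Rightarrow> 'a::banach"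
  assumes lim: "uniform_limit {0..T} U U' sequentially" and g: "continuous_on {0..} g"
    and U: "\<And>n. continuous_on {0..} (U n)" and U': "continuous_on {0..} U'" and T: "T \<ge> 0"
  shows "uniform_limit {0..T} (\<lambda>n. conv g (U n)) (conv g U') sequentially"
proof (rule uniform_limitI)
  fix e :: real assume e: "e > 0"
  obtain M where M: "M \<ge> 0" "\<And>t. 0 \<le> t \<Longrightarrow> t \<le> T \<Longrightarrow> norm (g t) \<le> M"
    using bounded_on_initial_interval[OF g] by blast
  define d where "d = e / (M * T + 1)"
  have MT: "M * T + 1 > 0" using M T by (simp add: add_nonneg_pos)
  have d: "d > 0" using e MT by (simp add: d_def)
  from uniform_limitD[OF lim d]
  show "\<forall>\<^sub>F n in sequentially. \<forall>t\<in>{0..T}. dist (conv g (U n) t) (conv g U' t) < e"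
  proof eventually_elim
    case (elim n)
    show ?case
    proof
      fix t assume t: "t \<in> {0..T}"
      have "dist (conv g (U n) t) (conv g U' t) = norm (conv g (\<lambda>s. U n s - U' s) t)"
        using t by (simp add: dist_norm conv_diff[OF g U U'])
      also have "\<dots> \<le> M * integral {0..t} (\<lambda>s. norm (U n s - U' s))"
        using t M by (intro norm_conv_le g continuous_intros U U') auto
      also have "\<dots> \<le> M * integral {0..t} (\<lambda>s. d)"
        using elim t M by (intro mult_left_mono integral_le integrable_continuous_real continuous_intros
            continuous_on_subset[OF U] continuous_on_subset[OF U'])
          (auto simp: dist_norm less_imp_le)
      also have "\<dots> = M * t * d" using t by simp
      also have "\<dots> \<le> M * T * d" using t M d by (intro mult_right_mono mult_left_mono) auto
      also have "\<dots> < (M * T + 1) * d" using d by (simp add: algebra_simps)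
      also have "\<dots> = e" using MT by (simp add: d_def)
      finally show "dist (conv g (U n) t) (conv g U' t) < e" .
    qed
  qed
qed

text \<open>In integrated form the relation between \<open>F n\<close> and \<open>F' n\<close> needs
  pointwise convergence of the former and uniform convergence of the latter; differentiating the
  limiting identity gives the result, including the one-sided derivative at 0.\<close>

lemma has_vector_derivative_uniform_limit:
  fixes F F' :: "nat \<Rightarrow> real \<Rightarrow> 'a::banach"
  assumes F: "\<And>t. 0 \<le> t \<Longrightarrow> (\<lambda>n. F n t) \<longlonglongrightarrow> f t"
    and F': "\<And>T. 0 \<le> T \<Longrightarrow> uniform_limit {0..T} F' f' sequentially"
    and c: "\<And>n. continuous_on {0..} (F' n)"
    and d: "\<And>n t. 0 \<le> t \<Longrightarrow> (F n has_vector_derivative F' n t) (at t within {0..})"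
    and t: "0 \<le> t"
  shows "(f has_vector_derivative f' t) (at t within {0..})"
proof -
  have f'c: "continuous_on {0..} f'"
  proof (rule continuous_on_halflineI)
    fix T :: real assume "0 \<le> T"
    then show "continuous_on {0..T} f'"
      by (intro uniform_limit_theorem[OF _ F']) (auto intro!: always_eventually continuous_on_subset[OF c])
  qed
  have eq: "f 0 + integral {0..s} f' = f s" if s: "s \<in> {0..}" for s
  proof -
    have s0: "0 \<le> s" using s by simp
    obtain I J where IJ: "\<And>n. (F' n has_integral I n) {0..s}" "(f' has_integral J) {0..s}" "I \<longlonglongrightarrow> J"
      by (rule uniform_limit_integral[OF F'[OF s0]]) (auto intro!: continuous_on_subset[OF c])
    have "(F' n has_integral F n s - F n 0) {0..s}" for n
      by (rule fundamental_theorem_of_calculus)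
        (use s0 in \<open>auto intro!: has_vector_derivative_within_subset[OF d]\<close>)
    then have "I = (\<lambda>n. F n s - F n 0)" using IJ(1) has_integral_unique by blast
    then have "(\<lambda>n. F n s - F n 0) \<longlonglongrightarrow> J" using IJ(3) by simp
    moreover have "(\<lambda>n. F n s - F n 0) \<longlonglongrightarrow> f s - f 0" by (intro tendsto_diff F s0) simp
    ultimately have "J = f s - f 0" using LIMSEQ_unique by blast
    then show ?thesis using IJ(2) by (simp add: integral_unique)
  qed
  show ?thesis
  proof (rule has_vector_derivative_transform[where f = "\<lambda>s. f 0 + integral {0..s} f'"])
    show "((\<lambda>s. f 0 + integral {0..s} f') has_vector_derivative f' t) (at t within {0..})"
      using has_vector_derivative_add[OF has_vector_derivative_const integral_has_vector_derivative_halfline[OF f'c t]]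
      by simp
  qed (use t eq in auto)
qed

section \<open>Dense range and an energy constant common to all resolvents\<close>

locale mgt_abstract = positive_bounded K for K :: "'a::{real_inner, banach} \<Rightarrow> 'a" +
  fixes g g' :: "real \<Rightarrow> real" and \<tau> \<alpha> b c :: real
  assumes dense: "closure (range K) = UNIV"
    and g: "C1_halfline g g'" and constants: "\<tau> > 0" "b > 0" "\<alpha> \<ge> 0"
begin

abbreviation sys where "sys \<equiv> mgt_system \<tau> \<alpha> b c g"

lemmas g_continuous = C1_halfline_continuous[OF g]

text \<open>By symmetry the kernel of \<open>K\<close> is orthogonal to its range, which is
  dense.\<close>

lemma K_inj:
  assumes "K x = 0"
  shows "x = 0"
proof -
  have "closed {y. inner x y = 0}" by (intro closed_Collect_eq continuous_intros)
  moreover have "range K \<subseteq> {y. inner x y = 0}" using assms by (auto simp: symmetric[symmetric])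
  ultimately have "closure (range K) \<subseteq> {y. inner x y = 0}" by (rule closure_minimal[rotated])
  then have "inner x x = 0" unfolding dense by blast
  then show ?thesis by simp
qed

lemma K_approx:
  assumes "e > 0"
  shows "\<exists>y. norm (K y - a) < e"
proof -
  have "a \<in> closure (range K)" using dense by simp
  then show ?thesis using assms unfolding closure_approachable by (auto simp: dist_norm)
qed

text \<open>Density of the range of \<open>K\<close> is used twice, the second time with the
  tolerance divided by a bound for \<open>K\<close>.\<close>

lemma KK_approx:
  assumes e: "e > 0"
  shows "\<exists>y. norm (K (K y) - a) < e"
proof -
  obtain B where B: "B > 0" "\<And>x. norm (K x) \<le> norm x * B"
    using bounded_linear.pos_bounded[OF bounded_linear] by blast
  obtain x where x: "norm (K x - a) < e / 2" using K_approx[of "e / 2"] e by auto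
  obtain y where y: "norm (K y - x) < e / (2 * B)" using K_approx[of "e / (2 * B)" x] e B by auto
  have "norm (K (K y) - K x) \<le> norm (K y - x) * B" using B(2)[of "K y - x"] by (simp add: linear_diff[OF linear])
  also have "\<dots> < e / 2" using y B by (simp add: field_simps)
  finally have "norm (K (K y) - a) < e" using x norm_triangle_ineq[of "K (K y) - K x" "K x - a"] by simp
  then show ?thesis by blast
qed

text \<open>The parameter \<open>e\<close> is quantified inside, so the uniformity on which both the
  passage to the limit and uniqueness rest is recorded in one predicate.\<close>

definition energy_constant :: "real \<Rightarrow> real \<Rightarrow> bool" where
  "energy_constant T C \<longleftrightarrow> (\<forall>e f1 f2 U V P D. e > 0 \<longrightarrow> sys (Q e) f1 f2 U V P \<longrightarrow>
    (\<forall>t\<in>{0..T}. norm (f1 t) \<le> D \<and> norm (f2 t) \<le> D) \<longrightarrow>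
    norm (U 0) \<le> D \<longrightarrow> norm (V 0) \<le> D \<longrightarrow> norm (P 0) \<le> D \<longrightarrow>
    (\<forall>t\<in>{0..T}. norm (U t) \<le> C * D \<and> norm (V t) \<le> C * D \<and> norm (P t) \<le> C * D))"

lemma energy_constant_exists:
  obtains C where "C \<ge> 0" "energy_constant T C"
proof -
  obtain C where C0: "C \<ge> 0" and C: "\<forall>(Q :: 'a \<Rightarrow> 'a) f1 f2 U V P D.
    Real_Vector_Spaces.linear Q \<longrightarrow> (\<forall>x y. inner (Q x) y = inner x (Q y)) \<longrightarrow>
    mgt_system \<tau> \<alpha> b c g Q f1 f2 U V P \<longrightarrow>
    (\<forall>t\<in>{0..T}. norm (f1 t) \<le> D \<and> norm (f2 t) \<le> D) \<longrightarrow>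
    norm (U 0) \<le> D \<longrightarrow> norm (V 0) \<le> D \<longrightarrow> norm (P 0) \<le> D \<longrightarrow>
    (\<forall>t\<in>{0..T}. norm (U t) \<le> C * D \<and> norm (V t) \<le> C * D \<and> norm (P t) \<le> C * D)"
    using mgt_energy_estimate[OF g constants, where c = c and T = T and 'a = 'a] by blast
  show ?thesis
  proof (rule that[OF C0])
    show "energy_constant T C"
      unfolding energy_constant_def
    proof (intro allI impI)
      fix e f1 f2 U V P D
      assume e: "e > 0" and h: "sys (Q e) f1 f2 U V P"
        "\<forall>t\<in>{0..T}. norm (f1 t) \<le> D \<and> norm (f2 t) \<le> D"
        "norm (U 0) \<le> D" "norm (V 0) \<le> D" "norm (P 0) \<le> D"
      have sym: "\<forall>x y. inner (Q e x) y = inner x (Q e y)" by (simp add: resolvent_symmetric[OF e])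
      show "\<forall>t\<in>{0..T}. norm (U t) \<le> C * D \<and> norm (V t) \<le> C * D \<and> norm (P t) \<le> C * D"
        using C[THEN spec, of "Q e"] resolvent_linear[OF e] sym h by blast
    qed
  qed
qed

lemma energy_constantD:
  assumes "energy_constant T C" "e > 0" "sys (Q e) f1 f2 U V P"
    "\<And>t. 0 \<le> t \<Longrightarrow> t \<le> T \<Longrightarrow> norm (f1 t) \<le> D" "\<And>t. 0 \<le> t \<Longrightarrow> t \<le> T \<Longrightarrow> norm (f2 t) \<le> D"
    "norm (U 0) \<le> D" "norm (V 0) \<le> D" "norm (P 0) \<le> D" "0 \<le> t" "t \<le> T"
  shows "norm (U t) \<le> C * D \<and> norm (V t) \<le> C * D \<and> norm (P t) \<le> C * D"
  using assms(1)[unfolded energy_constant_def, rule_format, OF assms(2,3) _ assms(6-8), of t] assms(4,5,9,10)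
  by auto

end

section \<open>Passage to the limit\<close>

context mgt_abstract
begin

definition eps :: "nat \<Rightarrow> real" where "eps n = inverse (real (Suc n))"

lemma eps_pos: "eps n > 0" by (simp add: eps_def)

lemma eps_tendsto: "eps \<longlonglongrightarrow> 0"
  unfolding eps_def[abs_def] by (rule LIMSEQ_inverse_real_of_nat)

text \<open>An argument in three parts: the approximations are compared with those started from
  nearby data of the form \<open>K (K x)\<close>, at a cost uniform in \<open>n\<close>, and for
  such data two approximations differ by a multiple of the difference of their parameters.\<close>

lemma approximations_Cauchy:
  assumes S: "\<And>n. sys (Q (eps n)) (\<lambda>_. 0) (\<lambda>_. 0) (U n) (V n) (P n)"
    and init: "\<And>n. U n 0 = a0" "\<And>n. V n 0 = a1" "\<And>n. P n 0 = a2"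
    and T: "T \<ge> 0" and d: "d > 0"
  shows "\<exists>N. \<forall>m\<ge>N. \<forall>n\<ge>N. \<forall>t\<in>{0..T}.
    norm (U m t - U n t) < d \<and> norm (V m t - V n t) < d \<and> norm (P m t - P n t) < d"
proof -
  obtain C where C0: "C \<ge> 0" and "energy_constant T C" by (rule energy_constant_exists)
  note C = energy_constantD[OF this(2)]
  obtain M where M: "M \<ge> 0" "\<And>t. 0 \<le> t \<Longrightarrow> t \<le> T \<Longrightarrow> norm (g t) \<le> M"
    using bounded_on_initial_interval[OF g_continuous] by blast
  \<comment> \<open>The accuracy of the data, chosen so that the energy constant turns it into at
    most \<open>d / 4\<close>; the added 1 admits \<open>C = 0\<close>.\<close>
  define h where "h = d / (4 * (C + 1))"
  have h: "h > 0" "C * h \<le> d / 4" using d C0 by (auto simp: h_def field_simps)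
  obtain b0 where b0: "norm (K (K b0) - a0) < h" using KK_approx[OF h(1)] by blast
  obtain b1 where b1: "norm (K (K b1) - a1) < h" using KK_approx[OF h(1)] by blast
  obtain b2 where b2: "norm (K (K b2) - a2) < h" using KK_approx[OF h(1)] by blast
  note b = b0 b1 b2
  define B where "B = norm b0 + norm b1 + norm b2"
  have "\<forall>n. \<exists>U V P. sys (Q (eps n)) (\<lambda>_. 0) (\<lambda>_. 0) U V P \<and> U 0 = K (K b0) \<and> V 0 = K (K b1) \<and> P 0 = K (K b2)"
    using mgt_system_exists[OF resolvent_bounded_linear[OF eps_pos] g] by blast
  then obtain U' V' P' where S': "\<And>n. sys (Q (eps n)) (\<lambda>_. 0) (\<lambda>_. 0) (U' n) (V' n) (P' n)"
    and init': "\<And>n. U' n 0 = K (K b0)" "\<And>n. V' n 0 = K (K b1)" "\<And>n. P' n 0 = K (K b2)"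
    by metis
  have close: "norm (U' n t - U n t) \<le> d / 4 \<and> norm (V' n t - V n t) \<le> d / 4 \<and> norm (P' n t - P n t) \<le> d / 4"
    if t: "0 \<le> t" "t \<le> T" for n t
  proof -
    have "norm (U' n t - U n t) \<le> C * h \<and> norm (V' n t - V n t) \<le> C * h \<and> norm (P' n t - P n t) \<le> C * h"
      by (rule C[OF eps_pos mgt_system_diff[OF S' S resolvent_linear[OF eps_pos] g_continuous]])
        (use b h t init init' in \<open>auto intro: less_imp_le\<close>)
    then show ?thesis using h(2) by linarith
  qed
  \<comment> \<open>The three last summands come from the bound for
    \<open>c\<^sup>2 *\<^sub>R U + b *\<^sub>R V - conv g U\<close>; the leading 1 makes the same
    constant cover \<open>P\<close>.\<close>
  define C3 where "C3 = 1 + c\<^sup>2 + b + M * T"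
  have C3: "C3 \<ge> 1" using M T constants by (simp add: C3_def)
  have B0: "B \<ge> 0" by (simp add: B_def)
  define D where "D = C3 * (C * B)"
  have D0: "D \<ge> 0" using C3 C0 B0 by (simp add: D_def)
  \<comment> \<open>The product of the two resolvents commutes with the system and maps the data
    \<open>K (K x)\<close> to vectors of norm at most \<open>norm x\<close>. The energy estimate for
    the transformed solution is thus uniform in both indices.\<close>
  have reg: "norm (Q (eps n) (Q (eps m) (P' m t))) \<le> D \<and>
      norm (Q (eps n) (Q (eps m) (c\<^sup>2 *\<^sub>R U' m t + b *\<^sub>R V' m t - conv g (U' m) t))) \<le> D"
    if t: "0 \<le> t" "t \<le> T" for m n t
  proof -
    define L where "L x = Q (eps n) (Q (eps m) x)" for x
    have L: "bounded_linear L" unfolding L_def[abs_def]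
      by (intro bounded_linear_compose[OF resolvent_bounded_linear resolvent_bounded_linear] eps_pos)
    note lin = bounded_linear.linear[OF L]
    have comm: "L (Q (eps m) x) = Q (eps m) (L x)" for x
      unfolding L_def by (rule resolvent_commute) (rule eps_pos)+
    have LKK: "norm (L (K (K x))) \<le> norm x" for x
    proof -
      have "L (K (K x)) = Q (eps n) (K (Q (eps m) (K x)))" by (simp add: L_def resolvent_K eps_pos)
      then have "norm (L (K (K x))) \<le> norm (Q (eps m) (K x))"
        using norm_resolvent_K_le[OF eps_pos, of n "Q (eps m) (K x)"] by simp
      also have "\<dots> \<le> norm x" by (rule norm_resolvent_K_le[OF eps_pos])
      finally show ?thesis .
    qed
    have LS: "sys (Q (eps m)) (\<lambda>_. 0) (\<lambda>_. 0) (\<lambda>t. L (U' m t)) (\<lambda>t. L (V' m t)) (\<lambda>t. L (P' m t))"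
      using mgt_system_image[OF S' L comm g_continuous] by (simp add: linear_0[OF lin])
    have bd: "norm (L (U' m t)) \<le> C * B \<and> norm (L (V' m t)) \<le> C * B \<and> norm (L (P' m t)) \<le> C * B"
      if t: "0 \<le> t" "t \<le> T" for t
    proof (rule C[OF eps_pos LS _ _ _ _ _ t])
      have "norm b0 \<le> B" "norm b1 \<le> B" "norm b2 \<le> B" by (auto simp: B_def)
      then show "norm (L (U' m 0)) \<le> B" "norm (L (V' m 0)) \<le> B" "norm (L (P' m 0)) \<le> B"
        using LKK init' by (metis order_trans)+
    qed (use B0 in auto)
    have Uc: "continuous_on {0..} (U' m)" by (rule mgt_system_continuous[OF S'])
    have LUc: "continuous_on {0..} (\<lambda>t. L (U' m t))" by (rule mgt_system_continuous[OF LS])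
    have "norm (conv g (\<lambda>t. L (U' m t)) t) \<le> M * integral {0..t} (\<lambda>s. norm (L (U' m s)))"
      using t M by (intro norm_conv_le g_continuous LUc) auto
    also have "\<dots> \<le> M * integral {0..t} (\<lambda>s. C * B)"
      using bd t M by (intro mult_left_mono integral_le integrable_continuous_real continuous_intros
          continuous_on_subset[OF LUc]) auto
    also have "\<dots> = M * t * (C * B)" using t by simp
    also have "\<dots> \<le> M * T * (C * B)" using t M C0 B0 by (intro mult_right_mono mult_left_mono) auto
    finally have cv: "norm (conv g (\<lambda>t. L (U' m t)) t) \<le> M * T * (C * B)" .
    have "norm (c\<^sup>2 *\<^sub>R L (U' m t) + b *\<^sub>R L (V' m t)) \<le> c\<^sup>2 * (C * B) + b * (C * B)"
      using bd[OF t] constants by (intro norm_triangle_le add_mono) (auto intro!: mult_left_mono)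
    then have "norm (c\<^sup>2 *\<^sub>R L (U' m t) + b *\<^sub>R L (V' m t) - conv g (\<lambda>t. L (U' m t)) t)
        \<le> (c\<^sup>2 * (C * B) + b * (C * B)) + M * T * (C * B)"
      using cv norm_triangle_ineq4[of "c\<^sup>2 *\<^sub>R L (U' m t) + b *\<^sub>R L (V' m t)" "conv g (\<lambda>t. L (U' m t)) t"]
      by linarith
    also have "\<dots> \<le> D" using C0 B0 by (simp add: D_def C3_def algebra_simps)
    finally have "norm (L (c\<^sup>2 *\<^sub>R U' m t + b *\<^sub>R V' m t - conv g (U' m) t)) \<le> D"
      using conv_linear[OF L g_continuous Uc t(1)]
      by (simp add: linear_add[OF lin] linear_diff[OF lin] linear_cmul[OF lin])
    moreover have "C * B \<le> D" using mult_right_mono[OF C3, of "C * B"] C0 B0 by (simp add: D_def)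
    then have "norm (L (P' m t)) \<le> D" using bd[OF t] by linarith
    ultimately show ?thesis by (simp add: L_def)
  qed
  \<comment> \<open>The approximation with index \<open>m\<close> is viewed as a forced solution of
    the system with index \<open>n\<close>. By the resolvent identity the forcing is
    \<open>eps n - eps m\<close> times a quantity bounded by \<open>reg\<close>, and the initial
    difference is zero.\<close>
  have diff': "norm (U' n t - U' m t) \<le> C * (\<bar>eps n - eps m\<bar> * D) \<and> norm (V' n t - V' m t) \<le> C * (\<bar>eps n - eps m\<bar> * D)
      \<and> norm (P' n t - P' m t) \<le> C * (\<bar>eps n - eps m\<bar> * D)"
    if t: "0 \<le> t" "t \<le> T" for m n t
  proof (rule C[OF eps_pos mgt_system_diff[OF S' mgt_system_change_operator[OF S']
          resolvent_linear[OF eps_pos] g_continuous] _ _ _ _ _ t])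
    have RI: "norm (Q (eps m) x - Q (eps n) x) = \<bar>eps n - eps m\<bar> * norm (Q (eps n) (Q (eps m) x))" for x
    proof -
      have "Q (eps m) x - Q (eps n) x = (eps n - eps m) *\<^sub>R Q (eps n) (Q (eps m) x)"
        by (simp add: resolvent_identity[OF eps_pos eps_pos] resolvent_commute[OF eps_pos eps_pos, of m n])
      then show ?thesis by simp
    qed
    show "norm (0 - (Q (eps m) (P' m t) - Q (eps n) (P' m t))) \<le> \<bar>eps n - eps m\<bar> * D"
      if "0 \<le> t" "t \<le> T" for t
      using RI[of "P' m t"] mult_left_mono[of _ D "\<bar>eps n - eps m\<bar>"] reg[OF that, of n m]
      by (simp add: norm_minus_commute)
    show "norm (0 - (Q (eps n) (c\<^sup>2 *\<^sub>R U' m t + b *\<^sub>R V' m t - conv g (U' m) t) -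
            Q (eps m) (c\<^sup>2 *\<^sub>R U' m t + b *\<^sub>R V' m t - conv g (U' m) t))) \<le> \<bar>eps n - eps m\<bar> * D"
      if "0 \<le> t" "t \<le> T" for t
      using RI[of "c\<^sup>2 *\<^sub>R U' m t + b *\<^sub>R V' m t - conv g (U' m) t"]
        mult_left_mono[of _ D "\<bar>eps n - eps m\<bar>"] reg[OF that, of n m] by simp
  qed (use D0 init' in auto)
  have "(\<lambda>n. C * (eps n * D)) \<longlonglongrightarrow> C * (0 * D)" by (intro tendsto_intros eps_tendsto)
  then have "\<forall>\<^sub>F n in sequentially. C * (eps n * D) < d / 2"
    by (rule order_tendstoD) (use d in simp)
  then obtain N where N: "\<And>n. n \<ge> N \<Longrightarrow> C * (eps n * D) < d / 2" by (auto simp: eventually_sequentially)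
  have small: "C * (\<bar>eps m - eps n\<bar> * D) < d / 2" if "m \<ge> N" "n \<ge> N" for m n
  proof -
    have "C * (\<bar>eps m - eps n\<bar> * D) \<le> C * (max (eps m) (eps n) * D)"
      using eps_pos[of m] eps_pos[of n] C0 D0 by (intro mult_left_mono mult_right_mono) auto
    then show ?thesis using N[OF that(1)] N[OF that(2)] by (auto simp: max_def split: if_splits)
  qed
  have tri: "norm (x - y) < d"
    if "norm (x' - x) \<le> d / 4" "norm (y' - y) \<le> d / 4" "norm (x' - y') < d / 2" for x x' y y' :: 'a
  proof -
    have "x - y = (x' - y') - (x' - x) + (y' - y)" by simp
    then have "norm (x - y) \<le> norm (x' - y') + norm (x' - x) + norm (y' - y)"
      using norm_triangle_ineq[of "(x' - y') - (x' - x)" "y' - y"] norm_triangle_ineq4[of "x' - y'" "x' - x"]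
      by simp
    then show ?thesis using that by linarith
  qed
  show ?thesis
  proof (intro exI[of _ N] allI impI ballI)
    fix m n t assume mn: "m \<ge> N" "n \<ge> N" and "t \<in> {0..T}"
    then have t: "0 \<le> t" "t \<le> T" by auto
    note s = small[OF mn]
    show "norm (U m t - U n t) < d \<and> norm (V m t - V n t) < d \<and> norm (P m t - P n t) < d"
      using close[OF t, of m] close[OF t, of n] diff'[OF t, of m n] s
      by (intro conjI tri[of "U' m t" _ "U' n t"] tri[of "V' m t" _ "V' n t"] tri[of "P' m t" _ "P' n t"]) auto
  qed
qed

text \<open>No bound on \<open>Q (eps n)\<close> uniform in \<open>n\<close> is at hand, so the
  equations for \<open>V\<close> and \<open>P\<close> are passed to the limit only after applying
  \<open>K + eps n\<close>, which removes the resolvent from the right-hand sides.\<close>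

lemma limit_system_exists:
  "\<exists>U V P. mgt_limit_system \<tau> \<alpha> b c g K U V P \<and> U 0 = a0 \<and> V 0 = a1 \<and> P 0 = a2"
proof -
  have "\<forall>n. \<exists>U V P. sys (Q (eps n)) (\<lambda>_. 0) (\<lambda>_. 0) U V P \<and> U 0 = a0 \<and> V 0 = a1 \<and> P 0 = a2"
    using mgt_system_exists[OF resolvent_bounded_linear[OF eps_pos] g] by blast
  then obtain U V P where S: "\<And>n. sys (Q (eps n)) (\<lambda>_. 0) (\<lambda>_. 0) (U n) (V n) (P n)"
    and init: "\<And>n. U n 0 = a0" "\<And>n. V n 0 = a1" "\<And>n. P n 0 = a2"
    by metis
  note Sc = mgt_system_continuous[OF S]
  define U' where "U' t = lim (\<lambda>n. U n t)" for t
  define V' where "V' t = lim (\<lambda>n. V n t)" for t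
  define P' where "P' t = lim (\<lambda>n. P n t)" for t
  note cauchy = approximations_Cauchy[OF S init]
  have UL: "uniform_limit {0..T} U U' sequentially" if "T \<ge> 0" for T
    unfolding U'_def[abs_def] uniformly_convergent_uniform_limit_iff[symmetric]
  proof (rule Cauchy_uniformly_convergent, unfold uniformly_Cauchy_on_def dist_norm, intro allI impI)
    fix d :: real assume "d > 0"
    from cauchy[OF that this] show "\<exists>M. \<forall>x\<in>{0..T}. \<forall>m\<ge>M. \<forall>n\<ge>M. norm (U m x - U n x) < d" by blast
  qed
  have VL: "uniform_limit {0..T} V V' sequentially" if "T \<ge> 0" for T
    unfolding V'_def[abs_def] uniformly_convergent_uniform_limit_iff[symmetric]
  proof (rule Cauchy_uniformly_convergent, unfold uniformly_Cauchy_on_def dist_norm, intro allI impI)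
    fix d :: real assume "d > 0"
    from cauchy[OF that this] show "\<exists>M. \<forall>x\<in>{0..T}. \<forall>m\<ge>M. \<forall>n\<ge>M. norm (V m x - V n x) < d" by blast
  qed
  have PL: "uniform_limit {0..T} P P' sequentially" if "T \<ge> 0" for T
    unfolding P'_def[abs_def] uniformly_convergent_uniform_limit_iff[symmetric]
  proof (rule Cauchy_uniformly_convergent, unfold uniformly_Cauchy_on_def dist_norm, intro allI impI)
    fix d :: real assume "d > 0"
    from cauchy[OF that this] show "\<exists>M. \<forall>x\<in>{0..T}. \<forall>m\<ge>M. \<forall>n\<ge>M. norm (P m x - P n x) < d" by blast
  qed
  have limc: "continuous_on {0..} f'" if L: "\<And>T. T \<ge> 0 \<Longrightarrow> uniform_limit {0..T} f f' sequentially"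
    and c: "\<And>n. continuous_on {0..} (f n)" for f :: "nat \<Rightarrow> real \<Rightarrow> 'a" and f'
  proof (rule continuous_on_halflineI)
    fix T :: real assume "0 \<le> T"
    then show "continuous_on {0..T} f'"
      by (intro uniform_limit_theorem[OF _ L]) (auto intro!: always_eventually continuous_on_subset[OF c])
  qed
  note U'c = limc[OF UL Sc(1)] and V'c = limc[OF VL Sc(2)] and P'c = limc[OF PL Sc(3)]
  have ptw: "(\<lambda>n. f n t) \<longlonglongrightarrow> f' t" if L: "\<And>T. T \<ge> 0 \<Longrightarrow> uniform_limit {0..T} f f' sequentially"
    and t: "t \<ge> 0" for f :: "nat \<Rightarrow> real \<Rightarrow> 'a" and f' t
    by (rule tendsto_uniform_limitI[OF L[OF t]]) (use t in simp)
  \<comment> \<open>The extra term tends to 0 uniformly because the limit \<open>P'\<close> is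
    continuous, hence bounded on compact intervals.\<close>
  have KP: "uniform_limit {0..T} (\<lambda>n t. K (P n t) + eps n *\<^sub>R P n t) (\<lambda>t. K (P' t)) sequentially"
    if T: "T \<ge> 0" for T
  proof -
    have "compact (P' ` {0..T})"
      by (intro compact_continuous_image continuous_on_subset[OF P'c]) auto
    then have "bounded (P' ` {0..T})" by (rule compact_imp_bounded)
    moreover have "uniform_limit {0..T} (\<lambda>n t. eps n) (\<lambda>t. 0) sequentially"
      using tendstoD[OF eps_tendsto] by (auto simp: uniform_limit_iff elim: eventually_mono)
    ultimately have "uniform_limit {0..T} (\<lambda>n t. eps n *\<^sub>R P n t) (\<lambda>t. 0 *\<^sub>R P' t) sequentially"
      by (intro bounded_bilinear_bounded_uniform_limit_intros PL T) (auto simp: image_constant_conv)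
    then have "uniform_limit {0..T} (\<lambda>n t. K (P n t) + eps n *\<^sub>R P n t) (\<lambda>t. K (P' t) + 0 *\<^sub>R P' t) sequentially"
      by (intro uniform_limit_add bounded_linear.uniform_limit[OF bounded_linear] PL T)
    then show ?thesis by simp
  qed
  have Kc: "continuous_on {0..} (\<lambda>t. K (f t))" if "continuous_on {0..} f" for f :: "real \<Rightarrow> 'a"
    by (rule bounded_linear.continuous_on[OF bounded_linear that])
  have "mgt_limit_system \<tau> \<alpha> b c g K U' V' P'"
    unfolding mgt_limit_system_def
  proof (intro conjI allI impI V'c P'c)
    fix t :: real assume t: "t \<ge> 0"
    show "(U' has_vector_derivative V' t) (at t within {0..})"
      by (rule has_vector_derivative_uniform_limit[OF ptw[OF UL] VL Sc(2) _ t])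
        (use S in \<open>auto simp: mgt_system_def\<close>)
    show "((\<lambda>t. K (V' t)) has_vector_derivative P' t) (at t within {0..})"
    proof (rule has_vector_derivative_uniform_limit[where F = "\<lambda>n t. K (V n t) + eps n *\<^sub>R V n t", OF _ PL Sc(3) _ t])
      fix s :: real assume s: "s \<ge> 0"
      have "(\<lambda>n. K (V n s) + eps n *\<^sub>R V n s) \<longlonglongrightarrow> K (V' s) + 0 *\<^sub>R V' s"
        by (intro tendsto_intros bounded_linear.tendsto[OF bounded_linear] ptw[OF VL s] eps_tendsto)
      then show "(\<lambda>n. K (V n s) + eps n *\<^sub>R V n s) \<longlonglongrightarrow> K (V' s)" by simp
      fix n
      have "(V n has_vector_derivative Q (eps n) (P n s)) (at s within {0..})"
        using S[of n] s by (simp add: mgt_system_def)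
      then have "((\<lambda>t. K (V n t) + eps n *\<^sub>R V n t) has_vector_derivative
          K (Q (eps n) (P n s)) + eps n *\<^sub>R Q (eps n) (P n s)) (at s within {0..})"
        by (intro has_vector_derivative_add bounded_linear.has_vector_derivative[OF bounded_linear]
            bounded_linear.has_vector_derivative[OF bounded_linear_scaleR_right])
      then show "((\<lambda>t. K (V n t) + eps n *\<^sub>R V n t) has_vector_derivative P n s) (at s within {0..})"
        by (simp add: add_resolvent eps_pos)
    qed
    show "((\<lambda>t. \<tau> *\<^sub>R K (P' t)) has_vector_derivative
        - (\<alpha> *\<^sub>R K (P' t)) - (c\<^sup>2 *\<^sub>R U' t + b *\<^sub>R V' t - conv g U' t)) (at t within {0..})"
    proof (rule has_vector_derivative_uniform_limit[where F = "\<lambda>n t. \<tau> *\<^sub>R (K (P n t) + eps n *\<^sub>R P n t)"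
          and f' = "\<lambda>t. - (\<alpha> *\<^sub>R K (P' t)) - (c\<^sup>2 *\<^sub>R U' t + b *\<^sub>R V' t - conv g U' t)"
          and F' = "\<lambda>n t. - (\<alpha> *\<^sub>R (K (P n t) + eps n *\<^sub>R P n t)) - (c\<^sup>2 *\<^sub>R U n t + b *\<^sub>R V n t - conv g (U n) t)",
          OF _ _ _ _ t])
      show "continuous_on {0..} (\<lambda>t. - (\<alpha> *\<^sub>R (K (P n t) + eps n *\<^sub>R P n t))
          - (c\<^sup>2 *\<^sub>R U n t + b *\<^sub>R V n t - conv g (U n) t))" for n
        by (intro continuous_intros Kc Sc continuous_on_conv[OF g])
      show "uniform_limit {0..T} (\<lambda>n t. - (\<alpha> *\<^sub>R (K (P n t) + eps n *\<^sub>R P n t))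
          - (c\<^sup>2 *\<^sub>R U n t + b *\<^sub>R V n t - conv g (U n) t))
          (\<lambda>t. - (\<alpha> *\<^sub>R K (P' t)) - (c\<^sup>2 *\<^sub>R U' t + b *\<^sub>R V' t - conv g U' t)) sequentially"
        if "0 \<le> T" for T
        by (intro uniform_limit_minus uniform_limit_add uniform_limit_uminus
            bounded_linear.uniform_limit[OF bounded_linear_scaleR_right]
            KP UL VL uniform_limit_conv g_continuous Sc U'c that)
    next
      fix s :: real assume s: "s \<ge> 0"
      have "(\<lambda>n. \<tau> *\<^sub>R (K (P n s) + eps n *\<^sub>R P n s)) \<longlonglongrightarrow> \<tau> *\<^sub>R (K (P' s) + 0 *\<^sub>R P' s)"
        by (intro tendsto_intros bounded_linear.tendsto[OF bounded_linear] ptw[OF PL s] eps_tendsto)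
      then show "(\<lambda>n. \<tau> *\<^sub>R (K (P n s) + eps n *\<^sub>R P n s)) \<longlonglongrightarrow> \<tau> *\<^sub>R K (P' s)" by simp
      fix n
      define X where "X = c\<^sup>2 *\<^sub>R U n s + b *\<^sub>R V n s - conv g (U n) s"
      define Y where "Y = (1 / \<tau>) *\<^sub>R (0 - \<alpha> *\<^sub>R P n s - Q (eps n) X)"
      have "(P n has_vector_derivative Y) (at s within {0..})"
        using S[of n] s by (simp add: mgt_system_def X_def Y_def)
      then have "((\<lambda>t. \<tau> *\<^sub>R (K (P n t) + eps n *\<^sub>R P n t)) has_vector_derivative
          \<tau> *\<^sub>R (K Y + eps n *\<^sub>R Y)) (at s within {0..})"
        by (intro has_vector_derivative_add bounded_linear.has_vector_derivative[OF bounded_linear]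
            bounded_linear.has_vector_derivative[OF bounded_linear_scaleR_right])
      moreover have "\<tau> *\<^sub>R (K Y + eps n *\<^sub>R Y) = - (\<alpha> *\<^sub>R (K (P n s) + eps n *\<^sub>R P n s)) - X"
      proof -
        have "\<tau> *\<^sub>R (K Y + eps n *\<^sub>R Y)
            = - (\<alpha> *\<^sub>R (K (P n s) + eps n *\<^sub>R P n s)) - (K (Q (eps n) X) + eps n *\<^sub>R Q (eps n) X)"
          using constants by (simp add: Y_def linear_cmul[OF linear] linear_diff[OF linear]
              linear_neg[OF linear] algebra_simps)
        then show ?thesis by (simp add: add_resolvent eps_pos)
      qed
      ultimately show "((\<lambda>t. \<tau> *\<^sub>R (K (P n t) + eps n *\<^sub>R P n t)) has_vector_derivative
          - (\<alpha> *\<^sub>R (K (P n s) + eps n *\<^sub>R P n s)) - (c\<^sup>2 *\<^sub>R U n s + b *\<^sub>R V n s - conv g (U n) s)) (at s within {0..})"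
        by (simp add: X_def)
    qed
  qed
  moreover have "U' 0 = a0" "V' 0 = a1" "P' 0 = a2"
    by (simp_all add: U'_def V'_def P'_def init)
  ultimately show ?thesis by blast
qed

text \<open>\<open>(K\<^sup>2 U, K\<^sup>2 V, K\<^sup>2 P)\<close> solves the system for \<open>Q = (K + \<epsilon>)\<^sup>-\<^sup>1\<close> up to a forcing of size
  \<open>O(\<epsilon>)\<close>, so the energy estimate applies.\<close>

lemma limit_system_unique:
  assumes lim: "mgt_limit_system \<tau> \<alpha> b c g K U V P" and init: "U 0 = 0" "V 0 = 0" "P 0 = 0"
    and t: "t \<ge> 0"
  shows "U t = 0"
proof -
  note c = mgt_limit_system_continuous[OF lim]
  define X where "X t = c\<^sup>2 *\<^sub>R U t + b *\<^sub>R V t - conv g U t" for t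
  have Xc: "continuous_on {0..} X"
    unfolding X_def[abs_def] by (intro continuous_intros c continuous_on_conv[OF g])
  obtain C where C0: "C \<ge> 0" and "energy_constant t C" by (rule energy_constant_exists)
  note C = energy_constantD[OF this(2)]
  obtain B1 where B1: "B1 \<ge> 0" "\<And>s. 0 \<le> s \<Longrightarrow> s \<le> t \<Longrightarrow> norm (P s) \<le> B1"
    using bounded_on_initial_interval[OF c(3)] by blast
  obtain B2 where B2: "B2 \<ge> 0" "\<And>s. 0 \<le> s \<Longrightarrow> s \<le> t \<Longrightarrow> norm (X s) \<le> B2"
    using bounded_on_initial_interval[OF Xc] by blast
  define B where "B = B1 + B2"
  define L where "L x = K (K x)" for x
  have L: "bounded_linear L" unfolding L_def[abs_def] by (rule bounded_linear_compose[OF bounded_linear bounded_linear])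
  note lin = bounded_linear.linear[OF L]
  have small: "norm (L (U t)) \<le> C * (e * B)" if e: "e > 0" for e
  proof -
    \<comment> \<open>The first term has the form required by the system for \<open>Q e\<close>; the
      second is a forcing of norm at most \<open>e * norm x\<close>, since \<open>K\<close>
      compensates the resolvent.\<close>
    have dec: "K x = Q e (L x) + e *\<^sub>R Q e (K x)" for x
      using add_resolvent[OF e, of "K x"] by (simp add: L_def resolvent_K[OF e])
    have "sys (Q e) (\<lambda>t. e *\<^sub>R Q e (K (P t))) (\<lambda>t. - (e *\<^sub>R Q e (K (X t)))) (\<lambda>t. L (U t)) (\<lambda>t. L (V t)) (\<lambda>t. L (P t))"
      unfolding mgt_system_def
    proof (intro allI impI)
      fix s :: real assume s: "s \<ge> 0"
      have d: "(U has_vector_derivative V s) (at s within {0..})"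
        "((\<lambda>t. K (V t)) has_vector_derivative P s) (at s within {0..})"
        "((\<lambda>t. \<tau> *\<^sub>R K (P t)) has_vector_derivative - (\<alpha> *\<^sub>R K (P s)) - X s) (at s within {0..})"
        using lim s by (auto simp: mgt_limit_system_def X_def)
      have "((\<lambda>t. (1 / \<tau>) *\<^sub>R K (\<tau> *\<^sub>R K (P t))) has_vector_derivative
          (1 / \<tau>) *\<^sub>R K (- (\<alpha> *\<^sub>R K (P s)) - X s)) (at s within {0..})"
        by (intro bounded_linear.has_vector_derivative[OF bounded_linear_scaleR_right]
            bounded_linear.has_vector_derivative[OF bounded_linear] d)
      then have "((\<lambda>t. L (P t)) has_vector_derivative (1 / \<tau>) *\<^sub>R K (- (\<alpha> *\<^sub>R K (P s)) - X s)) (at s within {0..})"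
        using constants by (simp add: L_def linear_cmul[OF linear])
      moreover have "K (- (\<alpha> *\<^sub>R K (P s)) - X s) = - (e *\<^sub>R Q e (K (X s))) - \<alpha> *\<^sub>R L (P s) - Q e (L (X s))"
      proof -
        have "K (- (\<alpha> *\<^sub>R K (P s)) - X s) = - (\<alpha> *\<^sub>R L (P s)) - K (X s)"
          by (simp add: L_def linear_diff[OF linear] linear_neg[OF linear] linear_cmul[OF linear])
        also have "\<dots> = - (\<alpha> *\<^sub>R L (P s)) - (Q e (L (X s)) + e *\<^sub>R Q e (K (X s)))"
          by (rule arg_cong[OF dec])
        finally show ?thesis by simp
      qed
      moreover have LX: "L (X s) = c\<^sup>2 *\<^sub>R L (U s) + b *\<^sub>R L (V s) - conv g (\<lambda>t. L (U t)) s"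
        by (simp add: X_def linear_add[OF lin] linear_diff[OF lin] linear_cmul[OF lin]
            conv_linear[OF L g_continuous c(1) s])
      ultimately have "((\<lambda>t. L (P t)) has_vector_derivative (1 / \<tau>) *\<^sub>R (- (e *\<^sub>R Q e (K (X s))) - \<alpha> *\<^sub>R L (P s)
          - Q e (c\<^sup>2 *\<^sub>R L (U s) + b *\<^sub>R L (V s) - conv g (\<lambda>t. L (U t)) s))) (at s within {0..})"
        by (simp only: LX)
      moreover have "((\<lambda>t. L (V t)) has_vector_derivative Q e (L (P s)) + e *\<^sub>R Q e (K (P s))) (at s within {0..})"
        using bounded_linear.has_vector_derivative[OF bounded_linear d(2)] dec[of "P s"] by (simp add: L_def)
      ultimately show "((\<lambda>t. L (U t)) has_vector_derivative L (V s)) (at s within {0..}) \<and>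
         ((\<lambda>t. L (V t)) has_vector_derivative Q e (L (P s)) + e *\<^sub>R Q e (K (P s))) (at s within {0..}) \<and>
         ((\<lambda>t. L (P t)) has_vector_derivative (1 / \<tau>) *\<^sub>R (- (e *\<^sub>R Q e (K (X s))) - \<alpha> *\<^sub>R L (P s)
          - Q e (c\<^sup>2 *\<^sub>R L (U s) + b *\<^sub>R L (V s) - conv g (\<lambda>t. L (U t)) s))) (at s within {0..})"
        using bounded_linear.has_vector_derivative[OF L d(1)] by simp
    qed
    from C[OF e this, of "e * B" t]
    have "norm (L (U t)) \<le> C * (e * B) \<and> norm (L (V t)) \<le> C * (e * B) \<and> norm (L (P t)) \<le> C * (e * B)"
    proof
      show "norm (e *\<^sub>R Q e (K (P s))) \<le> e * B" if "0 \<le> s" "s \<le> t" for s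
        using norm_resolvent_K_le[OF e, of "P s"] B1(2)[OF that] B2(1) e by (simp add: B_def)
      show "norm (- (e *\<^sub>R Q e (K (X s)))) \<le> e * B" if "0 \<le> s" "s \<le> t" for s
        using norm_resolvent_K_le[OF e, of "X s"] B2(2)[OF that] B1(1) e by (simp add: B_def)
    qed (use t e B1 B2 init in \<open>auto simp: linear_0[OF lin] B_def\<close>)
    then show ?thesis by simp
  qed
  \<comment> \<open>The estimate holds for every positive \<open>e\<close> with the same
    \<open>C\<close> and \<open>B\<close>, so \<open>K (K (U t))\<close> vanishes, and injectivity
    of \<open>K\<close> is applied twice.\<close>
  have "norm (L (U t)) \<le> 0"
  proof (rule LIMSEQ_le_const)
    have "(\<lambda>n. C * (eps n * B)) \<longlonglongrightarrow> C * (0 * B)" by (intro tendsto_intros eps_tendsto)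
    then show "(\<lambda>n. C * (eps n * B)) \<longlonglongrightarrow> 0" by simp
  qed (use small eps_pos in auto)
  then show "U t = 0" using K_inj by (simp add: L_def)
qed

lemma mgt_limit_system_diff:
  assumes "mgt_limit_system \<tau> \<alpha> b c g K U V P" "mgt_limit_system \<tau> \<alpha> b c g K U' V' P'"
  shows "mgt_limit_system \<tau> \<alpha> b c g K (\<lambda>t. U t - U' t) (\<lambda>t. V t - V' t) (\<lambda>t. P t - P' t)"
  unfolding mgt_limit_system_def
proof (intro conjI allI impI continuous_intros mgt_limit_system_continuous[OF assms(1)]
    mgt_limit_system_continuous[OF assms(2)])
  fix t :: real assume t: "t \<ge> 0"
  have s: "(U has_vector_derivative V t) (at t within {0..})"
    "((\<lambda>t. K (V t)) has_vector_derivative P t) (at t within {0..})"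
    "((\<lambda>t. \<tau> *\<^sub>R K (P t)) has_vector_derivative
        - (\<alpha> *\<^sub>R K (P t)) - (c\<^sup>2 *\<^sub>R U t + b *\<^sub>R V t - conv g U t)) (at t within {0..})"
    "(U' has_vector_derivative V' t) (at t within {0..})"
    "((\<lambda>t. K (V' t)) has_vector_derivative P' t) (at t within {0..})"
    "((\<lambda>t. \<tau> *\<^sub>R K (P' t)) has_vector_derivative
        - (\<alpha> *\<^sub>R K (P' t)) - (c\<^sup>2 *\<^sub>R U' t + b *\<^sub>R V' t - conv g U' t)) (at t within {0..})"
    using assms t by (auto simp: mgt_limit_system_def)
  note cv = conv_diff[OF g_continuous mgt_limit_system_continuous(1)[OF assms(1)]
      mgt_limit_system_continuous(1)[OF assms(2)] t]
  show "((\<lambda>t. U t - U' t) has_vector_derivative V t - V' t) (at t within {0..})"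
    by (intro has_vector_derivative_diff s)
  show "((\<lambda>t. K (V t - V' t)) has_vector_derivative P t - P' t) (at t within {0..})"
    using has_vector_derivative_diff[OF s(2) s(5)] by (simp add: linear_diff[OF linear])
  show "((\<lambda>t. \<tau> *\<^sub>R K (P t - P' t)) has_vector_derivative
        - (\<alpha> *\<^sub>R K (P t - P' t)) - (c\<^sup>2 *\<^sub>R (U t - U' t) + b *\<^sub>R (V t - V' t) - conv g (\<lambda>t. U t - U' t) t))
      (at t within {0..})"
    using has_vector_derivative_diff[OF s(3) s(6)] unfolding cv linear_diff[OF linear]
    by (simp add: algebra_simps)
qed

end

section \<open>Weak solutions\<close>

lemma convolution_inner:
  fixes F :: "real \<Rightarrow> 'a::{real_inner, banach}"
  assumes "continuous_on {0..} g" "continuous_on {0..} F" "0 \<le> t"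
  shows "inner (conv g F t) x = integral {0..t} (\<lambda>s. g (t - s) * inner (F s) x)"
  using conv_linear[OF bounded_linear_inner_left assms, of x] by (simp add: conv_def)

lemma integral_eq_iff_has_vector_derivative:
  fixes f F :: "real \<Rightarrow> 'a::banach"
  assumes f: "continuous_on {0..} f"
  shows "(\<forall>t\<ge>0. F t = F 0 + integral {0..t} f) \<longleftrightarrow>
    (\<forall>t\<ge>0. (F has_vector_derivative f t) (at t within {0..}))"
proof
  assume L: "\<forall>t\<ge>0. F t = F 0 + integral {0..t} f"
  show "\<forall>t\<ge>0. (F has_vector_derivative f t) (at t within {0..})"
  proof (intro allI impI)
    fix t :: real assume t: "t \<ge> 0"
    have "((\<lambda>s. F 0 + integral {0..s} f) has_vector_derivative f t) (at t within {0..})"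
      using has_vector_derivative_add[OF has_vector_derivative_const integral_has_vector_derivative_halfline[OF f t]]
      by simp
    then show "(F has_vector_derivative f t) (at t within {0..})"
    proof (rule has_vector_derivative_transform[rotated 2])
      show "F s = F 0 + integral {0..s} f" if "s \<in> {0..}" for s using L that by blast
    qed (use t in simp)
  qed
next
  assume R: "\<forall>t\<ge>0. (F has_vector_derivative f t) (at t within {0..})"
  show "\<forall>t\<ge>0. F t = F 0 + integral {0..t} f"
  proof (intro allI impI)
    fix t :: real assume t: "t \<ge> 0"
    have "(f has_integral F t - F 0) {0..t}"
    proof (rule fundamental_theorem_of_calculus)
      fix s assume "s \<in> {0..t}"
      then have "(F has_vector_derivative f s) (at s within {0..})" using R by simp
      then show "(F has_vector_derivative f s) (at s within {0..t})"
        by (rule has_vector_derivative_within_subset) auto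
    qed (rule t)
    then show "F t = F 0 + integral {0..t} f" by (simp add: integral_unique)
  qed
qed

lemma C1_halfline_image:
  assumes "C1_halfline f f'" "bounded_linear L"
  shows "C1_halfline (\<lambda>t. L (f t)) (\<lambda>t. L (f' t))"
  using assms unfolding C1_halfline_def
  by (auto intro: bounded_linear.has_vector_derivative bounded_linear.continuous_on)

text \<open>Every \<open>v\<close> in \<open>E\<close> is \<open>K x\<close> with
  \<open>S v = x\<close>, so testing with \<open>E\<close> becomes testing with the whole space, and
  \<open>inner (P t) (K x)\<close> equals \<open>inner (K (P t)) x\<close>. The scalar
  distributional equations then combine into one vector equation for \<open>K (P t)\<close>.\<close>

lemma weak_solution_iff:
  fixes S K :: "'a::{real_inner, banach} \<Rightarrow> 'a"
  assumes K: "positive_bounded K" and KE: "\<And>x. K x \<in> E" and SK: "\<And>x. S (K x) = x"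
    and KS: "\<And>v. v \<in> E \<Longrightarrow> K (S v) = v" and g: "C1_halfline g g'"
  shows "weak_solution E S \<tau> \<alpha> b c g u0 u1 u2 u \<longleftrightarrow>
    (\<exists>U V P. mgt_limit_system \<tau> \<alpha> b c g K U V P \<and> (\<forall>t\<ge>0. u t = K (U t)) \<and>
      u 0 = u0 \<and> K (V 0) = u1 \<and> P 0 = u2)"
proof -
  interpret positive_bounded K by (rule K)
  note gc = C1_halfline_continuous[OF g]
  have key: "(\<forall>v\<in>E. \<forall>\<phi>. test_function \<phi> \<longrightarrow>
           integral {0..} (\<lambda>t.
             - \<tau> * inner (P t) v * deriv \<phi> t
             + (\<alpha> * inner (P t) v
                + c\<^sup>2 * inner (U t) (S v)
                + b * inner (V t) (S v)
                - integral {0..t} (\<lambda>s. g (t - s) * inner (U s) (S v))) * \<phi> t) = 0)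
    \<longleftrightarrow> (\<forall>t\<ge>0. ((\<lambda>t. \<tau> *\<^sub>R K (P t)) has_vector_derivative
        - (\<alpha> *\<^sub>R K (P t)) - (c\<^sup>2 *\<^sub>R U t + b *\<^sub>R V t - conv g U t)) (at t within {0..}))"
    (is "?weak \<longleftrightarrow> ?strong")
    if U: "continuous_on {0..} U" and V: "continuous_on {0..} V" and P: "continuous_on {0..} P"
    for U V P :: "real \<Rightarrow> 'a"
  proof -
    define F where "F t = \<tau> *\<^sub>R K (P t)" for t
    define f where "f t = \<alpha> *\<^sub>R K (P t) + (c\<^sup>2 *\<^sub>R U t + b *\<^sub>R V t - conv g U t)" for t
    have KP: "continuous_on {0..} (\<lambda>t. K (P t))" by (rule bounded_linear.continuous_on[OF bounded_linear P])
    have Fc: "continuous_on {0..} F" unfolding F_def[abs_def] by (intro continuous_intros KP)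
    have fc: "continuous_on {0..} f" unfolding f_def[abs_def]
      by (intro continuous_intros KP U V continuous_on_conv[OF g])
    have int: "integral {0..t} (\<lambda>s. inner (f s) x) = inner (integral {0..t} f) x" if "t \<ge> 0" for t x
      by (rule integral_linear[of f "{0..t}" "\<lambda>y. inner y x", unfolded o_def])
        (auto intro!: integrable_continuous_real continuous_on_subset[OF fc] bounded_linear_inner_left)
    have E: "E = range K"
    proof
      show "E \<subseteq> range K" using KS by (metis rangeI subsetI)
    qed (use KE in auto)
    \<comment> \<open>Substituting \<open>v = K x\<close> leaves a scalar equation in which
      \<open>x\<close> appears only as the second argument of an inner product, ready for the
      distributional criterion.\<close>
    have "?weak \<longleftrightarrow> (\<forall>x. \<forall>\<phi>. test_function \<phi> \<longrightarrow>
        integral {0..} (\<lambda>t. - inner (F t) x * deriv \<phi> t + inner (f t) x * \<phi> t) = 0)"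
    proof -
      have "integral {0..} (\<lambda>t. - \<tau> * inner (P t) (K x) * deriv \<phi> t
             + (\<alpha> * inner (P t) (K x) + c\<^sup>2 * inner (U t) x + b * inner (V t) x
                - integral {0..t} (\<lambda>s. g (t - s) * inner (U s) x)) * \<phi> t)
          = integral {0..} (\<lambda>t. - inner (F t) x * deriv \<phi> t + inner (f t) x * \<phi> t)" for x \<phi>
        by (rule integral_cong)
          (simp add: F_def f_def inner_add_left inner_diff_left symmetric convolution_inner[OF gc U] add.assoc)
      then show ?thesis unfolding E by (auto simp: SK)
    qed
    also have "\<dots> \<longleftrightarrow> (\<forall>x. \<forall>t\<ge>0. inner (F t) x + integral {0..t} (\<lambda>s. inner (f s) x) = inner (F 0) x)"
      by (subst distributional_derivative_iff) (auto intro!: continuous_intros Fc fc)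
    also have "\<dots> \<longleftrightarrow> (\<forall>t\<ge>0. \<forall>x. inner (F t + integral {0..t} f) x = inner (F 0) x)"
      by (auto simp: int inner_add_left)
    also have "\<dots> \<longleftrightarrow> (\<forall>t\<ge>0. F t + integral {0..t} f = F 0)"
      by (metis vector_eq_rdot)
    also have "\<dots> \<longleftrightarrow> (\<forall>t\<ge>0. F t = F 0 + integral {0..t} (\<lambda>s. - f s))"
      by (simp add: eq_diff_eq)
    also have "\<dots> \<longleftrightarrow> (\<forall>t\<ge>0. (F has_vector_derivative - f t) (at t within {0..}))"
      by (rule integral_eq_iff_has_vector_derivative) (intro continuous_intros fc)
    also have "\<dots> \<longleftrightarrow> ?strong"
    proof -
      have "- f t = - (\<alpha> *\<^sub>R K (P t)) - (c\<^sup>2 *\<^sub>R U t + b *\<^sub>R V t - conv g U t)" for t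
        by (simp add: f_def)
      then show ?thesis by (simp only: F_def[abs_def])
    qed
    finally show ?thesis .
  qed
  show ?thesis
  proof
    assume "weak_solution E S \<tau> \<alpha> b c g u0 u1 u2 u"
    then obtain u' u'' where
      G: "C1_halfline_graph E S u u'" and C2: "C2_halfline u u' u''"
      and init: "u 0 = u0" "u' 0 = u1" "u'' 0 = u2"
      and weak: "\<forall>v\<in>E. \<forall>\<phi>. test_function \<phi> \<longrightarrow>
           integral {0..} (\<lambda>t.
             - \<tau> * inner (u'' t) v * deriv \<phi> t
             + (\<alpha> * inner (u'' t) v
                + c\<^sup>2 * inner (S (u t)) (S v)
                + b * inner (S (u' t)) (S v)
                - integral {0..t} (\<lambda>s. g (t - s) * inner (S (u s)) (S v))) * \<phi> t) = 0"
      unfolding weak_solution_def by blast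
    define U where "U t = S (u t)" for t
    define V where "V t = S (u' t)" for t
    have mem: "u t \<in> E" "u' t \<in> E" if "t \<ge> 0" for t using G that by (auto simp: C1_halfline_graph_def)
    have KU: "u t = K (U t)" and KV: "u' t = K (V t)" if "t \<ge> 0" for t
      using mem[OF that] by (auto simp: U_def V_def KS)
    have UV: "C1_halfline U V"
      using C1_halfline_image[OF _ bounded_linear_snd] G
      unfolding C1_halfline_graph_def U_def[abs_def] V_def[abs_def] by force
    have cont: "continuous_on {0..} U" "continuous_on {0..} V" "continuous_on {0..} u''"
      using UV C2 C1_halfline_continuous[OF UV] by (auto simp: C2_halfline_def C1_halfline_def)
    have strong: "\<forall>t\<ge>0. ((\<lambda>t. \<tau> *\<^sub>R K (u'' t)) has_vector_derivative
        - (\<alpha> *\<^sub>R K (u'' t)) - (c\<^sup>2 *\<^sub>R U t + b *\<^sub>R V t - conv g U t)) (at t within {0..})"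
      using weak key[OF cont] by (simp add: U_def V_def)
    \<comment> \<open>The functions \<open>u'\<close> and \<open>K (V t)\<close> agree for
      nonnegative times only, so the derivative is transferred within the half-line.\<close>
    have "((\<lambda>t. K (V t)) has_vector_derivative u'' t) (at t within {0..})" if t: "t \<ge> 0" for t
    proof (rule has_vector_derivative_transform[where f = u'])
      show "(u' has_vector_derivative u'' t) (at t within {0..})"
        using C2 t by (simp add: C2_halfline_def C1_halfline_def)
    qed (use t KV in auto)
    then have "mgt_limit_system \<tau> \<alpha> b c g K U V u''"
      using UV cont strong by (auto simp: mgt_limit_system_def C1_halfline_def)
    then show "\<exists>U V P. mgt_limit_system \<tau> \<alpha> b c g K U V P \<and> (\<forall>t\<ge>0. u t = K (U t)) \<and>
      u 0 = u0 \<and> K (V 0) = u1 \<and> P 0 = u2"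
      using KU KV[of 0] init by (intro exI[of _ U] exI[of _ V] exI[of _ u'']) auto
  next
    assume "\<exists>U V P. mgt_limit_system \<tau> \<alpha> b c g K U V P \<and> (\<forall>t\<ge>0. u t = K (U t)) \<and>
      u 0 = u0 \<and> K (V 0) = u1 \<and> P 0 = u2"
    then obtain U V P where lim: "mgt_limit_system \<tau> \<alpha> b c g K U V P" and u: "\<And>t. t \<ge> 0 \<Longrightarrow> u t = K (U t)"
      and init: "u 0 = u0" "K (V 0) = u1" "P 0 = u2" by blast
    note cont = mgt_limit_system_continuous[OF lim]
    have UV: "C1_halfline U V" using lim cont by (simp add: mgt_limit_system_def C1_halfline_def)
    have VP: "C1_halfline (\<lambda>t. K (V t)) P" using lim cont by (simp add: mgt_limit_system_def C1_halfline_def)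
    \<comment> \<open>Needed because \<open>u\<close> is unrestricted at negative times and so need
      not equal \<open>K (U t)\<close> there.\<close>
    have cong: "C1_halfline f2 f'" if "C1_halfline f1 f'" "\<And>t. t \<ge> 0 \<Longrightarrow> f2 t = f1 t"
      for f1 f2 f' :: "real \<Rightarrow> 'b::real_normed_vector"
      unfolding C1_halfline_def
    proof (intro conjI allI impI)
      fix t :: real assume t: "t \<ge> 0"
      show "(f2 has_vector_derivative f' t) (at t within {0..})"
        by (rule has_vector_derivative_transform[where f = f1]) (use that t in \<open>auto simp: C1_halfline_def\<close>)
    qed (use that in \<open>simp add: C1_halfline_def\<close>)
    have "bounded_linear (\<lambda>x. (K x, x))" by (intro bounded_linear_Pair bounded_linear bounded_linear_ident)
    from C1_halfline_image[OF UV this]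
    have "C1_halfline (\<lambda>t. (u t, S (u t))) (\<lambda>t. (K (V t), S (K (V t))))"
      unfolding SK by (rule cong) (simp add: u SK)
    then have "C1_halfline_graph E S u (\<lambda>t. K (V t))"
      by (simp add: C1_halfline_graph_def u KE)
    moreover have "C2_halfline u (\<lambda>t. K (V t)) P"
      unfolding C2_halfline_def using cong[OF C1_halfline_image[OF UV bounded_linear] u] VP by simp
    moreover have "\<forall>v\<in>E. \<forall>\<phi>. test_function \<phi> \<longrightarrow>
           integral {0..} (\<lambda>t.
             - \<tau> * inner (P t) v * deriv \<phi> t
             + (\<alpha> * inner (P t) v
                + c\<^sup>2 * inner (S (u t)) (S v)
                + b * inner (S (K (V t))) (S v)
                - integral {0..t} (\<lambda>s. g (t - s) * inner (S (u s)) (S v))) * \<phi> t) = 0"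
    proof (intro ballI allI impI)
      fix v \<phi> assume v: "v \<in> E" and \<phi>: "test_function \<phi>"
      have "integral {0..} (\<lambda>t. - \<tau> * inner (P t) v * deriv \<phi> t
             + (\<alpha> * inner (P t) v
                + c\<^sup>2 * inner (S (u t)) (S v)
                + b * inner (S (K (V t))) (S v)
                - integral {0..t} (\<lambda>s. g (t - s) * inner (S (u s)) (S v))) * \<phi> t)
          = integral {0..} (\<lambda>t. - \<tau> * inner (P t) v * deriv \<phi> t
             + (\<alpha> * inner (P t) v
                + c\<^sup>2 * inner (U t) (S v)
                + b * inner (V t) (S v)
                - integral {0..t} (\<lambda>s. g (t - s) * inner (U s) (S v))) * \<phi> t)"
      proof (rule integral_cong)
        fix t :: real assume t: "t \<in> {0..}"
        have "integral {0..t} (\<lambda>s. g (t - s) * inner (S (u s)) (S v)) = integral {0..t} (\<lambda>s. g (t - s) * inner (U s) (S v))"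
          by (rule integral_cong) (simp add: u SK)
        then show "- \<tau> * inner (P t) v * deriv \<phi> t
             + (\<alpha> * inner (P t) v
                + c\<^sup>2 * inner (S (u t)) (S v)
                + b * inner (S (K (V t))) (S v)
                - integral {0..t} (\<lambda>s. g (t - s) * inner (S (u s)) (S v))) * \<phi> t
            = - \<tau> * inner (P t) v * deriv \<phi> t
             + (\<alpha> * inner (P t) v
                + c\<^sup>2 * inner (U t) (S v)
                + b * inner (V t) (S v)
                - integral {0..t} (\<lambda>s. g (t - s) * inner (U s) (S v))) * \<phi> t"
          using t by (simp add: u SK)
      qed
      also have "\<dots> = 0"
        using iffD2[OF key[OF cont]] lim v \<phi> unfolding mgt_limit_system_def by blast
      finally show "integral {0..} (\<lambda>t. - \<tau> * inner (P t) v * deriv \<phi> t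
             + (\<alpha> * inner (P t) v
                + c\<^sup>2 * inner (S (u t)) (S v)
                + b * inner (S (K (V t))) (S v)
                - integral {0..t} (\<lambda>s. g (t - s) * inner (S (u s)) (S v))) * \<phi> t) = 0" .
    qed
    ultimately show "weak_solution E S \<tau> \<alpha> b c g u0 u1 u2 u"
      unfolding weak_solution_def using init by blast
  qed
qed

text \<open>The domain \<open>E\<close> is the range of \<open>K\<close>, which supplies the
  required density. The data become \<open>S u0\<close>, \<open>S u1\<close>, \<open>u2\<close>;
  applying \<open>S\<close> recovers the initial values of \<open>U\<close> and \<open>V\<close> for
  any competitor, so the difference of two solutions has zero data.\<close>

theorem weak_solution_well_posed:
  fixes S :: "'a::{real_inner, banach} \<Rightarrow> 'a"
  assumes S: "self_adjoint_operator E S" "positive_operator E S"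
    and l: "l > 0" "\<And>v. v \<in> E \<Longrightarrow> norm v \<le> l * norm (S v)"
    and constants: "\<tau> > 0" "b > 0" "\<alpha> \<ge> 0" and g: "C1_halfline g g'"
    and data: "u0 \<in> E" "u1 \<in> E"
  shows "\<exists>u. weak_solution E S \<tau> \<alpha> b c g u0 u1 u2 u \<and>
    (\<forall>w. weak_solution E S \<tau> \<alpha> b c g u0 u1 u2 w \<longrightarrow> (\<forall>t\<ge>0. w t = u t))"
proof -
  obtain K where K: "positive_bounded K" and KE: "\<And>x. K x \<in> E" and SK: "\<And>x. S (K x) = x"
    and KS: "\<And>v. v \<in> E \<Longrightarrow> K (S v) = v"
    by (rule self_adjoint_coercive_inverse[OF S l]) blast+
  have "E = range K" using KE KS by (metis rangeI subsetI image_subsetI subset_antisym)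
  moreover have "closure E = UNIV" using S by (simp add: self_adjoint_operator_def)
  ultimately have "mgt_abstract K g g' \<tau> \<alpha> b"
    using K g constants by (simp add: mgt_abstract_def mgt_abstract_axioms_def)
  then interpret mgt_abstract K g g' \<tau> \<alpha> b c .
  have iff: "weak_solution E S \<tau> \<alpha> b c g u0 u1 u2 u \<longleftrightarrow>
      (\<exists>U V P. mgt_limit_system \<tau> \<alpha> b c g K U V P \<and> (\<forall>t\<ge>0. u t = K (U t)) \<and>
        u 0 = u0 \<and> K (V 0) = u1 \<and> P 0 = u2)" for u
    by (rule weak_solution_iff[OF K KE SK _ g]) (rule KS)
  obtain U V P where lim: "mgt_limit_system \<tau> \<alpha> b c g K U V P"
    and init: "U 0 = S u0" "V 0 = S u1" "P 0 = u2"
    using limit_system_exists by blast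
  show ?thesis
  proof (intro exI conjI allI impI)
    show "weak_solution E S \<tau> \<alpha> b c g u0 u1 u2 (\<lambda>t. K (U t))"
      unfolding iff using lim init data by (intro exI[of _ U] exI[of _ V] exI[of _ P]) (simp add: KS)
    fix w t assume "weak_solution E S \<tau> \<alpha> b c g u0 u1 u2 w" and t: "(t :: real) \<ge> 0"
    then obtain U' V' P' where lim': "mgt_limit_system \<tau> \<alpha> b c g K U' V' P'" and w: "\<And>t. t \<ge> 0 \<Longrightarrow> w t = K (U' t)"
      and init': "w 0 = u0" "K (V' 0) = u1" "P' 0 = u2"
      unfolding iff by blast
    have "U' t - U t = 0"
    proof (rule limit_system_unique[OF mgt_limit_system_diff[OF lim' lim] _ _ _ t])
      show "U' 0 - U 0 = 0" using init(1) init'(1) w[of 0] SK by fastforce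
      show "V' 0 - V 0 = 0" using init(2) init'(2) SK by fastforce
      show "P' 0 - P 0 = 0" using init init' by simp
    qed
    then show "w t = K (U t)" using w[OF t] by simp
  qed
qed

section \<open>Hilbert spaces as Banach spaces\<close>

text \<open>A type of sort \<open>{real_inner, complete_space}\<close> is not known to belong to the class \<open>banach\<close>,
  which the integral of vector-valued functions requires. The copy below does.\<close>

typedef 'a hilbert_copy = "UNIV :: 'a set" morphisms of_copy to_copy ..

lemmas copy_simps [simp] = of_copy_inverse to_copy_inverse[OF UNIV_I]

instantiation hilbert_copy :: (real_vector) real_vector
begin

definition "0 = to_copy 0"
definition "x + y = to_copy (of_copy x + of_copy y)"
definition "x - y = to_copy (of_copy x - of_copy y)"
definition "- x = to_copy (- of_copy x)"
definition "r *\<^sub>R x = to_copy (r *\<^sub>R of_copy x)"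

lemmas copy_vector_defs = zero_hilbert_copy_def plus_hilbert_copy_def minus_hilbert_copy_def
  uminus_hilbert_copy_def scaleR_hilbert_copy_def

instance
  by standard (simp_all add: copy_vector_defs algebra_simps)

end

instantiation hilbert_copy :: (real_inner) real_inner
begin

definition "inner x y = inner (of_copy x) (of_copy y)"
definition "norm x = norm (of_copy x)"
definition "dist x y = dist (of_copy x) (of_copy y)"
definition "sgn x = to_copy (sgn (of_copy x))"
definition "(uniformity :: ('a hilbert_copy \<times> 'a hilbert_copy) filter)
  = (INF e\<in>{0<..}. principal {(x, y). dist x y < e})"
definition "open (U :: 'a hilbert_copy set)
  \<longleftrightarrow> (\<forall>x\<in>U. eventually (\<lambda>(x', y). x' = x \<longrightarrow> y \<in> U) uniformity)"

lemmas copy_defs = copy_vector_defs inner_hilbert_copy_def norm_hilbert_copy_def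
  dist_hilbert_copy_def sgn_hilbert_copy_def

instance
proof
  fix x :: "'a hilbert_copy"
  show "inner x x = 0 \<longleftrightarrow> x = 0"
    unfolding copy_defs inner_eq_zero_iff by (metis copy_simps)
qed (auto simp: copy_defs uniformity_hilbert_copy_def open_hilbert_copy_def inner_commute
    inner_add_left inner_add_right dist_norm norm_eq_sqrt_inner sgn_div_norm)

end

instance hilbert_copy :: ("{real_inner, complete_space}") complete_space
proof
  fix X :: "nat \<Rightarrow> 'a hilbert_copy" assume "Cauchy X"
  then have "Cauchy (\<lambda>n. of_copy (X n))" by (simp add: Cauchy_def dist_hilbert_copy_def)
  then obtain l where "(\<lambda>n. of_copy (X n)) \<longlonglongrightarrow> l" using Cauchy_convergent convergent_def by blast
  then have "X \<longlonglongrightarrow> to_copy l" by (simp add: tendsto_iff dist_hilbert_copy_def)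
  then show "convergent X" by (auto simp: convergent_def)
qed

instance hilbert_copy :: ("{real_inner, complete_space}") banach ..

section \<open>Transport of operators and weak solutions along an isometry\<close>

locale hilbert_isometry =
  fixes f :: "'a::real_inner \<Rightarrow> 'b::real_inner" and h :: "'b \<Rightarrow> 'a"
  assumes linear: "linear f" and inner: "inner (f x) (f y) = inner x y"
    and inverse: "h (f x) = x" "f (h z) = z"
begin

lemma norm: "norm (f x) = norm x" by (simp add: norm_eq_sqrt_inner inner)

lemma bounded_linear: "bounded_linear f"
  by (rule bounded_linear_intro[where K = 1])
    (simp_all add: linear_add[OF linear] linear_cmul[OF linear] norm)

lemma inner_left: "inner (f x) y = inner x (h y)"
  using inner[of x "h y"] by (simp add: inverse)

lemma inverse_isometry: "hilbert_isometry h f"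
proof
  show "h (x + y) = h x + h y" for x y
    using inverse linear_add[OF linear, of "h x" "h y"] by metis
  show "h (r *\<^sub>R x) = r *\<^sub>R h x" for r x
    using inverse linear_cmul[OF linear, of r "h x"] by metis
  show "inner (h x) (h y) = inner x y" for x y
    using inner[of "h x" "h y"] by (simp add: inverse)
qed (simp_all add: inverse)

lemma positive_transport:
  assumes "positive_operator E S"
  shows "positive_operator (f ` E) (\<lambda>y. f (S (h y)))"
  using assms by (auto simp: positive_operator_def inverse inner)

lemma self_adjoint_transport:
  assumes "self_adjoint_operator E S"
  shows "self_adjoint_operator (f ` E) (\<lambda>y. f (S (h y)))"
  unfolding self_adjoint_operator_def
proof (intro conjI)
  have lin: "linear_operator_on E S" and dense: "closure E = UNIV"
    and graph: "operator_graph E S = adjoint_graph E S"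
    using assms by (auto simp: self_adjoint_operator_def)
  show "linear_operator_on (f ` E) (\<lambda>y. f (S (h y)))"
    using lin unfolding linear_operator_on_def
    by (auto simp: inverse linear_subspace_image[OF linear] linear_add[OF linear, symmetric]
        linear_cmul[OF linear, symmetric])
  have "f ` closure E \<subseteq> closure (f ` E)" by (rule closure_bounded_linear_image_subset[OF bounded_linear])
  moreover have "f ` closure E = UNIV" using dense inverse(2) by (metis surjI)
  ultimately show "closure (f ` E) = UNIV" by auto
  \<comment> \<open>Both graphs are pulled back by the inverse isometry, so their equality reduces
    to self-adjointness of the original operator.\<close>
  have "(v, w) \<in> operator_graph (f ` E) (\<lambda>y. f (S (h y))) \<longleftrightarrow> (h v, h w) \<in> operator_graph E S" for v w
    unfolding operator_graph_def using inverse by (auto simp: image_iff) metis+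
  moreover have "(v, w) \<in> adjoint_graph (f ` E) (\<lambda>y. f (S (h y))) \<longleftrightarrow> (h v, h w) \<in> adjoint_graph E S" for v w
    unfolding adjoint_graph_def by (auto simp: inverse inner_left)
  ultimately show "operator_graph (f ` E) (\<lambda>y. f (S (h y))) = adjoint_graph (f ` E) (\<lambda>y. f (S (h y)))"
    using graph by auto
qed

lemma weak_solution_transport:
  assumes "weak_solution E S \<tau> \<alpha> b c g u0 u1 u2 u"
  shows "weak_solution (f ` E) (\<lambda>y. f (S (h y))) \<tau> \<alpha> b c g (f u0) (f u1) (f u2) (\<lambda>t. f (u t))"
proof -
  obtain u' u'' where
    G: "C1_halfline_graph E S u u'" and C2: "C2_halfline u u' u''"
    and init: "u 0 = u0" "u' 0 = u1" "u'' 0 = u2"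
    and weak: "\<forall>v\<in>E. \<forall>\<phi>. test_function \<phi> \<longrightarrow>
         integral {0..} (\<lambda>t.
           - \<tau> * inner (u'' t) v * deriv \<phi> t
           + (\<alpha> * inner (u'' t) v
              + c\<^sup>2 * inner (S (u t)) (S v)
              + b * inner (S (u' t)) (S v)
              - integral {0..t} (\<lambda>s. g (t - s) * inner (S (u s)) (S v))) * \<phi> t) = 0"
    using assms unfolding weak_solution_def by blast
  have "bounded_linear (\<lambda>p. (f (fst p), f (snd p)))"
    by (intro bounded_linear_Pair bounded_linear_compose[OF bounded_linear]
        bounded_linear_fst bounded_linear_snd)
  from C1_halfline_image[OF _ this] G
  have "C1_halfline_graph (f ` E) (\<lambda>y. f (S (h y))) (\<lambda>t. f (u t)) (\<lambda>t. f (u' t))"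
    unfolding C1_halfline_graph_def by (force simp: inverse)
  moreover have "C2_halfline (\<lambda>t. f (u t)) (\<lambda>t. f (u' t)) (\<lambda>t. f (u'' t))"
    using C2 unfolding C2_halfline_def by (auto intro: C1_halfline_image[OF _ bounded_linear])
  ultimately show ?thesis
    unfolding weak_solution_def using init weak
    by (intro exI[of _ "\<lambda>t. f (u' t)"] exI[of _ "\<lambda>t. f (u'' t)"]) (auto simp: inverse inner)
qed

end

lemma hilbert_isometry_to_copy:
  "hilbert_isometry (to_copy :: 'a::{real_inner, complete_space} \<Rightarrow> 'a hilbert_copy) of_copy"
  by unfold_locales (simp_all add: copy_defs)

theorem theorem1p3:
  fixes domA domR :: "'a::{real_inner, complete_space} set"
    and A R :: "'a \<Rightarrow> 'a"
    and \<tau> \<alpha> b c \<gamma> \<alpha>0 \<delta> l0 :: real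
    and g g' H H' H'' y :: "real \<Rightarrow> real"
    and u0 u1 u2 :: 'a
  assumes A: "self_adjoint_operator domA A" "positive_operator domA A"
    and R: "is_operator_sqrt domR R domA A"
    and constants: "\<tau> > 0" "\<alpha> > 0" "b > 0" "c > 0"
    and \<gamma>_def: "\<gamma> = \<alpha> - c\<^sup>2 * \<tau> / b"
    and g_C1: "C1_halfline g g'"
    and g_pos: "\<forall>t\<ge>0. g t > 0"
    and g_0: "g 0 < b * \<alpha> * \<gamma> / \<tau>\<^sup>2"
    and G_infinity: "\<exists>L. ((\<lambda>t. integral {0..t} g) \<longlongrightarrow> L) at_top \<and> L < c\<^sup>2"
    and H_C1: "C1_halfline H H'"
    and H_convex: "convex_on {0..} H"
    and H_mono: "strict_mono_on {0..} H"
    and H_0: "H 0 = 0"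
    and g_H: "\<forall>t>0. g' t + H (g t) \<le> 0"
    and y_range: "\<forall>t\<ge>0. y t \<ge> 0"
    and y_ode: "\<forall>t\<ge>0. (y has_real_derivative - H (y t)) (at t within {0..})"
    and y_0: "y 0 = g 0"
    and \<alpha>0: "0 < \<alpha>0" "\<alpha>0 < 1"
    and y_L1: "set_integrable lborel {0..} (\<lambda>t. y t powr (1 - \<alpha>0))"
    and \<delta>: "\<delta> > 0"
    and H_C2: "\<forall>x\<in>{0<..<\<delta>}. (H' has_real_derivative H'' x) (at x)"
              "continuous_on {0<..<\<delta>} H''"
    and H_ineq: "\<forall>x\<in>{0<..<\<delta>}. x\<^sup>2 * H'' x - x * H' x + H x \<ge> 0"
    and l0: "l0 > 0"
    and poincare: "\<forall>v\<in>domR. norm v \<le> l0 * norm (R v)"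
    and \<gamma>_pos: "\<gamma> > 0"
    and data: "u0 \<in> domR" "u1 \<in> domR"
  shows "\<exists>u. weak_solution domR R \<tau> \<alpha> b c g u0 u1 u2 u \<and>
             (\<forall>w. weak_solution domR R \<tau> \<alpha> b c g u0 u1 u2 w \<longrightarrow> (\<forall>t\<ge>0. w t = u t))"
proof -
  \<comment> \<open>Both directions are used: existence is carried back from the copy by
    \<open>of_copy\<close>, while for uniqueness an arbitrary solution is carried forward by
    \<open>to_copy\<close> and compared there.\<close>
  interpret to_copy: hilbert_isometry "to_copy :: 'a \<Rightarrow> 'a hilbert_copy" of_copy
    by (rule hilbert_isometry_to_copy)
  interpret of_copy: hilbert_isometry of_copy "to_copy :: 'a \<Rightarrow> 'a hilbert_copy"
    by (rule to_copy.inverse_isometry)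
  let ?E = "to_copy ` domR" and ?S = "\<lambda>y. to_copy (R (of_copy y))"
  have "self_adjoint_operator domR R" "positive_operator domR R"
    using R by (auto simp: is_operator_sqrt_def)
  then have "self_adjoint_operator ?E ?S" "positive_operator ?E ?S"
    by (simp_all add: to_copy.self_adjoint_transport to_copy.positive_transport)
  moreover have "norm v \<le> l0 * norm (?S v)" if "v \<in> ?E" for v
    using that poincare by (auto simp: to_copy.norm)
  ultimately obtain U where U: "weak_solution ?E ?S \<tau> \<alpha> b c g (to_copy u0) (to_copy u1) (to_copy u2) U"
    and uniq: "\<And>w t. weak_solution ?E ?S \<tau> \<alpha> b c g (to_copy u0) (to_copy u1) (to_copy u2) w \<Longrightarrow>
      t \<ge> 0 \<Longrightarrow> w t = U t"
    using weak_solution_well_posed[of ?E ?S l0 \<tau> b \<alpha> g g' "to_copy u0" "to_copy u1" c "to_copy u2"]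
      l0 constants g_C1 data by auto
  show ?thesis
  proof (intro exI conjI allI impI)
    show "weak_solution domR R \<tau> \<alpha> b c g u0 u1 u2 (\<lambda>t. of_copy (U t))"
      using of_copy.weak_solution_transport[OF U] by (simp add: image_image)
    fix w t assume "weak_solution domR R \<tau> \<alpha> b c g u0 u1 u2 w" and "(t :: real) \<ge> 0"
    then have "to_copy (w t) = U t" using uniq[OF to_copy.weak_solution_transport] by blast
    then show "w t = of_copy (U t)" by (metis copy_simps(2))
  qed
qed

end
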